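(* Let $0<\delta_1\le\delta_2<1$ be real numbers and let $b,q\ge2$ be two integers such that $\gcd(b,q-1)=1$. There exist a constant $C=C(\delta_1,\delta_2,b,q)>0$ and an exponent $\eta=\eta(\delta_1,\delta_2,b,q)>0$ such that for every real $x>0$, every integer $D$ with $x^{\delta_1}\le D\le x^{\delta_2}$ and every integer $a$, $$\sum_{D<m\le qD}\ \max_{y,z:\ 0\le y<z,\ z-y\le x}\ \max_{r\ge0}\left|N_{y,z}(a,b;r,m)-\frac{z-y}{bm}\right|\le Cx^{1-\eta}.$$ An admissible value for $\eta$ is $$\eta=\frac{\delta_1(1-\delta_2)^2\min\left(1/4,\,3\log_q(P^-(q))\right)}{1800\cdot 8^{(1-\delta_2)^{-1}}\left(\log(4q/(1-\delta_2))+5b\log(q)/(1-\delta_2)\right)}\exp\left(-\frac{5}{1-\delta_2}\left(\log(4q(1-\delta_2)^{-1})+\frac{5b\log q}{1-\delta_2}\right)\right).$$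
   Context: For an integer $n\ge 0$ with base-$q$ expansion $n=\sum_{k\ge0}n_kq^k$, $n_k\in\{0,\dots,q-1\}$, put $s_q(n)=\sum_{k\ge 0}n_k$. For real numbers $0\le y<z$ and integers $a,b,r,m$, $$N_{y,z}(a,b;r,m)=\left|\{n\in\mathbb{Z}: y\le n<z,\ s_q(n)\equiv a \pmod b,\ n\equiv r\pmod m\}\right|.$$ The maximum over $y,z$ is over real numbers, the maximum over $r$ is over integers $r\ge 0$ (maxima may be read as suprema), and $m$ runs over integers. $P^-(q)$ is the smallest prime divisor of $q$ and $\log_q(x)=\log x/\log q$. *)

theory Defs
  imports "HOL-Analysis.Analysis" "HOL-Number_Theory.Number_Theory"
begin

(* The digits at positions k with q ^ k > n vanish, so the sum ranges over finitely many k
   as soon as q \<ge> 2. *)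
definition digit_sum :: "nat \<Rightarrow> nat \<Rightarrow> nat" where
  "digit_sum q n = (\<Sum>k | q ^ k \<le> n. n div q ^ k mod q)"

(* Only used for y \<ge> 0, so the integers n with y \<le> n are natural numbers. *)
definition count_AP :: "nat \<Rightarrow> real \<Rightarrow> real \<Rightarrow> int \<Rightarrow> nat \<Rightarrow> int \<Rightarrow> int \<Rightarrow> nat" where
  "count_AP q y z a b r m =
     card {n :: nat. y \<le> real n \<and> real n < z \<and>
                     [int (digit_sum q n) = a] (mod int b) \<and> [int n = r] (mod m)}"

definition AP_error :: "nat \<Rightarrow> nat \<Rightarrow> int \<Rightarrow> int \<Rightarrow> real \<Rightarrow> real \<Rightarrow> int \<Rightarrow> real" where
  "AP_error q b a m y z r =
     \<bar>real (count_AP q y z a b r m) - (z - y) / (real b * real_of_int m)\<bar>"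

definition max_AP_error :: "nat \<Rightarrow> nat \<Rightarrow> int \<Rightarrow> real \<Rightarrow> int \<Rightarrow> real" where
  "max_AP_error q b a x m =
     (SUP (y, z) \<in> {(y, z). 0 \<le> y \<and> y < z \<and> z - y \<le> x}. SUP r \<in> {r :: int. 0 \<le> r}. AP_error q b a m y z r)"

definition distribution_bound ::
    "real \<Rightarrow> real \<Rightarrow> nat \<Rightarrow> nat \<Rightarrow> real \<Rightarrow> real \<Rightarrow> bool" where
  "distribution_bound \<delta>\<^sub>1 \<delta>\<^sub>2 b q C \<eta> \<longleftrightarrow>
     (\<forall>x :: real. \<forall>D a :: int.
        0 < x \<longrightarrow> x powr \<delta>\<^sub>1 \<le> real_of_int D \<longrightarrow> real_of_int D \<le> x powr \<delta>\<^sub>2 \<longrightarrow>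
        (\<Sum>m \<in> {D<..int q * D}. max_AP_error q b a x m) \<le> C * x powr (1 - \<eta>))"

definition least_prime_divisor :: "nat \<Rightarrow> nat" where
  "least_prime_divisor q = (LEAST p. prime p \<and> p dvd q)"

definition eta_admissible :: "real \<Rightarrow> real \<Rightarrow> nat \<Rightarrow> nat \<Rightarrow> real" where
  "eta_admissible \<delta>\<^sub>1 \<delta>\<^sub>2 b q =
     \<delta>\<^sub>1 * (1 - \<delta>\<^sub>2)\<^sup>2 * min (1/4) (3 * log (real q) (real (least_prime_divisor q)))
     / (1800 * 8 powr (1 / (1 - \<delta>\<^sub>2))
          * (ln (4 * real q / (1 - \<delta>\<^sub>2)) + 5 * real b * ln (real q) / (1 - \<delta>\<^sub>2)))
     * exp (- (5 / (1 - \<delta>\<^sub>2))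
              * (ln (4 * real q / (1 - \<delta>\<^sub>2)) + 5 * real b * ln (real q) / (1 - \<delta>\<^sub>2)))"

(* The suprema in max_AP_error are taken in the reals, where Sup of an unbounded set is
   unspecified. The following lemmas show that all suprema involved are over nonempty sets
   that are bounded above. *)

lemma AP_error_le:
  assumes "b \<ge> 1" "m \<ge> 1" "0 \<le> y" "y < z" "z - y \<le> x"
  shows "AP_error q b a m y z r \<le> x + 1"
proof -
  let ?S = "{n :: nat. y \<le> real n \<and> real n < z \<and>
                     [int (digit_sum q n) = a] (mod int b) \<and> [int n = r] (mod m)}"
  have "?S \<subseteq> {nat \<lceil>y\<rceil>..<nat \<lceil>z\<rceil>}"
    by (auto simp: nat_le_iff ceiling_le_iff zless_nat_eq_int_zless less_ceiling_iff)
  then have "card ?S \<le> nat \<lceil>z\<rceil> - nat \<lceil>y\<rceil>"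
    using card_mono[of "{nat \<lceil>y\<rceil>..<nat \<lceil>z\<rceil>}" ?S] by simp
  moreover have "real (nat \<lceil>z\<rceil> - nat \<lceil>y\<rceil>) \<le> z - y + 1"
  proof -
    have "nat \<lceil>y\<rceil> \<le> nat \<lceil>z\<rceil>"
      using assms by (intro nat_mono ceiling_mono) simp
    then have "real (nat \<lceil>z\<rceil> - nat \<lceil>y\<rceil>) = real (nat \<lceil>z\<rceil>) - real (nat \<lceil>y\<rceil>)"
      by (simp add: of_nat_diff)
    moreover have "real (nat \<lceil>z\<rceil>) = of_int \<lceil>z\<rceil>" "real (nat \<lceil>y\<rceil>) = of_int \<lceil>y\<rceil>"
      using assms by simp_all
    ultimately show ?thesis by linarith
  qed
  ultimately have 1: "real (count_AP q y z a b r m) \<le> z - y + 1"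
    unfolding count_AP_def by linarith
  have "1 * 1 \<le> real b * real_of_int m"
    using assms by (intro mult_mono) auto
  then have "(z - y) / (real b * real_of_int m) \<le> (z - y) / 1"
    using assms by (intro divide_left_mono) auto
  moreover have "0 \<le> (z - y) / (real b * real_of_int m)"
    using assms by auto
  moreover have "0 \<le> real (count_AP q y z a b r m)" by simp
  ultimately show ?thesis
    unfolding AP_error_def abs_le_iff using 1 assms(5) by simp
qed

lemma bdd_above_AP_error:
  assumes "b \<ge> 1" "m \<ge> 1" "0 \<le> y" "y < z"
  shows "bdd_above (AP_error q b a m y z ` {r :: int. 0 \<le> r})"
  using AP_error_le[OF assms order.refl] by (intro bdd_aboveI2)

lemma bdd_above_SUP_AP_error:
  assumes "b \<ge> 1" "m \<ge> 1"
  shows "bdd_above ((\<lambda>(y, z). SUP r \<in> {r :: int. 0 \<le> r}. AP_error q b a m y z r)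
           ` {(y, z). 0 \<le> y \<and> y < z \<and> z - y \<le> x})"
proof (rule bdd_aboveI2)
  fix p :: "real \<times> real"
  assume "p \<in> {(y, z). 0 \<le> y \<and> y < z \<and> z - y \<le> x}"
  then show "(case p of (y, z) \<Rightarrow> SUP r \<in> {r :: int. 0 \<le> r}. AP_error q b a m y z r) \<le> x + 1"
    using assms by (auto intro!: cSUP_least AP_error_le)
qed

lemma interval_pairs_nonempty:
  assumes "(0 :: real) < x"
  shows "{(y, z). 0 \<le> y \<and> y < z \<and> z - y \<le> x} \<noteq> {}"
proof -
  have "(0, x) \<in> {(y, z). 0 \<le> y \<and> y < z \<and> z - y \<le> x}"
    using assms by simp
  then show ?thesis by blast
qed

end

theory Submission
  imports Defs
begin

text \<open>
  Detecting the residue of the digit sum by additive characters, one has to bound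
  \<open>\<Sum>\<^bsub>k < K\<^esub> f (r + m * k)\<close> with \<open>f n = z ^ digit_sum q n\<close>, uniformly in \<open>r\<close> and on average over
  \<open>m\<close>, where \<open>K\<close> may be as short as a small power of \<open>m\<close> and \<open>z ^ (q - 1) \<noteq> 1\<close>.

  Van der Corput's inequality is applied \<open>s + 1\<close> times, the \<open>i\<close>-th time with shifts of \<open>k\<close> by multiples of
  a number \<open>\<kappa>\<^sub>i\<close> such that \<open>m * \<kappa>\<^sub>i\<close> is close to a multiple of a power of \<open>q\<close> (Dirichlet
  approximation, and a Bezout relation at the end). Such a shift leaves the digits of \<open>r + m * k\<close> between two
  levels unchanged unless a carry occurs, so that these digits cancel in the product over the vertices of
  the cube of shifts. After all steps only the lowest \<open>\<rho>\<close> digits are left, and for most \<open>m\<close> the numbers \<open>\<kappa>\<^sub>i\<close> have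
  a small common factor with powers of \<open>q\<close>, so the shifts are nearly equidistributed modulo \<open>q ^ \<rho>\<close>. Since the
  remaining averages are non-negative, restricted shifts may be replaced by all shifts at
  the price of a small factor. This leaves a Gowers norm of the truncated phase. Its recurrence in the number of digits
  contracts because two choices of low digits lead to the same carries and to phases that differ by
  \<open>z ^ (q - 1)\<close>.
\<close>

section \<open>Digit sums\<close>

text \<open>The obstacle is the length of the sums, about x / D, against the d digits of
  \<open>m\<close>: one van der Corput step lowers the digit level by only
  \<open>6 * \<rho>\<close>, where \<open>\<rho>\<close> is about (1 -
  \<open>\<delta>\<^sub>2\<close>) d / 16, so roughly 3 / (1 - \<open>\<delta>\<^sub>2\<close>)
  steps are needed. Each step squares the sum; the resulting exponent \<open>2 ^ (s + 1)\<close> is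
  the origin of \<open>8 powr (1 / (1 - \<delta>\<^sub>2))\<close> in the admissible exponent. The
  cube has dimension \<open>s + 1\<close>, and a block of \<open>L0\<close> digits saves only about
  1 / b^2 out of \<open>(q ^ L0) ^ (s + 2)\<close> terms; this is the origin of the exponential
  factor. A single parameter \<open>J\<close> balances the losses. Powers \<open>p ^ J\<close> of
  primes dividing \<open>q\<close> are forbidden in \<open>m\<close> and in the multipliers, which
  excludes a proportion of order \<open>2 ^ - J\<close> of the moduli. Replacing shifts by all
  residues costs \<open>q ^ ((2 * s + 2) * J + 1)\<close>, and \<open>J\<close> is so small a
  multiple of \<open>\<rho>\<close> that the contraction wins. The maxima over intervals and residue
  classes need no argument of their own: the bound attached to a modulus holds for every offset and
  every length up to \<open>N\<close>.\<close>

lemma digit_sum_eq_bounded: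
  assumes q: "q \<ge> 2" and n: "n < q ^ L"
  shows "digit_sum q n = (\<Sum>k<L. n div q ^ k mod q)"
  unfolding digit_sum_def
proof (rule sum.mono_neutral_left)
  show "{k. q ^ k \<le> n} \<subseteq> {..<L}"
  proof
    fix k assume "k \<in> {k. q ^ k \<le> n}"
    then have "q ^ k < q ^ L" using n by simp
    then show "k \<in> {..<L}" using q by (simp add: power_strict_increasing_iff)
  qed
qed auto

lemma digit_sum_bound_exists:
  assumes "(q::nat) \<ge> 2"
  shows "\<exists>L. (n::nat) < q ^ L"
  using power_gt_expt[of q n] assms by auto

lemma sum_lessThan_add:
  "(\<Sum>k<L+M. f k) = (\<Sum>k<L. f k) + (\<Sum>k<M. f (L + k))" for f :: "nat \<Rightarrow> 'a :: comm_monoid_add"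
  by (induction M) (simp_all add: add.assoc)

lemma digit_sum_block:
  assumes q: "q \<ge> 2" and a: "a < q ^ L"
  shows "digit_sum q (a + q ^ L * c) = digit_sum q a + digit_sum q c"
proof -
  obtain M where M: "c < q ^ M" using digit_sum_bound_exists[OF q] by blast
  have *: "a + q ^ L * c < q ^ (L + M)"
  proof -
    have "a + q ^ L * c < q ^ L * (c + 1)" using a by simp
    also have "\<dots> \<le> q ^ L * q ^ M" using M by (intro mult_left_mono) auto
    finally show ?thesis by (simp add: power_add)
  qed
  have "digit_sum q (a + q ^ L * c) = (\<Sum>k<L+M. (a + q ^ L * c) div q ^ k mod q)"
    by (rule digit_sum_eq_bounded[OF q *])
  also have "\<dots> = (\<Sum>k<L. (a + q ^ L * c) div q ^ k mod q) +
      (\<Sum>k<M. (a + q ^ L * c) div q ^ (L + k) mod q)"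
    by (rule sum_lessThan_add)
  also have "(\<Sum>k<L. (a + q ^ L * c) div q ^ k mod q) = (\<Sum>k<L. a div q ^ k mod q)"
  proof (rule sum.cong[OF refl])
    fix k assume "k \<in> {..<L}"
    then obtain j where j: "L = k + Suc j" by (metis less_iff_Suc_add add_Suc_right lessThan_iff)
    have "(a + q ^ L * c) div q ^ k = a div q ^ k + q * (q ^ j * c)"
    proof -
      have "a + q ^ L * c = a + q ^ k * (q * (q ^ j * c))" by (simp add: j power_add)
      then show ?thesis using q by (metis div_mult_self2 not_numeral_le_zero power_not_zero add.commute)
    qed
    then show "(a + q ^ L * c) div q ^ k mod q = a div q ^ k mod q" by simp
  qed
  also have "\<dots> = digit_sum q a" by (rule digit_sum_eq_bounded[OF q a, symmetric])
  also have "(\<Sum>k<M. (a + q ^ L * c) div q ^ (L + k) mod q) = (\<Sum>k<M. c div q ^ k mod q)"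
    using a q by (intro sum.cong refl) (simp add: power_add div_mult2_eq)
  also have "\<dots> = digit_sum q c" by (rule digit_sum_eq_bounded[OF q M, symmetric])
  finally show ?thesis .
qed

lemma digit_sum_split:
  assumes "q \<ge> 2"
  shows "digit_sum q n = digit_sum q (n mod q ^ L) + digit_sum q (n div q ^ L)"
  using digit_sum_block[of q "n mod q ^ L" L "n div q ^ L"] assms by simp

lemma digit_sum_0 [simp]: "q \<ge> 2 \<Longrightarrow> digit_sum q 0 = 0"
  using digit_sum_eq_bounded[of q 0 0] by simp

lemma digit_sum_less:
  assumes "q \<ge> 2" "n < q"
  shows "digit_sum q n = n"
  using digit_sum_eq_bounded[of q n 1] assms by simp

lemma digit_sum_power_minus_one:
  assumes q: "q \<ge> 2"
  shows "digit_sum q (q ^ c - 1) = c * (q - 1)"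
proof (induction c)
  case (Suc c)
  have "q ^ Suc c - 1 = (q - 1) + q ^ 1 * (q ^ c - 1)"
  proof -
    obtain x y where x: "q = Suc x" and y: "q ^ c = Suc y"
      using q by (metis Suc_pred gr0I not_numeral_le_zero zero_less_power)
    show ?thesis by (simp add: y) (simp add: x)
  qed
  then show ?case
    using digit_sum_block[OF q, of "q - 1" 1 "q ^ c - 1"] Suc digit_sum_less[OF q, of "q - 1"] q by simp
qed (use q in simp)

text \<open>The carry clears all digits \<open>q - 1\<close> and leaves a leading 1 above
  \<open>e - 1\<close>. The value no longer depends on \<open>c\<close>, so blocks of different
  length become indistinguishable as soon as a positive shift is added.\<close>

lemma digit_sum_past_power:
  assumes q: "q \<ge> 2" and e: "1 \<le> e" "e \<le> q ^ c"
  shows "digit_sum q (q ^ c - 1 + e) = 1 + digit_sum q (e - 1)"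
proof -
  have "q ^ c - 1 + e = (e - 1) + q ^ c * 1" using e q by simp
  then show ?thesis
    using digit_sum_block[OF q, of "e - 1" c 1] e digit_sum_less[OF q, of 1] q by simp
qed

section \<open>Cubes of phases and the Gowers norm recurrence\<close>

text \<open>Factors are conjugated at vertices with an odd number of shifts. \<open>G\<close> may
  depend on the vertex because, once low digits are split off, the carries into the remaining digits
  differ from vertex to vertex.\<close>

primrec cube :: "(bool list \<Rightarrow> nat \<Rightarrow> complex) \<Rightarrow> nat list \<Rightarrow> nat \<Rightarrow> complex" where
  "cube G [] v = G [] v"
| "cube G (w # ws) v = cube (\<lambda>e. G (False # e)) ws v * cnj (cube (\<lambda>e. G (True # e)) ws (v + w))"

text \<open>Each direction has its own range, since the last van der Corput step uses fewer shifts
  than the others.\<close>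

primrec msum :: "nat list \<Rightarrow> (nat list \<Rightarrow> real) \<Rightarrow> real" where
  "msum [] Z = Z []"
| "msum (T # Ts) Z = (\<Sum>h<T. msum Ts (\<lambda>hs. Z (h # hs)))"

lemma msum_mono:
  assumes "\<And>hs. list_all2 (<) hs Ts \<Longrightarrow> Z hs \<le> Z' hs"
  shows "msum Ts Z \<le> msum Ts Z'"
  using assms by (induction Ts arbitrary: Z Z') (auto intro!: sum_mono)

lemma msum_cong:
  assumes "\<And>hs. list_all2 (<) hs Ts \<Longrightarrow> Z hs = Z' hs"
  shows "msum Ts Z = msum Ts Z'"
  using assms by (intro antisym msum_mono) auto

lemma msum_const: "msum Ts (\<lambda>_. c) = real (prod_list Ts) * c"
  by (induction Ts) auto

lemma msum_cmult: "msum Ts (\<lambda>hs. c * Z hs) = c * msum Ts Z"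
  by (induction Ts arbitrary: Z) (auto simp: sum_distrib_left)

lemma msum_add: "msum Ts (\<lambda>hs. Z hs + Z' hs) = msum Ts Z + msum Ts Z'"
  by (induction Ts arbitrary: Z Z') (auto simp: sum.distrib)

lemma msum_zero: "msum Ts (\<lambda>_. 0) = 0"
  by (induction Ts) auto

lemma msum_sum: "msum Ts (\<lambda>hs. \<Sum>x\<in>A. Z x hs) = (\<Sum>x\<in>A. msum Ts (Z x))"
  by (induction A rule: infinite_finite_induct) (auto simp: msum_add msum_zero)

lemma msum_nonneg:
  assumes "\<And>hs. list_all2 (<) hs Ts \<Longrightarrow> 0 \<le> Z hs"
  shows "0 \<le> msum Ts Z"
  using msum_mono[of Ts "\<lambda>_. 0" Z] assms by (simp add: msum_zero)

text \<open>A saving at one tuple among all is tiny, but in the recurrence it is collected again for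
  every block of digits.\<close>

lemma msum_le_special:
  assumes "\<And>hs. list_all2 (<) hs Ts \<Longrightarrow> Z hs \<le> A"
    and "list_all2 (<) cs Ts" "Z cs \<le> A - \<delta>"
  shows "msum Ts Z \<le> real (prod_list Ts) * A - \<delta>"
  using assms
proof (induction Ts arbitrary: Z cs)
  case (Cons T Ts)
  then obtain c cs' where cs: "cs = c # cs'" "c < T" "list_all2 (<) cs' Ts"
    by (auto simp: list_all2_Cons2)
  have "msum (T # Ts) Z = msum Ts (\<lambda>hs. Z (c # hs)) + (\<Sum>h\<in>{..<T} - {c}. msum Ts (\<lambda>hs. Z (h # hs)))"
    using cs by (simp add: sum.remove)
  also have "msum Ts (\<lambda>hs. Z (c # hs)) \<le> real (prod_list Ts) * A - \<delta>"
    using Cons.prems cs by (intro Cons.IH[of _ cs']) auto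
  also have "(\<Sum>h\<in>{..<T} - {c}. msum Ts (\<lambda>hs. Z (h # hs))) \<le> (\<Sum>h\<in>{..<T} - {c}. real (prod_list Ts) * A)"
    unfolding msum_const[symmetric] using Cons.prems by (intro sum_mono msum_mono) auto
  also have "\<dots> = (real T - 1) * (real (prod_list Ts) * A)"
    using cs by (simp add: of_nat_diff)
  finally show ?case by (simp add: algebra_simps)
qed auto

lemma sum_lessThan_mult:
  "(\<Sum>h<a * b. g h) = (\<Sum>c<a. \<Sum>w<b. g (c + a * w))" for g :: "nat \<Rightarrow> 'a :: comm_monoid_add"
proof -
  have "(\<Sum>h<a * b. g h) = (\<Sum>w<b. \<Sum>c<a. g (c + a * w))"
  proof (induction b)
    case (Suc b)
    have "(\<Sum>h<a * Suc b. g h) = (\<Sum>h<a * b + a. g h)" by (simp add: add.commute)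
    also have "\<dots> = (\<Sum>h<a * b. g h) + (\<Sum>c<a. g (c + a * b))"
      unfolding sum_lessThan_add by (simp add: add.commute)
    finally show ?case by (simp add: Suc)
  qed simp
  then show ?thesis by (simp add: sum.swap[of _ "{..<b}"])
qed

text \<open>Splits every shift into low part \<open>c\<close> and high part \<open>w\<close>; for
  powers of \<open>q\<close> these are blocks of digits.\<close>

lemma msum_block:
  "msum (replicate n (a * b)) Z =
   msum (replicate n a) (\<lambda>cs. msum (replicate n b) (\<lambda>ws. Z (map2 (\<lambda>c w. c + a * w) cs ws)))"
proof (induction n arbitrary: Z)
  case (Suc n)
  show ?case
    by (simp add: sum_lessThan_mult Suc msum_sum sum.swap[of _ "{..<a}" "{..<b}"])
qed auto

definition dotb :: "bool list \<Rightarrow> nat list \<Rightarrow> nat" where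
  "dotb e cs = sum_list (map2 (\<lambda>b c. if b then c else 0) e cs)"

lemma dotb_simps [simp]:
  "dotb [] cs = 0" "dotb (b # e) (c # cs) = (if b then c else 0) + dotb e cs"
  by (simp_all add: dotb_def)

lemma dotb_le:
  assumes "list_all (\<lambda>c. c \<le> A) cs" "length e = length cs"
  shows "dotb e cs \<le> length cs * A"
  using assms
proof (induction cs arbitrary: e)
  case (Cons c cs)
  then obtain x e' where e: "e = x # e'" "length e' = length cs" by (auto simp: length_Suc_conv)
  from Cons.IH[OF _ e(2)] Cons.prems show ?case by (auto simp: e)
qed auto

lemma dotb_replicate:
  "length e = n \<Longrightarrow> dotb e (replicate n A) = A * count_list e True"
  by (induction n arbitrary: e) (auto simp: length_Suc_conv)

lemma cube_cong:
  assumes "\<And>e v. length e = length ws \<Longrightarrow> G e v = H e v"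
  shows "cube G ws v = cube H ws v"
  using assms
proof (induction ws arbitrary: G H v)
  case (Cons w ws)
  have "cube (\<lambda>e. G (b # e)) ws u = cube (\<lambda>e. H (b # e)) ws u" for b u
    by (rule Cons.IH) (simp add: Cons.prems)
  then show ?case by simp
qed auto

lemma norm_cube_le_1:
  assumes "\<And>e v. norm (G e v) \<le> 1"
  shows "norm (cube G ws v) \<le> 1"
  using assms
proof (induction ws arbitrary: G v)
  case (Cons w ws)
  show ?case using Cons.IH[of "\<lambda>e. G (False # e)" v] Cons.IH[of "\<lambda>e. G (True # e)" "v + w"] Cons.prems
    by (auto simp: norm_mult intro!: mult_le_one)
qed auto

lemma norm_cube_eq_1:
  assumes "\<And>e v. norm (G e v) = 1"
  shows "norm (cube G ws v) = 1"
  using assms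
proof (induction ws arbitrary: G v)
  case (Cons w ws)
  show ?case using Cons.IH[of "\<lambda>e. G (False # e)" v] Cons.IH[of "\<lambda>e. G (True # e)" "v + w"] Cons.prems
    by (auto simp: norm_mult)
qed auto

text \<open>If two base points give different values only at the vertex without shifts, the ratio of the two
  products is the ratio at that vertex.\<close>

lemma cube_replicate_ratio:
  assumes "\<And>e. length e = n \<Longrightarrow> G e (x2 + A * count_list e True) =
              (if count_list e True = 0 then \<zeta> else 1) * G e (x1 + A * count_list e True)"
  shows "cube G (replicate n A) x2 = \<zeta> * cube G (replicate n A) x1"
  using assms
proof (induction n arbitrary: G x1 x2 \<zeta>)
  case 0
  from "0.prems"[of "[]"] show ?case by simp
next
  case (Suc n)
  have 1: "cube (\<lambda>e. G (False # e)) (replicate n A) x2 = \<zeta> * cube (\<lambda>e. G (False # e)) (replicate n A) x1"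
  proof (rule Suc.IH)
    fix e :: "bool list" assume "length e = n"
    with Suc.prems[of "False # e"]
    show "G (False # e) (x2 + A * count_list e True) =
        (if count_list e True = 0 then \<zeta> else 1) * G (False # e) (x1 + A * count_list e True)" by simp
  qed
  have 2: "cube (\<lambda>e. G (True # e)) (replicate n A) (x2 + A) = 1 * cube (\<lambda>e. G (True # e)) (replicate n A) (x1 + A)"
  proof (rule Suc.IH)
    fix e :: "bool list" assume "length e = n"
    with Suc.prems[of "True # e"]
    show "G (True # e) (x2 + A + A * count_list e True) =
        (if count_list e True = 0 then 1 else 1) * G (True # e) (x1 + A + A * count_list e True)"
      by (simp add: algebra_simps)
  qed
  show ?case using 1 2 by simp
qed

section \<open>Truncated phases, carries between digit blocks, and contraction\<close>

definition phase :: "nat \<Rightarrow> complex \<Rightarrow> nat \<Rightarrow> nat \<Rightarrow> complex" where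
  "phase q z L v = z ^ digit_sum q (v mod q ^ L)"

lemma norm_phase [simp]: "norm z = 1 \<Longrightarrow> norm (phase q z L v) = 1"
  by (simp add: phase_def norm_power)

lemma phase_block:
  assumes q: "q \<ge> 2"
  shows "phase q z (L0 + L) (x + q ^ L0 * y) = phase q z L0 x * phase q z L (y + x div q ^ L0)"
proof -
  let ?n = "x + q ^ L0 * y"
  have "?n mod q ^ (L0 + L) = ?n mod q ^ L0 + q ^ L0 * ((?n div q ^ L0) mod q ^ L)"
    by (simp add: power_add mod_mult2_eq)
  also have "?n mod q ^ L0 = x mod q ^ L0" by simp
  also have "?n div q ^ L0 = y + x div q ^ L0" using q by simp
  finally show ?thesis
    unfolding phase_def using q digit_sum_block[OF q, of "x mod q ^ L0" L0]
    by (simp add: power_add)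
qed

text \<open>The low block of base point and shifts decides its own factor completely and acts on the
  high block only through the carry \<open>(x + dotb e cs + r e) div q ^ L0\<close>, which is a new
  offset function of the same kind as \<open>r\<close>.\<close>

lemma cube_block:
  assumes q: "q \<ge> 2" and "length cs = length ws"
  shows "cube (\<lambda>e v. phase q z (L0 + L) (v + r e)) (map2 (\<lambda>c w. c + q ^ L0 * w) cs ws) (x + q ^ L0 * y) =
         cube (\<lambda>e v. phase q z L0 (v + r e)) cs x *
         cube (\<lambda>e v. phase q z L (v + (x + dotb e cs + r e) div q ^ L0)) ws y"
  using assms(2)
proof (induction cs ws arbitrary: r x y rule: list_induct2)
  case Nil
  show ?case
    using phase_block[OF q, of z L0 L "x + r []" y] by (simp add: algebra_simps)
next
  case (Cons c cs w ws)
  have eq: "x + q ^ L0 * y + (c + q ^ L0 * w) = (x + c) + q ^ L0 * (y + w)" by (simp add: algebra_simps)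
  show ?case
    using Cons.IH[of "\<lambda>e. r (False # e)" x y] Cons.IH[of "\<lambda>e. r (True # e)" "x + c" "y + w"]
    unfolding zip_Cons_Cons list.map case_prod_conv cube.simps(2) eq dotb_simps if_True if_False
    by (simp only: add.assoc complex_cnj_mult mult_ac add_0)
qed

text \<open>The function \<open>r\<close> records the carries at the vertices coming from the digits already summed
  over.\<close>

definition bav :: "nat \<Rightarrow> complex \<Rightarrow> nat \<Rightarrow> nat \<Rightarrow> (bool list \<Rightarrow> nat) \<Rightarrow> real" where
  "bav q z n L r = msum (replicate n (q ^ L))
     (\<lambda>ws. norm (\<Sum>v<q ^ L. cube (\<lambda>e v. phase q z L (v + r e)) ws v))"

lemma bav_trivial:
  assumes "norm z = 1"
  shows "bav q z n L r \<le> real (q ^ L) ^ (n + 1)"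
proof -
  have "bav q z n L r \<le> msum (replicate n (q ^ L)) (\<lambda>_. real (q ^ L))"
    unfolding bav_def
  proof (rule msum_mono)
    fix ws
    have "norm (\<Sum>v<q ^ L. cube (\<lambda>e v. phase q z L (v + r e)) ws v) \<le> (\<Sum>v<q ^ L. 1)"
      using assms by (intro sum_norm_le) (simp add: norm_cube_eq_1)
    then show "norm (\<Sum>v<q ^ L. cube (\<lambda>e v. phase q z L (v + r e)) ws v) \<le> real (q ^ L)" by simp
  qed
  also have "\<dots> = real (q ^ L) ^ (n + 1)"
    by (simp add: msum_const prod_list_replicate)
  finally show ?thesis .
qed

text \<open>The total is at most (Q - 1) + n (Q - 1) + n = (n + 1) Q - 1. So the class of offsets
  bounded by \<open>n\<close> is preserved from block to block, and the recurrence closes.\<close>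

lemma carry_le:
  assumes "x < Q" "list_all2 (<) cs (replicate n Q)" "length e = n" "r e \<le> n"
  shows "(x + dotb e cs + r e) div Q \<le> n"
proof -
  have len: "length cs = n" using assms(2) by (auto dest: list_all2_lengthD)
  have "list_all (\<lambda>c. c \<le> Q - 1) cs"
    using assms(2) by (auto simp: list_all_length list_all2_conv_all_nth len)
  then have "dotb e cs \<le> n * (Q - 1)" using dotb_le assms(3) len by metis
  then have "x + dotb e cs + r e \<le> (Q - 1) + n * (Q - 1) + n" using assms(1,4) by linarith
  also have "\<dots> < Suc n * Q"
  proof -
    obtain Q' where "Q = Suc Q'" using assms(1) by (cases Q) auto
    then show ?thesis by simp
  qed
  finally have "x + dotb e cs + r e < Suc n * Q" .
  then show ?thesis using assms(1) by (simp add: div_less_iff_less_mult less_Suc_eq_le[symmetric] del: mult_Suc)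
qed

text \<open>Two base points, \<open>q ^ a * (q ^ c - 1)\<close> and \<open>q ^ a * (q ^ (c + 1) - 1)\<close>, together with all shifts equal to
  \<open>q ^ a\<close>, produce no carry out of the block of \<open>L0\<close> digits. Any positive shift carries past the block of
  digits \<open>q - 1\<close>, so only the unshifted vertex sees the length of this block, and the two phases differ by
  the factor \<open>z ^ (q - 1)\<close>.\<close>

lemma bav_step:
  assumes q: "q \<ge> 2" and z: "norm z = 1" and \<delta>: "norm (1 + z ^ (q - 1)) \<le> 2 - \<delta>"
    and L0: "L0 = a + c + 2" and a: "n < q ^ a" and c: "n \<le> q ^ c"
    and r: "\<And>e. length e = n \<Longrightarrow> r e \<le> n"
    and M: "\<And>r'. (\<And>e. length e = n \<Longrightarrow> r' e \<le> n) \<Longrightarrow> bav q z n L r' \<le> M"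
  shows "bav q z n (L0 + L) r \<le> (real (q ^ L0) ^ (n + 1) - \<delta>) * M"
proof -
  define Q where "Q = q ^ L0"
  define ph where "ph cs x = cube (\<lambda>e v. phase q z L0 (v + r e)) cs x" for cs x
  define X where "X cs x ws = (\<Sum>y<q ^ L. cube (\<lambda>e v. phase q z L (v + (x + dotb e cs + r e) div Q)) ws y)"
    for cs x ws
  define W where "W cs = msum (replicate n (q ^ L)) (\<lambda>ws. norm (\<Sum>x<Q. ph cs x * X cs x ws))" for cs
  have nph: "norm (ph cs x) = 1" for cs x
    unfolding ph_def using z by (intro norm_cube_eq_1) simp
  have "bav q z n (L0 + L) r = msum (replicate n Q) (\<lambda>cs. msum (replicate n (q ^ L)) (\<lambda>ws.
      norm (\<Sum>v<Q * q ^ L. cube (\<lambda>e v. phase q z (L0 + L) (v + r e)) (map2 (\<lambda>c w. c + Q * w) cs ws) v)))"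
    unfolding bav_def by (simp add: power_add Q_def msum_block)
  also have "\<dots> = msum (replicate n Q) W"
    unfolding W_def
  proof (intro msum_cong)
    fix cs ws assume "list_all2 (<) cs (replicate n Q)" "list_all2 (<) ws (replicate n (q ^ L))"
    then have len: "length cs = length ws" by (simp add: list_all2_lengthD[of "(<)"])
    show "norm (\<Sum>v<Q * q ^ L. cube (\<lambda>e v. phase q z (L0 + L) (v + r e)) (map2 (\<lambda>c w. c + Q * w) cs ws) v) =
      norm (\<Sum>x<Q. ph cs x * X cs x ws)"
      unfolding sum_lessThan_mult X_def ph_def Q_def cube_block[OF q len] sum_distrib_left ..
  qed
  finally have eq: "bav q z n (L0 + L) r = msum (replicate n Q) W" .

  have XM: "msum (replicate n (q ^ L)) (\<lambda>ws. norm (X cs x ws)) \<le> M"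
    if "list_all2 (<) cs (replicate n Q)" "x < Q" for cs x
  proof -
    have "msum (replicate n (q ^ L)) (\<lambda>ws. norm (X cs x ws)) = bav q z n L (\<lambda>e. (x + dotb e cs + r e) div Q)"
      by (simp add: bav_def X_def)
    also have "\<dots> \<le> M" using that r by (intro M carry_le) auto
    finally show ?thesis .
  qed
  have WM: "W cs \<le> real Q * M" if cs: "list_all2 (<) cs (replicate n Q)" for cs
  proof -
    have "W cs \<le> msum (replicate n (q ^ L)) (\<lambda>ws. \<Sum>x<Q. norm (X cs x ws))"
      unfolding W_def by (intro msum_mono sum_norm_le) (simp add: norm_mult nph)
    also have "\<dots> = (\<Sum>x<Q. msum (replicate n (q ^ L)) (\<lambda>ws. norm (X cs x ws)))" by (rule msum_sum)
    also have "\<dots> \<le> (\<Sum>x<Q. M)" using XM cs by (intro sum_mono) auto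
    finally show ?thesis by simp
  qed

  define A where "A = q ^ a"
  define cs where "cs = replicate n A"
  define x1 where "x1 = A * (q ^ c - 1)"
  define x2 where "x2 = A * (q ^ Suc c - 1)"
  have Apos: "A > 0" using q by (simp add: A_def)
  have nA: "n < A" using a by (simp add: A_def)
  have QA: "Q = A * q ^ (c + 2)" by (simp add: Q_def L0 A_def power_add)
  have qc: "q ^ c \<ge> 1" using q by simp
  have qq: "2 * q ^ c \<le> q ^ Suc c" "2 * q ^ Suc c \<le> q ^ (c + 2)" using q by simp_all
  \<comment> \<open>Here the size \<open>a + c + 2\<close> of a block is used:
    \<open>N + j + 1\<close> is at most \<open>q ^ Suc c + q ^ c \<le> q ^ (c + 2)\<close>, and the
    incoming carry \<open>\<rho> \<le> n < A\<close> fits below the next multiple of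
    \<open>A\<close>.\<close>
  have small: "A * (N + j) + \<rho> < Q" if "N \<le> q ^ Suc c - 1" "j \<le> n" "\<rho> \<le> n" for N j \<rho>
  proof -
    have "N + j + 1 \<le> q ^ Suc c + q ^ c" using that c qc qq by linarith
    also have "\<dots> \<le> q ^ (c + 2)" using qq by linarith
    finally have "A * (N + j + 1) \<le> Q" unfolding QA by (intro mult_left_mono) auto
    then show ?thesis using that(3) nA by simp
  qed
  have x12: "x1 < x2" unfolding x1_def x2_def using Apos qc qq
    by (intro mult_strict_left_mono) linarith+
  have N1: "q ^ c - 1 \<le> q ^ Suc c - 1" using qq by linarith
  have x2Q: "x2 < Q" using small[of "q ^ Suc c - 1" 0 0] by (simp add: x2_def)
  then have x1Q: "x1 < Q" using x12 by simp
  have csQ: "list_all2 (<) cs (replicate n Q)"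
  proof -
    have "A < Q" if "n > 0" using small[of 0 1 0] Apos that by simp
    then show ?thesis unfolding cs_def by (auto simp: list_all2_conv_all_nth)
  qed
  have carry0: "(A * N + dotb e cs + r e) div Q = 0" if "N \<le> q ^ Suc c - 1" "length e = n" for N e
  proof -
    have "count_list e True \<le> n" using that count_le_length[of e True] by simp
    from small[OF that(1) this r[OF that(2)]] show ?thesis
      using that unfolding cs_def by (simp add: dotb_replicate algebra_simps)
  qed
  have X12: "X cs x2 ws = X cs x1 ws" if "list_all2 (<) ws (replicate n (q ^ L))" for ws
    unfolding X_def x1_def x2_def
  proof (intro sum.cong refl cube_cong)
    fix e :: "bool list" and y v
    assume "length e = length ws"
    then have e: "length e = n" using that by (auto dest: list_all2_lengthD)
    show "phase q z L (v + (A * (q ^ Suc c - 1) + dotb e cs + r e) div Q) =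
          phase q z L (v + (A * (q ^ c - 1) + dotb e cs + r e) div Q)"
      by (simp only: carry0[OF N1 e] carry0[OF order.refl e])
  qed
  have phv: "phase q z L0 (A * N + A * j + r e) = z ^ (digit_sum q (r e) + digit_sum q (N + j))"
    if "N \<le> q ^ Suc c - 1" "j \<le> n" "length e = n" for N j e
  proof -
    have "A * N + A * j + r e = r e + q ^ a * (N + j)" by (simp add: A_def algebra_simps)
    moreover have "A * N + A * j + r e < q ^ L0"
      using small[OF that(1,2) r[OF that(3)]] by (simp add: Q_def algebra_simps)
    moreover have "r e < q ^ a" using r[OF that(3)] a by simp
    ultimately show ?thesis using digit_sum_block[OF q, of "r e" a "N + j"] by (simp only: phase_def mod_less)
  qed
  have ratio: "ph cs x2 = z ^ (q - 1) * ph cs x1"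
    unfolding ph_def cs_def
  proof (rule cube_replicate_ratio)
    fix e :: "bool list" assume e: "length e = n"
    define j where "j = count_list e True"
    have j: "j \<le> n" unfolding j_def using e count_le_length[of e True] by simp
    have "digit_sum q (q ^ Suc c - 1 + j) = (if j = 0 then q - 1 else 0) + digit_sum q (q ^ c - 1 + j)"
    proof (cases "j = 0")
      case True
      then show ?thesis using digit_sum_power_minus_one[OF q, of c] digit_sum_power_minus_one[OF q, of "Suc c"] by simp
    next
      case False
      then show ?thesis
        using digit_sum_past_power[OF q, of j c] digit_sum_past_power[OF q, of j "Suc c"] j c qq
        by (simp del: power_Suc)
    qed
    then show "phase q z L0 (x2 + A * count_list e True + r e) =
       (if count_list e True = 0 then z ^ (q - 1) else 1) * phase q z L0 (x1 + A * count_list e True + r e)"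
      unfolding j_def[symmetric] x1_def x2_def phv[OF order.refl j e] phv[OF N1 j e]
      by (simp add: power_add del: power_Suc)
  qed
  have Wcs: "W cs \<le> real Q * M - \<delta> * M"
  proof -
    \<comment> \<open>The two special base points have the same high factor and are combined before
      norms are taken; all other base points are estimated by the triangle inequality.\<close>
    have pt: "norm (\<Sum>x<Q. ph cs x * X cs x ws) \<le> (2 - \<delta>) * norm (X cs x1 ws) + (\<Sum>x\<in>{..<Q}-{x1,x2}. norm (X cs x ws))"
      if ws: "list_all2 (<) ws (replicate n (q ^ L))" for ws
    proof -
      have "(\<Sum>x<Q. ph cs x * X cs x ws) = ph cs x1 * X cs x1 ws + (ph cs x2 * X cs x2 ws + (\<Sum>x\<in>{..<Q}-{x1}-{x2}. ph cs x * X cs x ws))"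
        using x1Q x2Q x12 by (simp add: sum.remove[of "{..<Q}" x1] sum.remove[of "{..<Q}-{x1}" x2])
      also have "\<dots> = (1 + z ^ (q - 1)) * (ph cs x1 * X cs x1 ws) + (\<Sum>x\<in>{..<Q}-{x1}-{x2}. ph cs x * X cs x ws)"
        by (simp add: X12[OF ws] ratio algebra_simps)
      also have "norm \<dots> \<le> norm (1 + z ^ (q - 1)) * norm (X cs x1 ws) + (\<Sum>x\<in>{..<Q}-{x1}-{x2}. norm (X cs x ws))"
        by (intro norm_triangle_le add_mono sum_norm_le) (simp_all add: norm_mult nph)
      also have "\<dots> \<le> (2 - \<delta>) * norm (X cs x1 ws) + (\<Sum>x\<in>{..<Q}-{x1}-{x2}. norm (X cs x ws))"
        using \<delta> by (intro add_mono mult_right_mono) auto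
      also have "{..<Q}-{x1}-{x2} = {..<Q}-{x1,x2}" by auto
      finally show ?thesis .
    qed
    have "W cs \<le> msum (replicate n (q ^ L)) (\<lambda>ws. (2 - \<delta>) * norm (X cs x1 ws) + (\<Sum>x\<in>{..<Q}-{x1,x2}. norm (X cs x ws)))"
      unfolding W_def by (intro msum_mono pt)
    also have "\<dots> = (2 - \<delta>) * msum (replicate n (q ^ L)) (\<lambda>ws. norm (X cs x1 ws)) +
       (\<Sum>x\<in>{..<Q}-{x1,x2}. msum (replicate n (q ^ L)) (\<lambda>ws. norm (X cs x ws)))"
      by (simp add: msum_add msum_cmult msum_sum)
    also have "\<dots> \<le> (2 - \<delta>) * M + (\<Sum>x\<in>{..<Q}-{x1,x2}. M)"
    proof (intro add_mono mult_left_mono sum_mono XM csQ x1Q)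
      show "0 \<le> 2 - \<delta>" using \<delta> norm_ge_zero[of "1 + z ^ (q - 1)"] by linarith
    qed auto
    also have "(\<Sum>x\<in>{..<Q}-{x1,x2}. M) = (real Q - 2) * M"
    proof -
      have "card {x1, x2} = 2" using x12 by simp
      then have "card ({..<Q}-{x1,x2}) = Q - 2" using x1Q x2Q by (subst card_Diff_subset) auto
      then show ?thesis using x1Q x2Q x12 by (simp add: of_nat_diff)
    qed
    finally show ?thesis by (simp add: algebra_simps)
  qed
  have "msum (replicate n Q) W \<le> real (prod_list (replicate n Q)) * (real Q * M) - \<delta> * M"
    by (rule msum_le_special[where cs = cs]) (use WM csQ Wcs in auto)
  also have "\<dots> = (real (q ^ L0) ^ (n + 1) - \<delta>) * M"
    by (simp add: prod_list_replicate Q_def algebra_simps)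
  finally show ?thesis using eq by simp
qed

text \<open>The first \<open>j\<close> blocks contract; the remaining \<open>L\<close> digits are
  estimated trivially.\<close>

lemma bav_iterate:
  assumes q: "q \<ge> 2" and z: "norm z = 1" and \<delta>: "norm (1 + z ^ (q - 1)) \<le> 2 - \<delta>"
    and L0: "L0 = a + c + 2" and a: "n < q ^ a" and c: "n \<le> q ^ c"
    and r: "\<And>e. length e = n \<Longrightarrow> r e \<le> n"
  shows "bav q z n (L0 * j + L) r \<le> (1 - \<delta> / real (q ^ L0) ^ (n + 1)) ^ j * real (q ^ (L0 * j + L)) ^ (n + 1)"
  using r
proof (induction j arbitrary: r)
  case 0
  then show ?case using bav_trivial[OF z] by simp
next
  case (Suc j)
  let ?P = "real (q ^ L0) ^ (n + 1)"
  have P: "?P > 0" using q by simp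
  have one_minus_div: "P - \<delta> = (1 - \<delta> / P) * P" if "P > 0" for P
    using that by (simp add: field_simps)
  have "bav q z n (L0 + (L0 * j + L)) r \<le> (?P - \<delta>) *
     ((1 - \<delta> / ?P) ^ j * real (q ^ (L0 * j + L)) ^ (n + 1))"
    by (rule bav_step[OF q z \<delta> L0 a c]) (use Suc in auto)
  also have "\<dots> = (1 - \<delta> / ?P) ^ Suc j * (?P * real (q ^ (L0 * j + L)) ^ (n + 1))"
    unfolding one_minus_div[OF P, THEN arg_cong[of _ _ "\<lambda>x. x * y" for y]] by (simp only: power_Suc mult_ac)
  also have "?P * real (q ^ (L0 * j + L)) ^ (n + 1) = real (q ^ (L0 * Suc j + L)) ^ (n + 1)"
    by (simp only: power_mult_distrib[symmetric] of_nat_mult[symmetric] power_add[symmetric] mult_Suc_right add.assoc)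
  finally show ?case by (simp add: add.assoc)
qed

text \<open>When \<open>m\<close> shares factors with \<open>q\<close>, the terms do not run through
  all residues, and cancellation has to be found inside a class modulo \<open>q ^ J\<close>. The
  lowest \<open>J\<close> digits then give only a unimodular factor and carries at most
  \<open>n\<close>, and the recurrence works on the other \<open>\<rho> - J\<close> digits.\<close>

lemma cube_phase_progression_bound:
  assumes q: "q \<ge> 2" and z: "norm z = 1" and \<delta>: "norm (1 + z ^ (q - 1)) \<le> 2 - \<delta>"
    and L0: "L0 = a + c + 2" and a: "n < q ^ a" and c: "n \<le> q ^ c"
    and J: "J \<le> \<rho>" and v: "v < q ^ J"
  shows "msum (replicate n (q ^ \<rho>)) (\<lambda>ws. norm (\<Sum>y<q ^ (\<rho> - J). cube (\<lambda>_. phase q z \<rho>) ws (v + q ^ J * y)))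
     \<le> (1 - \<delta> / real (q ^ L0) ^ (n + 1)) ^ ((\<rho> - J) div L0) * real (q ^ \<rho>) ^ n * real (q ^ (\<rho> - J))"
proof -
  define L where "L = \<rho> - J"
  have rho: "\<rho> = J + L" using J by (simp add: L_def)
  define K where "K = (1 - \<delta> / real (q ^ L0) ^ (n + 1)) ^ (L div L0) * real (q ^ L) ^ (n + 1)"
  have "msum (replicate n (q ^ \<rho>)) (\<lambda>ws. norm (\<Sum>y<q ^ L. cube (\<lambda>_. phase q z \<rho>) ws (v + q ^ J * y))) =
     msum (replicate n (q ^ J)) (\<lambda>cs. msum (replicate n (q ^ L)) (\<lambda>ws. norm (\<Sum>y<q ^ L. 
        cube (\<lambda>_. phase q z \<rho>) (map2 (\<lambda>c w. c + q ^ J * w) cs ws) (v + q ^ J * y))))"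
    by (simp add: rho power_add msum_block)
  also have "\<dots> \<le> msum (replicate n (q ^ J)) (\<lambda>cs. K)"
  proof (rule msum_mono)
    fix cs assume cs: "list_all2 (<) cs (replicate n (q ^ J))"
    have "msum (replicate n (q ^ L)) (\<lambda>ws. norm (\<Sum>y<q ^ L. 
        cube (\<lambda>_. phase q z \<rho>) (map2 (\<lambda>c w. c + q ^ J * w) cs ws) (v + q ^ J * y))) =
      bav q z n L (\<lambda>e. (v + dotb e cs) div q ^ J)"
      unfolding bav_def
    proof (rule msum_cong)
      fix ws assume "list_all2 (<) ws (replicate n (q ^ L))"
      then have len: "length cs = length ws" using cs by (simp add: list_all2_lengthD[of "(<)"])
      have "cube (\<lambda>_. phase q z \<rho>) (map2 (\<lambda>c w. c + q ^ J * w) cs ws) (v + q ^ J * y) =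
         cube (\<lambda>_. phase q z J) cs v * cube (\<lambda>e y. phase q z L (y + (v + dotb e cs) div q ^ J)) ws y" for y
        using cube_block[OF q len, of z J L "\<lambda>_. 0" v y] unfolding rho by simp
      then show "norm (\<Sum>y<q ^ L. cube (\<lambda>_. phase q z \<rho>) (map2 (\<lambda>c w. c + q ^ J * w) cs ws) (v + q ^ J * y)) =
         norm (\<Sum>y<q ^ L. cube (\<lambda>e y. phase q z L (y + (v + dotb e cs) div q ^ J)) ws y)"
        using z by (simp add: sum_distrib_left[symmetric] norm_mult norm_cube_eq_1)
    qed
    also have "\<dots> = bav q z n (L0 * (L div L0) + L mod L0) (\<lambda>e. (v + dotb e cs) div q ^ J)" by simp
    also have "\<dots> \<le> K"
      using bav_iterate[OF q z \<delta> L0 a c, of "\<lambda>e. (v + dotb e cs) div q ^ J" "L div L0" "L mod L0"]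
        carry_le[OF v cs, of _ "\<lambda>_. 0"] by (simp add: K_def)
    finally show "msum (replicate n (q ^ L)) (\<lambda>ws. norm (\<Sum>y<q ^ L. 
        cube (\<lambda>_. phase q z \<rho>) (map2 (\<lambda>c w. c + q ^ J * w) cs ws) (v + q ^ J * y))) \<le> K" .
  qed
  also have "\<dots> = (1 - \<delta> / real (q ^ L0) ^ (n + 1)) ^ (L div L0) * real (q ^ \<rho>) ^ n * real (q ^ L)"
    by (simp add: msum_const prod_list_replicate K_def rho power_add power_mult_distrib algebra_simps)
  finally show ?thesis by (simp add: L_def)
qed

section \<open>Iterated van der Corput inequality\<close>

lemma norm_sum_shift_diff:
  fixes g :: "nat \<Rightarrow> complex"
  assumes "\<And>k. norm (g k) \<le> 1"
  shows "norm ((\<Sum>k<K. g k) - (\<Sum>k<K. g (k + c))) \<le> 2 * real c"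
proof (induction c)
  case (Suc c)
  have tele: "(\<Sum>k<K. g (k + c)) - (\<Sum>k<K. g (k + Suc c)) = g c - g (K + c)"
    by (induction K) (auto simp: algebra_simps)
  have "(\<Sum>k<K. g k) - (\<Sum>k<K. g (k + Suc c)) = ((\<Sum>k<K. g k) - (\<Sum>k<K. g (k + c))) + (g c - g (K + c))"
    unfolding tele[symmetric] by simp
  also have "norm \<dots> \<le> 2 * real c + (norm (g c) + norm (g (K + c)))"
    by (intro norm_triangle_le add_mono Suc norm_triangle_ineq4)
  also have "\<dots> \<le> 2 * real (Suc c)" using assms[of c] assms[of "K + c"] by simp
  finally show ?case .
qed simp

lemma norm_sum_squared_le:
  fixes f :: "nat \<Rightarrow> complex"
  shows "(norm (\<Sum>k<K. f k))\<^sup>2 \<le> real K * (\<Sum>k<K. (norm (f k))\<^sup>2)"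
proof -
  have "(norm (\<Sum>k<K. f k))\<^sup>2 \<le> (\<Sum>k<K. norm (f k))\<^sup>2"
    by (intro power_mono norm_sum) auto
  also have "\<dots> = (\<Sum>k<K. 1 * norm (f k))\<^sup>2" by simp
  also have "\<dots> \<le> (\<Sum>k<K. 1\<^sup>2) * (\<Sum>k<K. (norm (f k))\<^sup>2)" by (rule Cauchy_Schwarz_ineq_sum)
  finally show ?thesis by simp
qed

lemma sum_pair_distance_le:
  fixes \<phi> :: "nat \<Rightarrow> real"
  assumes "\<And>h. \<phi> h \<ge> 0"
  shows "(\<Sum>t<T. \<Sum>t'<T. \<phi> (if t \<le> t' then t' - t else t - t')) \<le> 2 * real T * (\<Sum>h<T. \<phi> h)"
proof -
  have "(\<Sum>t'<T. \<phi> (if t \<le> t' then t' - t else t - t')) \<le> 2 * (\<Sum>h<T. \<phi> h)" if t: "t < T" for t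
  proof -
    have "(\<Sum>t'<T. \<phi> (if t \<le> t' then t' - t else t - t')) =
       (\<Sum>t'\<in>{..<t}. \<phi> (t - t')) + (\<Sum>t'\<in>{t..<T}. \<phi> (t' - t))"
    proof -
      have "{..<T} = {..<t} \<union> {t..<T}" using t by auto
      then show ?thesis by (simp add: sum.union_disjoint ivl_disj_int)
    qed
    also have "(\<Sum>t'\<in>{..<t}. \<phi> (t - t')) = (\<Sum>h\<in>(\<lambda>t'. t - t') ` {..<t}. \<phi> h)"
      by (subst sum.reindex) (auto simp: inj_on_def)
    also have "\<dots> \<le> (\<Sum>h<T. \<phi> h)"
    proof (cases "t = 0")
      case False
      show ?thesis using t assms
        by (intro sum_mono2) (auto simp: image_subset_iff)
    qed (simp add: sum_nonneg assms)
    also have "(\<Sum>t'\<in>{t..<T}. \<phi> (t' - t)) = (\<Sum>h\<in>(\<lambda>t'. t' - t) ` {t..<T}. \<phi> h)"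
      by (subst sum.reindex) (auto simp: inj_on_def)
    also have "\<dots> \<le> (\<Sum>h<T. \<phi> h)" using t assms by (intro sum_mono2) auto
    finally show ?thesis by simp
  qed
  then have "(\<Sum>t<T. \<Sum>t'<T. \<phi> (if t \<le> t' then t' - t else t - t')) \<le> (\<Sum>t<T. 2 * (\<Sum>h<T. \<phi> h))"
    by (intro sum_mono) auto
  then show ?thesis by simp
qed

text \<open>Since \<open>g\<close> is defined everywhere, the range of summation is kept and a
  translation by \<open>c\<close> costs \<open>2 * c\<close>. Division by \<open>N\<close> instead
  of \<open>K\<close> gives a bound uniform in \<open>K \<le> N\<close>. Pairs of shifts at distance
  \<open>h\<close> occur at most \<open>2 * T\<close> times, and exchanging the two shifts
  conjugates the correlation, so only \<open>h \<ge> 0\<close> is needed.\<close>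

lemma van_der_corput:
  fixes g :: "nat \<Rightarrow> complex"
  assumes g: "\<And>k. norm (g k) \<le> 1" and KN: "K \<le> N" and N: "N > 0" and T: "T > 0"
  shows "(norm (\<Sum>k<K. g k) / N)\<^sup>2 \<le>
     2 * (\<Sum>h<T. norm (\<Sum>k<K. g k * cnj (g (k + \<kappa> * h))) / N) / T + 6 * real (\<kappa> * T) / N"
proof -
  define S where "S = (\<Sum>k<K. g k)"
  define a where "a k = (\<Sum>t<T. g (k + \<kappa> * t))" for k
  define X where "X = norm (\<Sum>k<K. a k) / T"
  define \<phi> where "\<phi> h = norm (\<Sum>k<K. g k * cnj (g (k + \<kappa> * h)))" for h
  define H where "H = real (\<kappa> * T)"
  have H0: "H \<ge> 0" by (simp add: H_def)
  have SK: "norm S \<le> N"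
  proof -
    have "norm S \<le> (\<Sum>k<K. 1)" unfolding S_def by (intro sum_norm_le g)
    then show ?thesis using KN by simp
  qed
  have XN: "X \<le> N"
  proof -
    have "norm (\<Sum>k<K. a k) \<le> (\<Sum>k<K. real T)"
    proof (intro sum_norm_le)
      fix k
      have "norm (a k) \<le> (\<Sum>t<T. 1)" unfolding a_def by (intro sum_norm_le g)
      then show "norm (a k) \<le> real T" by simp
    qed
    also have "\<dots> = real K * real T" by simp
    also have "\<dots> \<le> real N * real T" using KN by (intro mult_right_mono) auto
    finally have "norm (\<Sum>k<K. a k) \<le> real N * real T" .
    then show ?thesis using T unfolding X_def by (simp add: field_simps)
  qed
  have SX: "norm S \<le> X + 2 * H"
  proof -
    have "(\<Sum>k<K. a k) = (\<Sum>t<T. \<Sum>k<K. g (k + \<kappa> * t))" unfolding a_def by (rule sum.swap)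
    then have "of_nat T * S - (\<Sum>k<K. a k) = (\<Sum>t<T. S - (\<Sum>k<K. g (k + \<kappa> * t)))"
      by (simp add: sum_subtractf)
    also have "norm \<dots> \<le> (\<Sum>t<T. 2 * H)"
    proof (intro sum_norm_le)
      fix t assume "t \<in> {..<T}"
      then have "\<kappa> * t \<le> \<kappa> * T" by simp
      then have "2 * real (\<kappa> * t) \<le> 2 * H" unfolding H_def by (simp only: of_nat_le_iff mult_le_cancel_left_pos)
      then show "norm (S - (\<Sum>k<K. g (k + \<kappa> * t))) \<le> 2 * H"
        unfolding S_def using norm_sum_shift_diff[of g K "\<kappa> * t", OF g] by linarith
    qed
    finally have "norm (of_nat T * S - (\<Sum>k<K. a k)) \<le> T * (2 * H)" by simp
    moreover have "norm (of_nat T * S) \<le> norm (of_nat T * S - (\<Sum>k<K. a k)) + norm (\<Sum>k<K. a k)"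
      using norm_triangle_ineq[of "of_nat T * S - (\<Sum>k<K. a k)" "\<Sum>k<K. a k"] by simp
    ultimately have "T * norm S \<le> T * (2 * H) + norm (\<Sum>k<K. a k)" by (simp add: norm_mult)
    then show ?thesis using T unfolding X_def by (simp add: field_simps)
  qed
  have X2: "X\<^sup>2 \<le> N * (2 * (\<Sum>h<T. \<phi> h) / T + 2 * H)"
  proof -
    have pair: "norm (\<Sum>k<K. g (k + \<kappa> * t) * cnj (g (k + \<kappa> * t'))) \<le>
        \<phi> (if t \<le> t' then t' - t else t - t') + 2 * H" if "t < T" "t' < T" for t t'
    proof -
      have *: "norm (\<Sum>k<K. g (k + \<kappa> * t) * cnj (g (k + \<kappa> * t'))) \<le> \<phi> (t' - t) + 2 * H"
        if "t \<le> t'" "t < T" for t t'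
      proof -
        define F where "F k = g k * cnj (g (k + \<kappa> * (t' - t)))" for k
        have F1: "norm (F k) \<le> 1" for k unfolding F_def using g by (simp add: norm_mult mult_le_one)
        have eq: "g (k + \<kappa> * t) * cnj (g (k + \<kappa> * t')) = F (k + \<kappa> * t)" for k
        proof -
          have "k + \<kappa> * t + \<kappa> * (t' - t) = k + \<kappa> * t'"
            using that by (simp add: add.assoc add_mult_distrib2[symmetric])
          then show ?thesis by (simp only: F_def)
        qed
        have "norm (\<Sum>k<K. F (k + \<kappa> * t)) \<le> norm (\<Sum>k<K. F k) + 2 * real (\<kappa> * t)"
          using norm_sum_shift_diff[of F K "\<kappa> * t", OF F1]
            norm_triangle_sub[of "\<Sum>k<K. F (k + \<kappa> * t)" "\<Sum>k<K. F k"]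
          by (simp add: norm_minus_commute)
        moreover have "real (\<kappa> * t) \<le> H" unfolding H_def using that by (simp only: of_nat_le_iff mult_le_mono2 less_imp_le)
        ultimately show ?thesis unfolding \<phi>_def eq F_def[symmetric] by linarith
      qed
      show ?thesis
      proof (cases "t \<le> t'")
        case True
        then show ?thesis using *[of t t'] that by simp
      next
        case False
        have "norm (\<Sum>k<K. g (k + \<kappa> * t) * cnj (g (k + \<kappa> * t'))) =
            norm (cnj (\<Sum>k<K. g (k + \<kappa> * t) * cnj (g (k + \<kappa> * t'))))" by (simp only: complex_mod_cnj)
        also have "\<dots> = norm (\<Sum>k<K. g (k + \<kappa> * t') * cnj (g (k + \<kappa> * t)))" by (simp add: mult.commute)
        finally show ?thesis using *[of t' t] that False by simp
      qed
    qed
    have "(norm (\<Sum>k<K. a k))\<^sup>2 \<le> real K * (\<Sum>k<K. (norm (a k))\<^sup>2)" by (rule norm_sum_squared_le)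
    also have "(\<Sum>k<K. (norm (a k))\<^sup>2) = norm (\<Sum>k<K. a k * cnj (a k))"
    proof -
      have "(\<Sum>k<K. a k * cnj (a k)) = of_real (\<Sum>k<K. (norm (a k))\<^sup>2)"
        by (simp only: of_real_sum complex_norm_square)
      then show ?thesis by (simp only: norm_of_real) (simp add: sum_nonneg)
    qed
    also have "(\<Sum>k<K. a k * cnj (a k)) = (\<Sum>k<K. \<Sum>t<T. \<Sum>t'<T. g (k + \<kappa> * t) * cnj (g (k + \<kappa> * t')))"
      unfolding a_def by (simp add: sum_product)
    also have "\<dots> = (\<Sum>t<T. \<Sum>t'<T. \<Sum>k<K. g (k + \<kappa> * t) * cnj (g (k + \<kappa> * t')))"
      by (subst sum.swap) (intro sum.cong refl sum.swap)
    also have "norm \<dots> \<le> (\<Sum>t<T. \<Sum>t'<T. \<phi> (if t \<le> t' then t' - t else t - t') + 2 * H)"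
      by (intro sum_norm_le pair) auto
    also have "\<dots> \<le> 2 * real T * (\<Sum>h<T. \<phi> h) + real T * (real T * (2 * H))"
      using sum_pair_distance_le[of \<phi> T] by (simp add: sum.distrib \<phi>_def)
    finally have "(norm (\<Sum>k<K. a k))\<^sup>2 \<le> real K * (2 * real T * (\<Sum>h<T. \<phi> h) + real T * (real T * (2 * H)))"
      by (simp add: mult_left_mono)
    also have "\<dots> \<le> real N * (2 * real T * (\<Sum>h<T. \<phi> h) + real T * (real T * (2 * H)))"
      using KN H0 by (intro mult_right_mono add_nonneg_nonneg mult_nonneg_nonneg sum_nonneg) (auto simp: \<phi>_def)
    finally have "X\<^sup>2 \<le> real N * (2 * real T * (\<Sum>h<T. \<phi> h) + real T * (real T * (2 * H))) / (real T)\<^sup>2"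
      unfolding X_def power_divide by (rule divide_right_mono) simp
    also have "\<dots> = N * (2 * (\<Sum>h<T. \<phi> h) / T + 2 * H)"
      using T by (simp add: field_simps power2_eq_square)
    finally show ?thesis .
  qed
  \<comment> \<open>If \<open>norm S\<close> exceeds \<open>X\<close>, their difference is at most
    \<open>2 * H\<close> and their sum at most \<open>2 * N\<close>. Together with the
    \<open>2 * H\<close> in \<open>X2\<close> this makes the 6 of the statement.\<close>
  have "(norm S)\<^sup>2 \<le> X\<^sup>2 + 4 * H * N"
  proof (cases "norm S \<le> X")
    case True
    then have "(norm S)\<^sup>2 \<le> X\<^sup>2" by (intro power_mono) auto
    moreover have "0 \<le> 4 * H * N" using H0 by simp
    ultimately show ?thesis by linarith
  next
    case False
    have "(norm S)\<^sup>2 - X\<^sup>2 = (norm S - X) * (norm S + X)" by (simp add: power2_eq_square algebra_simps)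
    also have "\<dots> \<le> (2 * H) * (2 * N)"
      using False SX SK XN H0 by (intro mult_mono) (auto simp: X_def)
    finally show ?thesis by simp
  qed
  also have "\<dots> \<le> N * (2 * (\<Sum>h<T. \<phi> h) / T + 6 * H)" using X2 by (simp add: algebra_simps)
  finally have "(norm S)\<^sup>2 / (real N)\<^sup>2 \<le> N * (2 * (\<Sum>h<T. \<phi> h) / T + 6 * H) / (real N)\<^sup>2"
    by (rule divide_right_mono) simp
  also have "\<dots> = 2 * (\<Sum>h<T. \<phi> h / N) / T + 6 * H / N"
    using N by (simp add: field_simps power2_eq_square sum_divide_distrib[symmetric])
  finally show ?thesis by (simp add: S_def \<phi>_def H_def power_divide)
qed

lemma msum_power2_le:
  assumes "\<And>hs. Z hs \<ge> 0" "prod_list Ts > 0"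
  shows "(msum Ts Z / prod_list Ts)\<^sup>2 \<le> msum Ts (\<lambda>hs. (Z hs)\<^sup>2) / prod_list Ts"
proof -
  define m where "m = msum Ts Z / prod_list Ts"
  have P: "real (prod_list Ts) > 0" using assms by simp
  have "0 \<le> msum Ts (\<lambda>hs. (Z hs - m)\<^sup>2)" by (intro msum_nonneg) auto
  also have "(\<lambda>hs. (Z hs - m)\<^sup>2) = (\<lambda>hs. (Z hs)\<^sup>2 + ((- 2 * m) * Z hs + m\<^sup>2))"
    by (auto simp: power2_eq_square algebra_simps)
  also have "msum Ts \<dots> = msum Ts (\<lambda>hs. (Z hs)\<^sup>2) + ((- 2 * m) * msum Ts Z + prod_list Ts * m\<^sup>2)"
    unfolding msum_add msum_cmult msum_const ..
  also have "msum Ts Z = prod_list Ts * m" using P by (simp add: m_def)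
  finally have "prod_list Ts * m\<^sup>2 \<le> msum Ts (\<lambda>hs. (Z hs)\<^sup>2)" by (simp add: power2_eq_square algebra_simps)
  then show ?thesis using P unfolding m_def[symmetric] by (simp add: field_simps)
qed

text \<open>14 = 2 (6 + 1): it comes from \<open>A\<^sup>2 \<le> 2 * A' + 6 * \<epsilon>\<close>,
  \<open>(A + \<epsilon>)\<^sup>2 \<le> 2 * (A\<^sup>2 + \<epsilon>\<^sup>2)\<close> and
  \<open>\<epsilon>\<^sup>2 \<le> \<epsilon>\<close> in the iteration.\<close>

primrec vdc_const :: "nat \<Rightarrow> real" where
  "vdc_const 0 = 1"
| "vdc_const (Suc n) = 14 * (vdc_const n)\<^sup>2"

lemma vdc_const_ge_1: "vdc_const n \<ge> 1"
proof (induction n)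
  case (Suc n)
  then have "1\<^sup>2 \<le> (vdc_const n)\<^sup>2" by (intro power_mono) auto
  then show ?case by simp
qed simp

lemma norm_average_le_1:
  fixes g :: "nat \<Rightarrow> complex"
  assumes "\<And>k. norm (g k) \<le> 1" "K \<le> N" "N > 0"
  shows "norm (\<Sum>k<K. g k) / N \<le> 1"
proof -
  have "norm (\<Sum>k<K. g k) \<le> (\<Sum>k<K. 1)" using assms by (intro sum_norm_le) auto
  then have "norm (\<Sum>k<K. g k) \<le> N" using assms(2) by simp
  then show ?thesis using assms(3) by simp
qed

theorem van_der_corput_iterated:
  fixes g :: "nat \<Rightarrow> complex"
  assumes g: "\<And>k. norm (g k) \<le> 1" and KN: "K \<le> N" and N: "N > 0"
    and "length \<kappa>s = length Ts"
    and "\<forall>T\<in>set Ts. T > 0" and "\<forall>(\<kappa>, T)\<in>set (zip \<kappa>s Ts). real (\<kappa> * T) \<le> H" and H: "H \<ge> 0"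
  shows "(norm (\<Sum>k<K. g k) / N) ^ (2 ^ length Ts) \<le> vdc_const (length Ts) *
     (msum Ts (\<lambda>hs. norm (\<Sum>k<K. cube (\<lambda>_. g) (map2 (*) \<kappa>s hs) k) / N) / prod_list Ts + H / N)"
  using assms(4-6)
proof (induction \<kappa>s Ts rule: list_induct2)
  case Nil
  then show ?case using H by simp
next
  case (Cons \<kappa> \<kappa>s T Ts)
  define Z where "Z hs = norm (\<Sum>k<K. cube (\<lambda>_. g) (map2 (*) \<kappa>s hs) k) / N" for hs
  define Z' where "Z' hs = norm (\<Sum>k<K. cube (\<lambda>_. g) (map2 (*) (\<kappa> # \<kappa>s) hs) k) / N" for hs
  define C where "C = vdc_const (length Ts)"
  define \<epsilon> where "\<epsilon> = H / N"
  define P where "P = real (prod_list Ts)"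
  define A where "A = msum Ts Z / P"
  define A' where "A' = msum (T # Ts) Z' / prod_list (T # Ts)"
  define a where "a = norm (\<Sum>k<K. g k) / N"
  have T: "T > 0" and \<kappa>T: "real (\<kappa> * T) \<le> H" using Cons.prems by auto
  have Ppos: "P > 0" unfolding P_def using Cons.prems(1)
    by (auto simp: prod_list_zero_iff intro!: Nat.gr0I)
  have C1: "C \<ge> 1" unfolding C_def by (rule vdc_const_ge_1)
  have a: "0 \<le> a" "a \<le> 1" unfolding a_def using norm_average_le_1[of g, OF g KN N] by auto
  have A0: "A \<ge> 0" "A' \<ge> 0" "\<epsilon> \<ge> 0"
    unfolding A_def A'_def \<epsilon>_def P_def using H by (auto intro!: divide_nonneg_nonneg msum_nonneg sum_nonneg simp: Z_def Z'_def)
  have IH: "a ^ (2 ^ length Ts) \<le> C * (A + \<epsilon>)"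
    using Cons by (simp add: a_def C_def A_def Z_def[abs_def] \<epsilon>_def P_def)
  have "a ^ (2 ^ length (T # Ts)) \<le> 14 * C\<^sup>2 * (A' + \<epsilon>)"
  proof (cases "\<epsilon> \<le> 1")
    \<comment> \<open>For \<open>\<epsilon> > 1\<close> the right-hand side is above 1 and the claim
      is trivial; the other case needs \<open>\<epsilon> \<le> 1\<close> to replace the square of
      \<open>\<epsilon>\<close> by \<open>\<epsilon>\<close>.\<close>
    case False
    have "a ^ (2 ^ length (T # Ts)) \<le> 1" using a by (simp add: power_le_one)
    also have "1 \<le> 14 * C\<^sup>2 * (A' + \<epsilon>)"
    proof -
      have "1 * 1 \<le> (14 * C\<^sup>2) * (A' + \<epsilon>)"
        using C1 False A0 one_le_power[OF C1, of 2] by (intro mult_mono) linarith+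
      then show ?thesis by simp
    qed
    finally show ?thesis .
  next
    case True
    have "A\<^sup>2 \<le> msum Ts (\<lambda>hs. (Z hs)\<^sup>2) / P"
      unfolding A_def P_def using Ppos by (intro msum_power2_le) (auto simp: Z_def P_def)
    also have "\<dots> \<le> msum Ts (\<lambda>hs. (2 / T) * (\<Sum>h<T. Z' (h # hs)) + 6 * \<epsilon>) / P"
    proof (intro divide_right_mono msum_mono)
      fix hs
      have "(Z hs)\<^sup>2 \<le> 2 * (\<Sum>h<T. norm (\<Sum>k<K. cube (\<lambda>_. g) (map2 (*) \<kappa>s hs) k * cnj (cube (\<lambda>_. g) (map2 (*) \<kappa>s hs) (k + \<kappa> * h))) / N) / T + 6 * real (\<kappa> * T) / N"
        unfolding Z_def by (intro van_der_corput KN N T norm_cube_le_1 g)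
      also have "6 * real (\<kappa> * T) / N \<le> 6 * \<epsilon>"
        unfolding \<epsilon>_def using \<kappa>T by (simp add: divide_right_mono)
      finally show "(Z hs)\<^sup>2 \<le> (2 / T) * (\<Sum>h<T. Z' (h # hs)) + 6 * \<epsilon>"
        by (simp add: Z'_def)
    qed (use Ppos in simp)
    also have "\<dots> = 2 * A' + 6 * \<epsilon>"
      using Ppos T unfolding msum_add msum_cmult msum_const msum_sum A'_def P_def[symmetric]
      by (simp add: P_def[symmetric] field_simps)
    finally have A2: "A\<^sup>2 \<le> 2 * A' + 6 * \<epsilon>" .
    have "\<epsilon>\<^sup>2 \<le> \<epsilon>" using True A0 by (simp add: power2_eq_square mult_left_le)
    have "a ^ (2 ^ length (T # Ts)) = (a ^ (2 ^ length Ts))\<^sup>2" by (simp add: power_mult[symmetric] mult.commute)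
    also have "\<dots> \<le> (C * (A + \<epsilon>))\<^sup>2" using IH a by (intro power_mono) auto
    also have "\<dots> = C\<^sup>2 * (A + \<epsilon>)\<^sup>2" by (simp add: power_mult_distrib)
    also have "\<dots> \<le> C\<^sup>2 * (2 * (A\<^sup>2 + \<epsilon>\<^sup>2))"
      using sum_squares_bound[of A \<epsilon>] by (intro mult_left_mono) (auto simp: power2_eq_square algebra_simps)
    also have "\<dots> \<le> C\<^sup>2 * (14 * (A' + \<epsilon>))"
      using A2 \<open>\<epsilon>\<^sup>2 \<le> \<epsilon>\<close> A0 by (intro mult_left_mono) auto
    finally show ?thesis by (simp add: algebra_simps)
  qed
  then show ?case by (simp add: a_def C_def A'_def Z'_def[abs_def] \<epsilon>_def)
qed

section \<open>Removing high digits\<close>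

primrec good :: "(nat \<Rightarrow> bool) \<Rightarrow> nat list \<Rightarrow> nat \<Rightarrow> bool" where
  "good P [] v \<longleftrightarrow> P v"
| "good P (w # ws) v \<longleftrightarrow> good P ws v \<and> good P ws (v + w)"

lemma cube_shift_invariant:
  assumes "\<And>v. P v \<Longrightarrow> \<phi> (v + u) = \<phi> v" and "good P ws v"
  shows "cube (\<lambda>_. \<phi>) ws (v + u) = cube (\<lambda>_. \<phi>) ws v"
  using assms(2)
proof (induction ws arbitrary: v)
  case (Cons w ws)
  have "cube (\<lambda>_. \<phi>) ws (v + u) = cube (\<lambda>_. \<phi>) ws v"
       "cube (\<lambda>_. \<phi>) ws (v + w + u) = cube (\<lambda>_. \<phi>) ws (v + w)"
    using Cons by auto
  then show ?case by (simp add: ac_simps)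
qed (use assms(1) in auto)

text \<open>The vertices pair up along direction \<open>i\<close>; the two values in a pair agree
  and one of them is conjugated, so each pair contributes a squared norm, which is 1.\<close>

lemma cube_eq_1:
  assumes "\<And>v. norm (\<phi> v) = 1" "\<And>v. P v \<Longrightarrow> \<phi> (v + ws ! i) = \<phi> v" "i < length ws" "good P ws v"
  shows "cube (\<lambda>_. \<phi>) ws v = 1"
  using assms(2-4)
proof (induction ws arbitrary: v i)
  case (Cons w ws)
  show ?case
  proof (cases i)
    case 0
    have "cube (\<lambda>_. \<phi>) ws (v + w) = cube (\<lambda>_. \<phi>) ws v"
      using Cons.prems 0 by (intro cube_shift_invariant[of P]) auto
    moreover have "norm (cube (\<lambda>_. \<phi>) ws v) = 1" using assms(1) by (intro norm_cube_eq_1) auto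
    ultimately show ?thesis by (simp add: complex_norm_square[symmetric])
  next
    case (Suc j)
    have "cube (\<lambda>_. \<phi>) ws v = 1" "cube (\<lambda>_. \<phi>) ws (v + w) = 1"
      using Cons.prems Suc by (auto intro!: Cons.IH[of j])
    then show ?thesis by simp
  qed
qed simp

lemma cube_mult: "cube (\<lambda>e v. G e v * H e v) ws v = cube G ws v * cube H ws v"
  by (induction ws arbitrary: G H v) (simp_all add: ac_simps)

text \<open>The offset \<open>r\<close> is arbitrary in the hypothesis because each of the
  \<open>2 ^ length ws\<close> vertices sees another translate of the same progression.\<close>

lemma card_not_good_le:
  assumes "\<And>r. card {k. k < K \<and> \<not> P (r + m * k)} \<le> M"
  shows "card {k. k < K \<and> \<not> good P ws (r + m * k)} \<le> 2 ^ length ws * M"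
proof (induction ws arbitrary: r)
  case (Cons w ws)
  have "{k. k < K \<and> \<not> good P (w # ws) (r + m * k)} \<subseteq>
     {k. k < K \<and> \<not> good P ws (r + m * k)} \<union> {k. k < K \<and> \<not> good P ws ((r + w) + m * k)}"
    by (auto simp: ac_simps)
  then have "card {k. k < K \<and> \<not> good P (w # ws) (r + m * k)} \<le>
     card ({k. k < K \<and> \<not> good P ws (r + m * k)} \<union> {k. k < K \<and> \<not> good P ws ((r + w) + m * k)})"
    by (intro card_mono) auto
  also have "\<dots> \<le> 2 ^ length ws * M + 2 ^ length ws * M"
    by (intro order.trans[OF card_Un_le] add_mono Cons)
  finally show ?case by simp
qed (use assms in simp)

definition central :: "nat \<Rightarrow> nat \<Rightarrow> nat \<Rightarrow> bool" where
  "central E Q v \<longleftrightarrow> E \<le> v mod Q \<and> v mod Q + E < Q"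

text \<open>The modulus \<open>Q = 0\<close> is allowed, where \<open>near 0 E w\<close> means \<open>w \<le> E\<close>; it encodes the absence of truncation.\<close>

definition near :: "nat \<Rightarrow> nat \<Rightarrow> nat \<Rightarrow> bool" where
  "near Q E w \<longleftrightarrow> (\<exists>e::int. \<bar>e\<bar> \<le> int E \<and> [int w = e] (mod int Q))"

text \<open>After reduction modulo \<open>Q'\<close> the shift acts like the small integer
  \<open>e\<close>, and a residue at distance at least \<open>E\<close> from both ends of the period
  leaves room for \<open>e\<close> of either sign, so no carry or borrow crosses the level
  \<open>Q\<close>. For \<open>Q' = 0\<close> nothing is reduced.\<close>

lemma high_digits_unchanged:
  assumes "Q dvd Q'" "near Q' E w" "central E Q v"
  shows "((v + w) mod Q') div Q = (v mod Q') div Q"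
proof -
  obtain R where R: "Q' = Q * R" using assms(1) by blast
  obtain e :: int where e: "\<bar>e\<bar> \<le> int E" "[int w = e] (mod int Q')" using assms(2) by (auto simp: near_def)
  have inn: "E \<le> v mod Q" "v mod Q + E < Q" using assms(3) by (auto simp: central_def)
  have Qpos: "Q > 0" using inn by simp
  obtain t where t: "int w = e + int Q' * t" using e(2) by (metis cong_iff_lin cong_sym)
  have dm: "(x mod Q') div Q = x div Q mod R" for x
    using Qpos by (simp add: R mod_mult2_eq)
  have "int ((v + w) div Q) = (int v + e + int Q * (int R * t)) div int Q"
    by (simp add: zdiv_int t R algebra_simps)
  also have "\<dots> = (int v + e) div int Q + int R * t" using Qpos by simp
  also have "(int v + e) div int Q = int (v div Q)"
  proof -
    have "int v = int (v mod Q) + int Q * int (v div Q)" by (metis mod_mult_div_eq of_nat_add of_nat_mult)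
    then have "(int v + e) div int Q = ((int (v mod Q) + e) + int Q * int (v div Q)) div int Q"
      by (simp add: algebra_simps)
    also have "\<dots> = int (v div Q) + (int (v mod Q) + e) div int Q" using Qpos by simp
    also have "(int (v mod Q) + e) div int Q = 0"
      using inn e(1) by (intro div_pos_pos_trivial) linarith+
    finally show ?thesis by simp
  qed
  finally have "[int ((v + w) div Q) = int (v div Q)] (mod int R)"
    by (simp add: cong_def)
  then have "[(v + w) div Q = v div Q] (mod R)" by (simp only: cong_int_iff)
  then have "(v + w) div Q mod R = v div Q mod R" by (simp only: cong_def)
  then show ?thesis by (simp add: dm)
qed

lemma cube_truncate:
  assumes q: "q \<ge> 2" and z: "norm z = 1" and "q ^ l dvd Q'" and i: "i < length ws"
    and "near Q' E (ws ! i)" and "good (central E (q ^ l)) ws v"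
  shows "cube (\<lambda>_ v. z ^ digit_sum q (v mod Q')) ws v = cube (\<lambda>_. phase q z l) ws v"
proof -
  define \<phi> where "\<phi> v = z ^ digit_sum q ((v mod Q') div q ^ l)" for v
  have "z ^ digit_sum q (v mod Q') = phase q z l v * \<phi> v" for v
    using digit_sum_split[OF q, of "v mod Q'" l] assms(3)
    by (simp add: phase_def \<phi>_def power_add mod_mod_cancel)
  then have "cube (\<lambda>_ v. z ^ digit_sum q (v mod Q')) ws v = cube (\<lambda>_. phase q z l) ws v * cube (\<lambda>_. \<phi>) ws v"
    using cube_mult[of "\<lambda>_. phase q z l" "\<lambda>_. \<phi>"] by simp
  also have "cube (\<lambda>_. \<phi>) ws v = 1"
  proof (rule cube_eq_1[OF _ _ i assms(6)])
    show "norm (\<phi> v) = 1" for v using z by (simp add: \<phi>_def norm_power)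
    show "\<phi> (v + ws ! i) = \<phi> v" if "central E (q ^ l) v" for v
      unfolding \<phi>_def by (simp only: high_digits_unchanged[OF assms(3,5) that])
  qed
  finally show ?thesis by simp
qed

text \<open>Only the first shift has to be small as a number. It cuts the phase down to its lowest
  \<open>l 0\<close> digits; afterwards a shift needs to be small only modulo the level already
  reached, and may itself be very large.\<close>

lemma cube_truncate_chain:
  assumes q: "q \<ge> 2" and z: "norm z = 1" and n: "n < length ws"
    and dec: "\<And>i. i < n \<Longrightarrow> l (Suc i) \<le> l i"
    and near0: "near 0 (E 0) (ws ! 0)"
    and near: "\<And>i. i < n \<Longrightarrow> near (q ^ l i) (E (Suc i)) (ws ! Suc i)"
    and good: "\<And>i. i \<le> n \<Longrightarrow> good (central (E i) (q ^ l i)) ws v"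
  shows "cube (\<lambda>_ v. z ^ digit_sum q v) ws v = cube (\<lambda>_. phase q z (l n)) ws v"
  using n dec near good
proof (induction n)
  case 0
  show ?case
    using cube_truncate[OF q z _ "0.prems"(1) near0 "0.prems"(4)] by simp
next
  case (Suc n)
  have "cube (\<lambda>_ v. z ^ digit_sum q v) ws v = cube (\<lambda>_. phase q z (l n)) ws v"
    by (rule Suc.IH) (use Suc.prems in auto)
  also have "\<dots> = cube (\<lambda>_. phase q z (l (Suc n))) ws v"
    using cube_truncate[OF q z le_imp_power_dvd, of "l (Suc n)" "l n" "Suc n" ws "E (Suc n)" v] Suc.prems
    by (simp add: phase_def[abs_def])
  finally show ?case .
qed

lemma norm_sum_cube_truncate_le:
  assumes q: "q \<ge> 2" and z: "norm z = 1" and n: "n < length ws"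
    and dec: "\<And>i. i < n \<Longrightarrow> l (Suc i) \<le> l i"
    and near0: "near 0 (E 0) (ws ! 0)"
    and near: "\<And>i. i < n \<Longrightarrow> near (q ^ l i) (E (Suc i)) (ws ! Suc i)"
    and bad: "\<And>i r. i \<le> n \<Longrightarrow> card {k. k < K \<and> \<not> central (E i) (q ^ l i) (r + m * k)} \<le> M i"
  shows "norm (\<Sum>k<K. cube (\<lambda>_ v. z ^ digit_sum q v) ws (r + m * k)) \<le>
     norm (\<Sum>k<K. cube (\<lambda>_. phase q z (l n)) ws (r + m * k)) + 2 * real (\<Sum>i\<le>n. 2 ^ length ws * M i)"
proof -
  define B where "B = (\<Union>i\<le>n. {k. k < K \<and> \<not> good (central (E i) (q ^ l i)) ws (r + m * k)})"
  define f where "f k = cube (\<lambda>_ v. z ^ digit_sum q v) ws (r + m * k)" for k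
  define g where "g k = cube (\<lambda>_. phase q z (l n)) ws (r + m * k)" for k
  have B: "B \<subseteq> {..<K}" by (auto simp: B_def)
  have "card B \<le> (\<Sum>i\<le>n. card {k. k < K \<and> \<not> good (central (E i) (q ^ l i)) ws (r + m * k)})"
    unfolding B_def by (intro card_UN_le) simp
  also have "\<dots> \<le> (\<Sum>i\<le>n. 2 ^ length ws * M i)"
    by (intro sum_mono card_not_good_le bad) simp
  finally have cB: "card B \<le> (\<Sum>i\<le>n. 2 ^ length ws * M i)" .
  have "f k = g k" if "k < K" "k \<notin> B" for k
    unfolding f_def g_def using that
    by (intro cube_truncate_chain[OF q z n dec near0 near]) (auto simp: B_def)
  then have "(\<Sum>k<K. f k) - (\<Sum>k<K. g k) = (\<Sum>k\<in>B. f k - g k)"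
    unfolding sum_subtractf[symmetric] using B by (intro sum.mono_neutral_right) auto
  also have "norm \<dots> \<le> (\<Sum>k\<in>B. 2)"
  proof (intro sum_norm_le)
    fix k
    have "norm (f k) = 1" "norm (g k) = 1" unfolding f_def g_def
      using z by (auto intro!: norm_cube_eq_1 simp: norm_power)
    then show "norm (f k - g k) \<le> 2" using norm_triangle_ineq4[of "f k" "g k"] by simp
  qed
  also have "\<dots> = 2 * real (card B)" by simp
  also have "\<dots> \<le> 2 * real (\<Sum>i\<le>n. 2 ^ length ws * M i)"
    using cB by (simp only: mult_le_cancel_left_pos of_nat_le_iff)
  finally show ?thesis
    using norm_triangle_sub[of "\<Sum>k<K. f k" "\<Sum>k<K. g k"] by (simp add: f_def g_def)
qed

section \<open>Counting multiples close to zero modulo Q\<close>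

lemma card_le_diameter:
  fixes A :: "nat set"
  assumes "\<And>x y. x \<in> A \<Longrightarrow> y \<in> A \<Longrightarrow> x \<le> y \<Longrightarrow> y - x \<le> B"
  shows "card A \<le> B + 1"
proof (cases "A = {}")
  case False
  define a where "a = (LEAST x. x \<in> A)"
  have a: "a \<in> A" "\<And>x. x \<in> A \<Longrightarrow> a \<le> x"
    unfolding a_def using False by (auto intro: LeastI Least_le)
  have "A \<subseteq> {a..a + B}"
  proof
    fix x assume "x \<in> A"
    then show "x \<in> {a..a + B}" using a assms[of a x] by fastforce
  qed
  then have "card A \<le> card {a..a + B}" by (intro card_mono) auto
  then show ?thesis by simp
qed simp

text \<open>Two indices with \<open>r + m * k\<close> close to multiples of \<open>Q\<close> differ
  by a \<open>j\<close> for which \<open>m * j\<close> is close to a multiple as well, with doubled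
  tolerance. Subtracting the least such index is injective and eliminates \<open>r\<close>.\<close>

lemma card_not_central_le:
  assumes Q: "Q > 0"
  shows "card {k. k < K \<and> \<not> central E Q (r + m * k)} \<le> 1 + card {j. 1 \<le> j \<and> j < K \<and> near Q (2 * E) (m * j)}"
proof (cases "{k. k < K \<and> \<not> central E Q (r + m * k)} = {}")
  case False
  define A where "A = {k. k < K \<and> \<not> central E Q (r + m * k)}"
  have fin: "finite A" by (simp add: A_def)
  define a where "a = Min A"
  have a: "a \<in> A" "\<And>x. x \<in> A \<Longrightarrow> a \<le> x"
    unfolding a_def using False fin by (auto simp: A_def[symmetric])
  have res: "\<exists>c t. int v = c + int Q * t \<and> - int E \<le> c \<and> c \<le> int E" if "\<not> central E Q v" for v
  proof -
    have "int v = int (v mod Q) + int Q * int (v div Q)" by (metis mod_mult_div_eq of_nat_add of_nat_mult)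
    moreover have "int v = int (v mod Q) - int Q + int Q * (int (v div Q) + 1)"
      using calculation by (simp add: algebra_simps)
    moreover have "v mod Q < Q" using Q by simp
    moreover have "v mod Q < E \<or> v mod Q + E \<ge> Q" using that by (auto simp: central_def)
    ultimately show ?thesis
    proof (elim disjE)
      assume "v mod Q < E"
      then show ?thesis using \<open>int v = int (v mod Q) + int Q * int (v div Q)\<close>
        by (intro exI[of _ "int (v mod Q)"] exI[of _ "int (v div Q)"]) simp
    next
      assume "v mod Q + E \<ge> Q"
      then show ?thesis using \<open>int v = int (v mod Q) - int Q + int Q * (int (v div Q) + 1)\<close> \<open>v mod Q < Q\<close>
        by (intro exI[of _ "int (v mod Q) - int Q"] exI[of _ "int (v div Q) + 1"]) simp
    qed
  qed
  have "(\<lambda>k. k - a) ` (A - {a}) \<subseteq> {j. 1 \<le> j \<and> j < K \<and> near Q (2 * E) (m * j)}"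
  proof clarify
    fix k assume k: "k \<in> A" "k \<noteq> a"
    then have ak: "a < k" using a(2)[of k] by simp
    obtain c t where c: "int (r + m * k) = c + int Q * t" "- int E \<le> c" "c \<le> int E" using res k by (force simp: A_def)
    obtain c' t' where c': "int (r + m * a) = c' + int Q * t'" "- int E \<le> c'" "c' \<le> int E" using res a(1) by (force simp: A_def)
    have "int (m * (k - a)) = int (r + m * k) - int (r + m * a)" using ak by (simp add: of_nat_diff algebra_simps)
    also have "\<dots> = (c - c') + int Q * (t - t')" using c c' by (simp add: algebra_simps)
    finally have "[int (m * (k - a)) = c - c'] (mod int Q)" by (simp add: cong_def)
    moreover have "\<bar>c - c'\<bar> \<le> int (2 * E)" using c c' by simp
    ultimately have "near Q (2 * E) (m * (k - a))" unfolding near_def by blast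
    then show "1 \<le> k - a \<and> k - a < K \<and> near Q (2 * E) (m * (k - a))" using ak k by (auto simp: A_def)
  qed
  then have "card ((\<lambda>k. k - a) ` (A - {a})) \<le> card {j. 1 \<le> j \<and> j < K \<and> near Q (2 * E) (m * j)}"
    by (intro card_mono) auto
  moreover have "card ((\<lambda>k. k - a) ` (A - {a})) = card (A - {a})"
    by (rule card_image) (auto simp: inj_on_def dest: a(2))
  moreover have "card (A - {a}) = card A - 1" using a fin by simp
  ultimately show ?thesis unfolding A_def[symmetric] by linarith
next
  case True
  then show ?thesis by (simp only: card.empty)
qed

lemma near_witness:
  assumes "near Q I w" "I < Q"
  obtains e :: int and i :: nat where "\<bar>e\<bar> \<le> int I" "int w = e + int Q * int i"
proof -
  obtain e :: int where e: "\<bar>e\<bar> \<le> int I" "[int w = e] (mod int Q)" using assms(1) by (auto simp: near_def)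
  obtain t where t: "int w = e + int Q * t" using e(2) by (metis cong_iff_lin cong_sym)
  have "t \<ge> 0"
  proof (rule ccontr)
    assume "\<not> t \<ge> 0"
    then have "int Q * t \<le> int Q * (-1)" by (intro mult_left_mono) auto
    then show False using t e(1) assms(2) by linarith
  qed
  then show ?thesis using that[OF e(1), of "nat t"] t by simp
qed

text \<open>First the multiple \<open>Q * i\<close> is chosen, among at most
  \<open>a * X div Q + 2\<close>; then \<open>x\<close> lies in a window of length
  \<open>2 * I / a\<close>. It will be applied with the modulus as multiplier and with the roles of
  \<open>m\<close> and \<open>j\<close> exchanged.\<close>

lemma card_near_multiples_le:
  assumes a: "a \<ge> 1" and I: "I < Q"
  shows "card {x. x \<le> X \<and> near Q I (a * x)} \<le> (a * X div Q + 2) * (2 * I div a + 1)"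
proof -
  define S where "S i = {x. x \<le> X \<and> \<bar>int (a * x) - int Q * int i\<bar> \<le> int I}" for i :: nat
  have "{x. x \<le> X \<and> near Q I (a * x)} \<subseteq> (\<Union>i\<in>{..a * X div Q + 1}. S i)"
  proof clarify
    fix x assume x: "x \<le> X" "near Q I (a * x)"
    from near_witness[OF x(2) I] obtain e i where ei: "\<bar>e\<bar> \<le> int I" "int (a * x) = e + int Q * int i" .
    have "int Q * int i \<le> int (a * x) + int I" using ei by linarith
    also have "\<dots> < int (a * X) + int Q" using x I mult_le_mono2[OF x(1), of a] by linarith
    finally have "Q * i < a * X + Q" by (simp only: of_nat_mult[symmetric] of_nat_add[symmetric] of_nat_less_iff)
    then have "i < a * X div Q + 2"
    proof -
      have "a * X < Q * (a * X div Q + 1)" using I by (metis Suc_eq_plus1 dividend_less_times_div mult.commute mult_Suc_right neq0_conv not_less0 add.commute)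
      then have "Q * i < Q * (a * X div Q + 2)" using \<open>Q * i < a * X + Q\<close> by (simp add: algebra_simps)
      then show ?thesis by (simp only: mult_less_cancel1)
    qed
    moreover have "x \<in> S i" using x ei by (simp add: S_def)
    ultimately show "x \<in> (\<Union>i\<in>{..a * X div Q + 1}. S i)" by auto
  qed
  then have "card {x. x \<le> X \<and> near Q I (a * x)} \<le> card (\<Union>i\<in>{..a * X div Q + 1}. S i)"
    by (intro card_mono) (auto simp: S_def)
  also have "\<dots> \<le> (\<Sum>i\<in>{..a * X div Q + 1}. card (S i))" by (intro card_UN_le) simp
  also have "\<dots> \<le> (\<Sum>i\<in>{..a * X div Q + 1}. 2 * I div a + 1)"
  proof (intro sum_mono card_le_diameter)
    fix i x y assume xy: "x \<in> S i" "y \<in> S i" "x \<le> y"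
    have "int (a * (y - x)) = int (a * y) - int (a * x)" using xy by (simp add: of_nat_diff algebra_simps)
    also have "\<dots> \<le> int (2 * I)" using xy by (auto simp: S_def)
    finally have "a * (y - x) \<le> 2 * I" by (simp only: of_nat_le_iff)
    then show "y - x \<le> 2 * I div a" using a by (simp add: less_eq_div_iff_mult_less_eq mult.commute)
  qed
  also have "\<dots> = (a * X div Q + 2) * (2 * I div a + 1)" by simp
  finally show ?thesis .
qed

lemma card_residue_fibre_le:
  assumes Q: "Q > 0"
  shows "card {j. j < Q \<and> m * j mod Q = c} \<le> gcd m Q"
proof -
  define g where "g = gcd m Q"
  obtain h where h: "Q = g * h" using gcd_dvd2[of m Q] unfolding g_def by blast
  have hpos: "h > 0" using Q h by (cases h) auto
  have gpos: "g > 0" using Q h by (cases g) auto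
  have "coprime (m div g) (Q div g)" unfolding g_def using Q by (intro div_gcd_coprime) auto
  moreover have "Q div g = h" using h gpos by simp
  ultimately have cop: "coprime (m div g) h" by simp
  have mg: "m = g * (m div g)" by (simp add: g_def)
  have same: "x mod h = y mod h" if "m * x mod Q = c" "m * y mod Q = c" for x y
  proof -
    have "[g * (m div g * x) = g * (m div g * y)] (mod (g * h))"
      using that mg h by (metis cong_def mult.assoc)
    then have "[m div g * x = m div g * y] (mod h)" using gpos by (simp add: cong_def mod_mult_mult1)
    then show ?thesis using cop by (simp add: cong_mult_lcancel_nat cong_def[symmetric])
  qed
  have "inj_on (\<lambda>j. j div h) {j. j < Q \<and> m * j mod Q = c}"
    by (intro inj_onI) (metis (mono_tags, lifting) mem_Collect_eq same div_mult_mod_eq)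
  moreover have "(\<lambda>j. j div h) ` {j. j < Q \<and> m * j mod Q = c} \<subseteq> {..<g}"
    using hpos by (auto simp: h div_less_iff_less_mult)
  ultimately have "card {j. j < Q \<and> m * j mod Q = c} \<le> card {..<g}"
    by (meson card_inj_on_le finite_lessThan)
  then show ?thesis by (simp add: g_def)
qed

text \<open>Only offsets divisible by \<open>g = gcd m Q\<close> can occur, at most
  \<open>2 * (I div g) + 1\<close> of them, each with at most \<open>g\<close> solutions. Hence the
  common factor enters additively and does not multiply \<open>I\<close>.\<close>

lemma card_near_period_le:
  assumes Q: "Q > 0"
  shows "card {j. j < Q \<and> near Q I (m * j)} \<le> 2 * I + gcd m Q"
proof -
  define g where "g = gcd m Q"
  have gpos: "g > 0" using Q by (simp add: g_def)
  define T where "T = {- int (I div g)..int (I div g)}"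
  define S where "S t = {j. j < Q \<and> m * j mod Q = nat ((int g * t) mod int Q)}" for t :: int
  have "{j. j < Q \<and> near Q I (m * j)} \<subseteq> (\<Union>t\<in>T. S t)"
  proof clarify
    fix j assume j: "j < Q" "near Q I (m * j)"
    then obtain e :: int where e: "\<bar>e\<bar> \<le> int I" "[int (m * j) = e] (mod int Q)" by (auto simp: near_def)
    have "int g dvd int (m * j)" "int g dvd int Q" by (auto simp: g_def simp del: of_nat_mult)
    then have "int g dvd e" using e(2) by (metis cong_dvd_iff cong_dvd_modulus)
    then obtain t where t: "e = int g * t" by blast
    have "int g * \<bar>t\<bar> \<le> int I" using e(1) t gpos by (simp add: abs_mult)
    then have "int (g * nat \<bar>t\<bar>) \<le> int I" by simp
    then have "nat \<bar>t\<bar> * g \<le> I" by (simp only: of_nat_le_iff mult.commute)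
    then have "nat \<bar>t\<bar> \<le> I div g" using gpos by (simp add: less_eq_div_iff_mult_less_eq)
    then have "t \<in> T" by (auto simp: T_def)
    moreover have "int (m * j mod Q) = (int g * t) mod int Q" using e(2) t by (simp add: cong_def zmod_int)
    then have "m * j mod Q = nat ((int g * t) mod int Q)" by linarith
    ultimately show "j \<in> (\<Union>t\<in>T. S t)" using j by (auto simp: S_def)
  qed
  then have "card {j. j < Q \<and> near Q I (m * j)} \<le> card (\<Union>t\<in>T. S t)"
    by (intro card_mono) (auto simp: S_def T_def)
  also have "\<dots> \<le> (\<Sum>t\<in>T. card (S t))" by (intro card_UN_le) (simp add: T_def)
  also have "\<dots> \<le> (\<Sum>t\<in>T. g)" unfolding S_def g_def by (intro sum_mono card_residue_fibre_le Q)
  also have "\<dots> = card T * g" by simp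
  also have "card T = 2 * (I div g) + 1"
  proof -
    have "card T = nat (int (2 * (I div g) + 1))"
      unfolding T_def card_atLeastAtMost_int by (rule arg_cong[of _ _ nat]) simp
    then show ?thesis by (simp only: nat_int)
  qed
  also have "(2 * (I div g) + 1) * g \<le> 2 * I + g" using div_times_less_eq_dividend[of I g] by (simp add: algebra_simps)
  finally show ?thesis by (simp add: g_def)
qed

lemma near_mod_cong:
  assumes "[w = w'] (mod Q)"
  shows "near Q I w \<longleftrightarrow> near Q I w'"
  using assms unfolding near_def by (metis cong_int_iff cong_sym cong_trans)

lemma card_near_le:
  assumes Q: "Q > 0"
  shows "card {j. j < K \<and> near Q I (m * j)} \<le> (K div Q + 1) * (2 * I + gcd m Q)"
proof -
  define S where "S t = (\<lambda>j. j + Q * t) ` {j. j < Q \<and> near Q I (m * j)}" for t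
  have "{j. j < K \<and> near Q I (m * j)} \<subseteq> (\<Union>t\<in>{..K div Q}. S t)"
  proof clarify
    fix j assume j: "j < K" "near Q I (m * j)"
    have "[m * (j mod Q) = m * j] (mod Q)" by (simp add: cong_def mod_mult_right_eq)
    then have "near Q I (m * (j mod Q))" using j near_mod_cong by blast
    moreover have "j div Q \<le> K div Q" using j by (intro div_le_mono) simp
    ultimately show "j \<in> (\<Union>t\<in>{..K div Q}. S t)" using Q
      by (auto simp: S_def image_iff intro!: bexI[of _ "j div Q"] exI[of _ "j mod Q"])
  qed
  then have "card {j. j < K \<and> near Q I (m * j)} \<le> card (\<Union>t\<in>{..K div Q}. S t)"
    by (intro card_mono) (auto simp: S_def)
  also have "\<dots> \<le> (\<Sum>t\<in>{..K div Q}. card (S t))" by (intro card_UN_le) simp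
  also have "\<dots> \<le> (\<Sum>t\<in>{..K div Q}. 2 * I + gcd m Q)"
    unfolding S_def by (intro sum_mono order.trans[OF card_image_le] card_near_period_le Q) auto
  finally show ?thesis by simp
qed

lemma card_multiples_le:
  assumes "P > 0"
  shows "card {k. 1 \<le> k \<and> k \<le> B \<and> P dvd k} \<le> B div P"
proof -
  have "{k. 1 \<le> k \<and> k \<le> B \<and> P dvd k} \<subseteq> (\<lambda>t. P * t) ` {1..B div P}"
  proof clarify
    fix k assume k: "1 \<le> k" "k \<le> B" "P dvd k"
    then obtain t where t: "k = P * t" by blast
    then have "t \<ge> 1" using k by (cases t) auto
    moreover have "t \<le> B div P" using k t assms by (simp add: less_eq_div_iff_mult_less_eq mult.commute)
    ultimately show "k \<in> (\<lambda>t. P * t) ` {1..B div P}" using t by auto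
  qed
  then have "card {k. 1 \<le> k \<and> k \<le> B \<and> P dvd k} \<le> card ((\<lambda>t. P * t) ` {1..B div P})"
    by (intro card_mono) auto
  also have "\<dots> \<le> B div P" using card_image_le[of "{1..B div P}" "\<lambda>t. P * t"] by simp
  finally show ?thesis .
qed

text \<open>At a prime of \<open>q\<close> the multiplicity in \<open>k\<close> is below
  \<open>J\<close>, that in \<open>q ^ J\<close> at least \<open>J\<close>; other primes do not
  divide the gcd.\<close>

lemma gcd_power_dvd:
  fixes q k :: nat
  assumes q: "q > 0" and k: "k > 0" and "\<And>p. prime p \<Longrightarrow> p dvd q \<Longrightarrow> \<not> p ^ J dvd k"
  shows "gcd k (q ^ \<rho>) dvd q ^ J"
proof (rule multiplicity_le_imp_dvd)
  show "gcd k (q ^ \<rho>) \<noteq> 0" using k by simp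
  fix p :: nat assume p: "prime p"
  show "multiplicity p (gcd k (q ^ \<rho>)) \<le> multiplicity p (q ^ J)"
  proof (cases "p dvd q")
    case False
    then have "\<not> p dvd gcd k (q ^ \<rho>)" using p by (meson dvd_trans gcd_dvd2 prime_dvd_power)
    then show ?thesis by (simp add: not_dvd_imp_multiplicity_0)
  next
    case True
    have "\<not> p ^ J dvd gcd k (q ^ \<rho>)" using assms(3)[OF p True] by (meson dvd_trans gcd_dvd1)
    then have "multiplicity p (gcd k (q ^ \<rho>)) < J" by (meson multiplicity_dvd' not_le)
    also have "J \<le> multiplicity p (q ^ J)"
      using True p q by (intro multiplicity_geI) (auto simp: dvd_power_same)
    finally show ?thesis by simp
  qed
qed

lemma gcd_mult_le:
  fixes a b c :: nat
  assumes "c > 0"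
  shows "gcd (a * b) c \<le> gcd a c * gcd b c"
proof (rule dvd_imp_le)
  have "gcd a c * gcd b c = gcd (gcd (a * b) (a * c)) (gcd (c * b) (c * c))"
    by (metis gcd_mult_distrib_nat mult.commute gcd.commute)
  moreover have "gcd (a * b) c dvd gcd (gcd (a * b) (a * c)) (gcd (c * b) (c * c))"
    by (intro gcd_greatest) (auto intro: dvd_mult dvd_mult2)
  ultimately show "gcd (a * b) c dvd gcd a c * gcd b c" by simp
  show "0 < gcd a c * gcd b c" using assms by simp
qed

section \<open>A bound for a single modulus\<close>

lemma sum_comp_le_fibre_bound:
  fixes Y :: "nat \<Rightarrow> real" and \<phi> :: "nat \<Rightarrow> nat"
  assumes "\<And>w. Y w \<ge> 0" and "\<And>h. h < T \<Longrightarrow> \<phi> h < Q"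
    and "\<And>x. card {h. h < T \<and> \<phi> h = x} \<le> M"
  shows "(\<Sum>h<T. Y (\<phi> h)) \<le> real M * (\<Sum>w<Q. Y w)"
proof -
  have "(\<Sum>h<T. Y (\<phi> h)) = (\<Sum>w<Q. \<Sum>h | h \<in> {..<T} \<and> \<phi> h = w. Y (\<phi> h))"
    by (rule sum.group[symmetric]) (auto simp: assms(2))
  also have "\<dots> \<le> (\<Sum>w<Q. real M * Y w)"
  proof (rule sum_mono)
    fix w
    have "(\<Sum>h | h \<in> {..<T} \<and> \<phi> h = w. Y (\<phi> h)) = real (card {h. h < T \<and> \<phi> h = w}) * Y w" by simp
    also have "\<dots> \<le> real M * Y w" using assms by (intro mult_right_mono) auto
    finally show "(\<Sum>h | h \<in> {..<T} \<and> \<phi> h = w. Y (\<phi> h)) \<le> real M * Y w" .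
  qed
  finally show ?thesis by (simp add: sum_distrib_left)
qed

text \<open>Non-negativity is essential: the residues that occur may be enlarged to all residues,
  each weighted by the maximal size \<open>M\<close> of a fibre. The fibre bound is needed
  separately in every direction, hence the product.\<close>

lemma msum_residues_le:
  assumes Q: "Q > 0" and Z: "\<And>ws. Z ws \<ge> 0"
    and "list_all2 (\<lambda>(c, M) T. \<forall>x. card {h. h < T \<and> c * h mod Q = x} \<le> M) cMs Ts"
  shows "msum Ts (\<lambda>hs. Z (map2 (\<lambda>c h. c * h mod Q) (map fst cMs) hs)) \<le>
     real (prod_list (map snd cMs)) * msum (replicate (length Ts) Q) Z"
  using assms(3,2)
proof (induction cMs Ts arbitrary: Z rule: list_all2_induct)
  case Nil
  then show ?case by simp
next
  case (Cons cM cMs T Ts)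
  obtain c M where cM: "cM = (c, M)" by (cases cM)
  let ?P = "real (prod_list (map snd cMs))"
  have "msum (T # Ts) (\<lambda>hs. Z (map2 (\<lambda>c h. c * h mod Q) (map fst (cM # cMs)) hs)) =
     (\<Sum>h<T. msum Ts (\<lambda>hs. Z ((c * h mod Q) # map2 (\<lambda>c h. c * h mod Q) (map fst cMs) hs)))"
    by (simp add: cM)
  also have "\<dots> \<le> (\<Sum>h<T. ?P * msum (replicate (length Ts) Q) (\<lambda>ws. Z ((c * h mod Q) # ws)))"
  proof (rule sum_mono)
    fix h
    show "msum Ts (\<lambda>hs. Z ((c * h mod Q) # map2 (\<lambda>c h. c * h mod Q) (map fst cMs) hs)) \<le>
      ?P * msum (replicate (length Ts) Q) (\<lambda>ws. Z ((c * h mod Q) # ws))"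
      using Cons.IH[of "\<lambda>ws. Z ((c * h mod Q) # ws)"] Cons.prems by auto
  qed
  also have "\<dots> = ?P * (\<Sum>h<T. msum (replicate (length Ts) Q) (\<lambda>ws. Z ((c * h mod Q) # ws)))"
    by (simp add: sum_distrib_left)
  also have "\<dots> \<le> ?P * (real M * (\<Sum>w<Q. msum (replicate (length Ts) Q) (\<lambda>ws. Z (w # ws))))"
    using Cons Q cM by (intro mult_left_mono sum_comp_le_fibre_bound[where Y = "\<lambda>w. msum (replicate (length Ts) Q) (\<lambda>ws. Z (w # ws))"])
      (auto intro!: msum_nonneg)
  finally show ?case by (simp add: cM algebra_simps)
qed

lemma cube_phase_cong:
  assumes "list_all2 (\<lambda>w w'. [w = w'] (mod q ^ L)) ws ws'" "[v = v'] (mod q ^ L)"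
  shows "cube (\<lambda>_. phase q z L) ws v = cube (\<lambda>_. phase q z L) ws' v'"
  using assms
proof (induction ws ws' arbitrary: v v' rule: list_all2_induct)
  case Nil
  then show ?case by (simp add: phase_def cong_def)
next
  case (Cons w ws w' ws')
  then have "cube (\<lambda>_. phase q z L) ws v = cube (\<lambda>_. phase q z L) ws' v'"
    "cube (\<lambda>_. phase q z L) ws (v + w) = cube (\<lambda>_. phase q z L) ws' (v' + w')"
    by (auto intro!: Cons.IH cong_add)
  then show ?case by simp
qed

section \<open>Periodic sums along a progression whose difference shares factors with the
  period\<close>

lemma norm_sum_periodic_le:
  fixes H :: "nat \<Rightarrow> complex"
  assumes "\<And>v. norm (H v) \<le> 1" and per: "\<And>v v'. [v = v'] (mod Q) \<Longrightarrow> H v = H v'" and Q: "Q > 0"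
  shows "norm (\<Sum>k<K. H (r + m * k)) \<le> real (K div Q) * norm (\<Sum>k<Q. H (r + m * k)) + real Q"
proof -
  have "(\<Sum>k<K. H (r + m * k)) = (\<Sum>k<Q * (K div Q) + K mod Q. H (r + m * k))" by simp
  also have "\<dots> = (\<Sum>c<Q. \<Sum>w<K div Q. H (r + m * (c + Q * w))) + (\<Sum>k<K mod Q. H (r + m * (Q * (K div Q) + k)))"
    unfolding sum_lessThan_add sum_lessThan_mult ..
  also have "(\<Sum>c<Q. \<Sum>w<K div Q. H (r + m * (c + Q * w))) = (\<Sum>c<Q. \<Sum>w<K div Q. H (r + m * c))"
  proof (intro sum.cong refl per)
    fix c w
    have "r + m * (c + Q * w) = (r + m * c) + Q * (m * w)" by (simp add: algebra_simps)
    then show "[r + m * (c + Q * w) = r + m * c] (mod Q)" by (simp only: cong_def mod_mult_self2)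
  qed
  also have "\<dots> = of_nat (K div Q) * (\<Sum>k<Q. H (r + m * k))" by (simp add: sum_distrib_left)
  also have "norm (\<dots> + (\<Sum>k<K mod Q. H (r + m * (Q * (K div Q) + k)))) \<le>
     real (K div Q) * norm (\<Sum>k<Q. H (r + m * k)) + (\<Sum>k<K mod Q. 1)"
    by (intro norm_triangle_le add_mono sum_norm_le assms) (simp add: norm_mult)
  also have "\<dots> \<le> real (K div Q) * norm (\<Sum>k<Q. H (r + m * k)) + real Q"
    using Q by (simp add: less_imp_le)
  finally show ?thesis .
qed

lemma sum_affine_mod:
  fixes f :: "nat \<Rightarrow> 'a :: comm_monoid_add"
  assumes "coprime a R" "R > 0"
  shows "(\<Sum>y<R. f ((a * y + s) mod R)) = (\<Sum>y<R. f y)"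
proof -
  have inj: "inj_on (\<lambda>y. (a * y + s) mod R) {..<R}"
  proof (rule inj_onI)
    fix x y assume xy: "x \<in> {..<R}" "y \<in> {..<R}" "(a * x + s) mod R = (a * y + s) mod R"
    then have "[a * x = a * y] (mod R)" by (simp add: cong_def[symmetric] cong_add_rcancel_nat)
    then have "[x = y] (mod R)" using assms(1) by (simp add: cong_mult_lcancel_nat)
    then show "x = y" using xy by (simp add: cong_def)
  qed
  have "(\<lambda>y. (a * y + s) mod R) ` {..<R} = {..<R}"
    by (rule endo_inj_surj[OF _ _ inj]) (use assms in auto)
  then have "bij_betw (\<lambda>y. (a * y + s) mod R) {..<R} {..<R}" using inj by (simp add: bij_betw_def)
  then show ?thesis by (rule sum.reindex_bij_betw)
qed

text \<open>Write m = g m' and A = g g'. Steps of \<open>k\<close> by \<open>g'\<close> move the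
  argument by A m' with m' coprime to \<open>R\<close>, so they run through the whole class modulo
  \<open>A\<close>, meeting each point \<open>g\<close> times. The remaining sum over
  \<open>k < g'\<close> is estimated by norms.\<close>

lemma norm_sum_progression_le:
  fixes H :: "nat \<Rightarrow> complex"
  assumes per: "\<And>v v'. [v = v'] (mod A * R) \<Longrightarrow> H v = H v'" and A: "A > 0" and R: "R > 0"
    and g: "gcd m (A * R) dvd A"
  shows "norm (\<Sum>k<A * R. H (r + m * k)) \<le>
     real (gcd m (A * R)) * (\<Sum>k<A div gcd m (A * R). norm (\<Sum>y<R. H ((r + m * k) mod A + A * y)))"
proof -
  define g where "g = gcd m (A * R)"
  obtain g' where g': "A = g * g'" using g by (auto simp: g_def)
  have gpos: "g > 0" "g' > 0" using A g' by auto
  obtain m' where m': "m = g * m'" using gcd_dvd1[of m "A * R"] unfolding g_def[symmetric] by blast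
  have "coprime (m div g) ((A * R) div g)" unfolding g_def using A R by (intro div_gcd_coprime) auto
  then have "coprime m' (g' * R)" using m' g' gpos by (simp add: mult.assoc)
  then have cop: "coprime m' R" by simp
  have inner: "(\<Sum>k1<R * g. H (r + m * (k + g' * k1))) = of_nat g * (\<Sum>y<R. H ((r + m * k) mod A + A * y))" for k
  proof -
    define v where "v = r + m * k"
    have "(\<Sum>k1<R * g. H (r + m * (k + g' * k1))) = (\<Sum>y<R. \<Sum>t<g. H (r + m * (k + g' * (y + R * t))))"
      by (rule sum_lessThan_mult)
    also have "\<dots> = (\<Sum>y<R. \<Sum>t<g. H (v mod A + A * ((m' * y + v div A) mod R)))"
    proof (intro sum.cong refl per)
      fix y t
      have "r + m * (k + g' * (y + R * t)) = v + A * (m' * y) + A * R * (m' * t)"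
        unfolding v_def g' m' by (simp add: algebra_simps)
      also have "v = v mod A + A * (v div A)" by simp
      finally have "r + m * (k + g' * (y + R * t)) = v mod A + A * (m' * y + v div A) + A * R * (m' * t)"
        by (simp add: algebra_simps)
      then have "[r + m * (k + g' * (y + R * t)) = v mod A + A * (m' * y + v div A)] (mod A * R)"
        by (simp add: cong_def)
      also have "[v mod A + A * (m' * y + v div A) = v mod A + A * ((m' * y + v div A) mod R)] (mod A * R)"
      proof -
        define w where "w = m' * y + v div A"
        have "A * w = A * (w mod R + R * (w div R))" by simp
        then have "v mod A + A * w = (v mod A + A * (w mod R)) + A * R * (w div R)"
          by (simp only: add_mult_distrib2 mult.assoc add.assoc)
        then show ?thesis unfolding w_def[symmetric] by (simp only: cong_def mod_mult_self2)
      qed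
      finally show "[r + m * (k + g' * (y + R * t)) = v mod A + A * ((m' * y + v div A) mod R)] (mod A * R)" .
    qed
    also have "\<dots> = of_nat g * (\<Sum>y<R. H (v mod A + A * ((m' * y + v div A) mod R)))"
      by (simp add: sum_distrib_left)
    also have "(\<Sum>y<R. H (v mod A + A * ((m' * y + v div A) mod R))) = (\<Sum>y<R. H (v mod A + A * y))"
      by (rule sum_affine_mod[OF cop R, where f = "\<lambda>y. H (v mod A + A * y)"])
    finally show ?thesis by (simp add: v_def)
  qed
  have "A * R = g' * (R * g)" by (simp add: g')
  then have "(\<Sum>k<A * R. H (r + m * k)) = (\<Sum>k<g'. \<Sum>k1<R * g. H (r + m * (k + g' * k1)))"
    by (simp only: sum_lessThan_mult)
  also have "\<dots> = of_nat g * (\<Sum>k<g'. \<Sum>y<R. H ((r + m * k) mod A + A * y))"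
    unfolding inner by (simp add: sum_distrib_left)
  also have "norm \<dots> \<le> real g * (\<Sum>k<g'. norm (\<Sum>y<R. H ((r + m * k) mod A + A * y)))"
    by (simp add: norm_mult mult_left_mono sum_norm_le)
  also have "g' = A div g" using g' gpos by simp
  finally show ?thesis unfolding g_def .
qed

lemma cube_phase_full_sum_bound:
  assumes q: "q \<ge> 2" and z: "norm z = 1" and \<delta>: "norm (1 + z ^ (q - 1)) \<le> 2 - \<delta>"
    and L0: "L0 = a + c + 2" and a: "n < q ^ a" and c: "n \<le> q ^ c"
    and J: "J \<le> \<rho>" and g: "gcd m (q ^ \<rho>) dvd q ^ J"
  shows "msum (replicate n (q ^ \<rho>)) (\<lambda>ws. norm (\<Sum>k<q ^ \<rho>. cube (\<lambda>_. phase q z \<rho>) ws (r + m * k)))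
     \<le> (1 - \<delta> / real (q ^ L0) ^ (n + 1)) ^ ((\<rho> - J) div L0) * real (q ^ \<rho>) ^ (n + 1)"
proof -
  define A where "A = q ^ J"
  define R where "R = q ^ (\<rho> - J)"
  define B where "B = (1 - \<delta> / real (q ^ L0) ^ (n + 1)) ^ ((\<rho> - J) div L0)"
  have AR: "q ^ \<rho> = A * R" using J by (simp add: A_def R_def power_add[symmetric])
  have pos: "A > 0" "R > 0" using q by (simp_all add: A_def R_def)
  define gg where "gg = gcd m (q ^ \<rho>)"
  define C where "C ws v = cube (\<lambda>_. phase q z \<rho>) ws v" for ws v
  have per: "C ws v = C ws v'" if "[v = v'] (mod A * R)" for ws v v'
    unfolding C_def using that by (intro cube_phase_cong) (auto simp: AR list_all2_refl)
  have "msum (replicate n (q ^ \<rho>)) (\<lambda>ws. norm (\<Sum>k<A * R. C ws (r + m * k))) \<le>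
     msum (replicate n (q ^ \<rho>)) (\<lambda>ws. real gg * (\<Sum>k<A div gg. norm (\<Sum>y<R. C ws ((r + m * k) mod A + A * y))))"
    unfolding gg_def AR using g pos by (intro msum_mono norm_sum_progression_le per) (auto simp: AR A_def)
  also have "\<dots> = real gg * (\<Sum>k<A div gg. msum (replicate n (q ^ \<rho>)) (\<lambda>ws. norm (\<Sum>y<R. C ws ((r + m * k) mod A + A * y))))"
    unfolding msum_cmult msum_sum ..
  also have "\<dots> \<le> real gg * (\<Sum>k<A div gg. B * real (q ^ \<rho>) ^ n * real R)"
    unfolding C_def A_def R_def B_def
    by (intro mult_left_mono sum_mono cube_phase_progression_bound[OF q z \<delta> L0 a c J]) (use pos A_def in auto)
  also have "\<dots> = real (gg * (A div gg)) * (B * real (q ^ \<rho>) ^ n * real R)" by simp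
  also have "gg * (A div gg) = A" using g by (simp add: gg_def A_def)
  also have "real A * (B * real (q ^ \<rho>) ^ n * real R) = B * real (q ^ \<rho>) ^ (n + 1)"
    by (simp add: AR)
  finally show ?thesis by (simp add: C_def AR B_def)
qed

lemma cube_affine:
  "cube (\<lambda>_ k. f (r + m * k)) ws k = cube (\<lambda>_. f) (map (\<lambda>w. m * w) ws) (r + m * k)"
  by (induction ws arbitrary: k) (simp_all add: algebra_simps)

text \<open>The factor \<open>F i * q ^ l s / T i\<close> is the price of replacing the available shifts in direction \<open>i\<close> by
  all residues modulo \<open>q ^ l s\<close>.\<close>

lemma progression_sum_bound:
  fixes \<kappa> T E M F l :: "nat \<Rightarrow> nat" and z :: complex
  assumes q: "q \<ge> 2" and z: "norm z = 1" and \<delta>: "norm (1 + z ^ (q - 1)) \<le> 2 - \<delta>"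
    and L0: "L0 = a + c + 2" and a: "S < q ^ a" and c: "S \<le> q ^ c"
    and S: "S = Suc s" and KN: "K \<le> N" and N: "N > 0"
    and T: "\<And>i. i < S \<Longrightarrow> T i > 0" and H: "\<And>i. i < S \<Longrightarrow> real (\<kappa> i * T i) \<le> H"
    and dec: "\<And>i. i < s \<Longrightarrow> l (Suc i) \<le> l i"
    and near0: "\<And>h. h < T 0 \<Longrightarrow> near 0 (E 0) (m * (\<kappa> 0 * h))"
    and near: "\<And>i h. i < s \<Longrightarrow> h < T (Suc i) \<Longrightarrow> near (q ^ l i) (E (Suc i)) (m * (\<kappa> (Suc i) * h))"
    and bad: "\<And>i r. i \<le> s \<Longrightarrow> card {k. k < N \<and> \<not> central (E i) (q ^ l i) (r + m * k)} \<le> M i"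
    and fib: "\<And>i x. i < S \<Longrightarrow> card {h. h < T i \<and> m * \<kappa> i * h mod q ^ l s = x} \<le> F i"
    and J: "J \<le> l s" and g: "gcd m (q ^ l s) dvd q ^ J"
  shows "(norm (\<Sum>k<K. z ^ digit_sum q (r + m * k)) / N) ^ (2 ^ S) \<le>
     vdc_const S * ((\<Prod>i<S. real (F i) * real (q ^ l s) / real (T i)) * (1 - \<delta> / real (q ^ L0) ^ (S + 1)) ^ ((l s - J) div L0)
       + (H + real (q ^ l s) + 2 ^ (S + 1) * (\<Sum>i\<le>s. real (M i))) / N)"
proof -
  define Q where "Q = q ^ l s"
  define f where "f v = z ^ digit_sum q v" for v
  define \<kappa>s where "\<kappa>s = map \<kappa> [0..<S]"
  define Ts where "Ts = map T [0..<S]"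
  define cMs where "cMs = map (\<lambda>i. (m * \<kappa> i, F i)) [0..<S]"
  define B where "B = (1 - \<delta> / real (q ^ L0) ^ (S + 1)) ^ ((l s - J) div L0)"
  define W where "W ws = norm (\<Sum>k<Q. cube (\<lambda>_. phase q z (l s)) ws (r + m * k))" for ws
  define e where "e = 2 ^ (S + 1) * (\<Sum>i\<le>s. real (M i))"
  have Q: "Q > 0" using q by (simp add: Q_def)
  have len: "length \<kappa>s = S" "length Ts = S" by (simp_all add: \<kappa>s_def Ts_def)
  have "0 \<notin> set Ts" using T by (force simp: Ts_def)
  then have "prod_list Ts \<noteq> 0" by (simp add: prod_list_zero_iff)
  then have prodT: "real (prod_list Ts) > 0" by (simp only: of_nat_0_less_iff neq0_conv)
  have "0 \<le> real (\<kappa> 0 * T 0)" by simp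
  also have "\<dots> \<le> H" using H[of 0] S by simp
  finally have H0: "H \<ge> 0" .
  have pointwise: "norm (\<Sum>k<K. cube (\<lambda>_ k. f (r + m * k)) (map2 (*) \<kappa>s hs) k) / N \<le>
      (1 / Q) * W (map2 (\<lambda>c h. c * h mod Q) (map fst cMs) hs) + (real Q + e) / N"
    if hs: "list_all2 (<) hs Ts" for hs
  proof -
    define ws where "ws = map2 (\<lambda>\<kappa> h. m * (\<kappa> * h)) \<kappa>s hs"
    have lhs: "length hs = S" using hs len by (simp add: list_all2_lengthD[OF hs])
    have hT: "hs ! i < T i" if "i < S" for i
      using hs that lhs by (auto simp: list_all2_conv_all_nth Ts_def)
    have ws: "length ws = S" "\<And>i. i < S \<Longrightarrow> ws ! i = m * (\<kappa> i * hs ! i)"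
      using lhs len by (simp_all add: ws_def \<kappa>s_def)
    have "(\<Sum>k<K. cube (\<lambda>_ k. f (r + m * k)) (map2 (*) \<kappa>s hs) k) = (\<Sum>k<K. cube (\<lambda>_ v. z ^ digit_sum q v) ws (r + m * k))"
    proof (rule sum.cong[OF refl])
      fix k
      show "cube (\<lambda>_ k. f (r + m * k)) (map2 (*) \<kappa>s hs) k = cube (\<lambda>_ v. z ^ digit_sum q v) ws (r + m * k)"
        using cube_affine[of f r m "map2 (*) \<kappa>s hs" k]
        by (simp add: ws_def o_def case_prod_unfold) (simp add: f_def[abs_def])
    qed
    also have "norm \<dots> \<le> norm (\<Sum>k<K. cube (\<lambda>_. phase q z (l s)) ws (r + m * k)) + 2 * real (\<Sum>i\<le>s. 2 ^ length ws * M i)"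
    proof (rule norm_sum_cube_truncate_le[OF q z, where E = E and l = l and n = s and M = M])
      show "l (Suc i) \<le> l i" if "i < s" for i using dec that .
      show "s < length ws" using ws S by simp
      show "near 0 (E 0) (ws ! 0)" using ws(2)[of 0] S near0 hT[of 0] by simp
      show "near (q ^ l i) (E (Suc i)) (ws ! Suc i)" if "i < s" for i
        using ws(2)[of "Suc i"] that S near hT[of "Suc i"] by simp
      show "card {k. k < K \<and> \<not> central (E i) (q ^ l i) (r + m * k)} \<le> M i" if "i \<le> s" for i r
      proof -
        have "card {k. k < K \<and> \<not> central (E i) (q ^ l i) (r + m * k)} \<le> card {k. k < N \<and> \<not> central (E i) (q ^ l i) (r + m * k)}"
          using KN by (intro card_mono) auto
        then show ?thesis using bad[OF that, of r] by simp
      qed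
    qed
    also have "2 * real (\<Sum>i\<le>s. 2 ^ length ws * M i) = e"
      by (simp add: e_def ws sum_distrib_left mult.assoc)
    also have "norm (\<Sum>k<K. cube (\<lambda>_. phase q z (l s)) ws (r + m * k)) \<le>
       real (K div Q) * norm (\<Sum>k<Q. cube (\<lambda>_. phase q z (l s)) ws (r + m * k)) + real Q"
    proof (rule norm_sum_periodic_le[OF _ _ Q])
      show "norm (cube (\<lambda>_. phase q z (l s)) ws v) \<le> 1" for v using z by (intro norm_cube_le_1) simp
      show "cube (\<lambda>_. phase q z (l s)) ws v = cube (\<lambda>_. phase q z (l s)) ws v'" if "[v = v'] (mod Q)" for v v'
        using that unfolding Q_def by (intro cube_phase_cong) (auto simp: list_all2_refl)
    qed
    also have "norm (\<Sum>k<Q. cube (\<lambda>_. phase q z (l s)) ws (r + m * k)) = W (map2 (\<lambda>c h. c * h mod Q) (map fst cMs) hs)"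
      unfolding W_def
    proof (intro arg_cong[of _ _ norm] sum.cong refl cube_phase_cong)
      show "list_all2 (\<lambda>w w'. [w = w'] (mod q ^ l s)) ws (map2 (\<lambda>c h. c * h mod Q) (map fst cMs) hs)"
        unfolding list_all2_conv_all_nth using ws lhs
        by (auto simp: cMs_def Q_def cong_def mult.assoc)
    qed auto
    finally have "norm (\<Sum>k<K. cube (\<lambda>_ k. f (r + m * k)) (map2 (*) \<kappa>s hs) k) / N \<le>
      (real (K div Q) * W (map2 (\<lambda>c h. c * h mod Q) (map fst cMs) hs) + real Q + e) / N"
      by (intro divide_right_mono) auto
    also have "\<dots> = (real (K div Q) / N) * W (map2 (\<lambda>c h. c * h mod Q) (map fst cMs) hs) + (real Q + e) / N"
      by (simp add: add_divide_distrib)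
    also have "\<dots> \<le> (1 / Q) * W (map2 (\<lambda>c h. c * h mod Q) (map fst cMs) hs) + (real Q + e) / N"
    proof (intro add_mono mult_right_mono order.refl)
      have "real (K div Q) \<le> real K / real Q" by (rule of_nat_div_le_of_nat)
      also have "\<dots> \<le> real N / real Q" using KN by (intro divide_right_mono) auto
      finally show "real (K div Q) / N \<le> 1 / Q" using N Q by (simp add: field_simps)
    qed (simp add: W_def)
    finally show ?thesis .
  qed
  have WB: "msum (replicate S Q) W \<le> B * real Q ^ (S + 1)"
    using cube_phase_full_sum_bound[OF q z \<delta> L0 a c J g] by (simp add: W_def[abs_def] Q_def B_def)
  have "(norm (\<Sum>k<K. f (r + m * k)) / N) ^ (2 ^ length Ts) \<le> vdc_const (length Ts) *
     (msum Ts (\<lambda>hs. norm (\<Sum>k<K. cube (\<lambda>_ k. f (r + m * k)) (map2 (*) \<kappa>s hs) k) / N) / prod_list Ts + H / N)"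
  proof (rule van_der_corput_iterated[OF _ KN N _ _ _ H0])
    show "norm (f (r + m * k)) \<le> 1" for k using z by (simp add: f_def norm_power)
    show "\<forall>(\<kappa>, T)\<in>set (zip \<kappa>s Ts). real (\<kappa> * T) \<le> H"
      using H by (auto simp: set_zip \<kappa>s_def Ts_def)
  qed (use T len in \<open>auto simp: Ts_def\<close>)
  also have "\<dots> \<le> vdc_const S * ((\<Prod>i<S. real (F i) * real Q / real (T i)) * B + (real Q + e) / N + H / N)"
    unfolding len
  proof (intro mult_left_mono add_mono order.refl)
    have "msum Ts (\<lambda>hs. norm (\<Sum>k<K. cube (\<lambda>_ k. f (r + m * k)) (map2 (*) \<kappa>s hs) k) / N) \<le>
       msum Ts (\<lambda>hs. (1 / Q) * W (map2 (\<lambda>c h. c * h mod Q) (map fst cMs) hs) + (real Q + e) / N)"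
      by (intro msum_mono pointwise)
    also have "\<dots> = (1 / Q) * msum Ts (\<lambda>hs. W (map2 (\<lambda>c h. c * h mod Q) (map fst cMs) hs)) + real (prod_list Ts) * ((real Q + e) / N)"
      unfolding msum_add msum_cmult msum_const ..
    also have "msum Ts (\<lambda>hs. W (map2 (\<lambda>c h. c * h mod Q) (map fst cMs) hs)) \<le>
        real (prod_list (map snd cMs)) * msum (replicate (length Ts) Q) W"
    proof (rule msum_residues_le[OF Q])
      show "list_all2 (\<lambda>(c, M) T. \<forall>x. card {h. h < T \<and> c * h mod Q = x} \<le> M) cMs Ts"
        using fib by (auto simp: list_all2_conv_all_nth cMs_def Ts_def Q_def)
    qed (simp add: W_def)
    also have "\<dots> \<le> real (prod_list (map snd cMs)) * (B * real Q ^ (S + 1))"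
      unfolding len by (intro mult_left_mono WB) simp
    finally have "msum Ts (\<lambda>hs. norm (\<Sum>k<K. cube (\<lambda>_ k. f (r + m * k)) (map2 (*) \<kappa>s hs) k) / N) / prod_list Ts \<le>
      ((1 / Q) * (real (prod_list (map snd cMs)) * (B * real Q ^ (S + 1))) + real (prod_list Ts) * ((real Q + e) / N)) / prod_list Ts"
      by (intro divide_right_mono) (auto intro: mult_left_mono simp: divide_right_mono)
    also have "\<dots> = (real (prod_list (map snd cMs)) * real Q ^ S / real (prod_list Ts)) * B + (real Q + e) / N"
      using prodT Q by (simp add: field_simps)
    also have "real (prod_list (map snd cMs)) * real Q ^ S / real (prod_list Ts) = (\<Prod>i<S. real (F i) * real Q / real (T i))"
    proof -
      have 1: "prod_list (map snd cMs) = (\<Prod>i<S. F i)" "prod_list Ts = (\<Prod>i<S. T i)"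
        by (simp_all add: cMs_def Ts_def o_def prod.distinct_set_conv_list[symmetric] atLeast0LessThan)
      show ?thesis unfolding 1 by (simp add: prod.distrib prod_dividef)
    qed
    finally show "msum Ts (\<lambda>hs. norm (\<Sum>k<K. cube (\<lambda>_ k. f (r + m * k)) (map2 (*) \<kappa>s hs) k) / N) / prod_list Ts \<le>
      (\<Prod>i<S. real (F i) * real Q / real (T i)) * B + (real Q + e) / N" .
  qed (use vdc_const_ge_1[of S] in simp)
  finally show ?thesis using len by (simp add: f_def Q_def B_def e_def add_divide_distrib add_ac)
qed

section \<open>The chain of digit levels\<close>

lemma near_mult:
  assumes "near Q I w" "h \<le> T" "I * T \<le> E"
  shows "near Q E (w * h)"
proof -
  obtain e :: int where e: "\<bar>e\<bar> \<le> int I" "[int w = e] (mod int Q)" using assms(1) by (auto simp: near_def)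
  have "[int (w * h) = e * int h] (mod int Q)" using cong_mult[OF e(2) cong_refl[of "int h"]] by simp
  moreover have "\<bar>e * int h\<bar> \<le> int E"
  proof -
    have "\<bar>e * int h\<bar> = \<bar>e\<bar> * int h" by (simp add: abs_mult)
    also have "\<dots> \<le> int I * int T" using e assms(2) by (intro mult_mono) auto
    also have "\<dots> \<le> int E" using assms(3) by (simp only: of_nat_mult[symmetric] of_nat_le_iff)
    finally show ?thesis .
  qed
  ultimately show ?thesis unfolding near_def by blast
qed

lemma near_mono: "near Q I w \<Longrightarrow> I \<le> I' \<Longrightarrow> near Q I' w"
  unfolding near_def by (meson of_nat_le_iff order.trans)

lemma near_small: "w \<le> E \<Longrightarrow> near Q E w"
  unfolding near_def by (intro exI[of _ "int w"]) auto

text \<open>Approximate m / (B I) with denominator at most \<open>B\<close>: an error below 1 / B in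
  the fraction becomes an error below \<open>I\<close> after multiplication by the modulus.\<close>

lemma near_approx_exists:
  assumes "B > 0" "I > 0"
  obtains k where "1 \<le> k" "k \<le> B" "near (B * I) I (m * k)"
proof -
  define Q where "Q = B * I"
  have Q: "Q > 0" using assms by (simp add: Q_def)
  obtain h k where hk: "0 < k" "k \<le> int B" "\<bar>of_int k * (real m / real Q) - of_int h\<bar> < 1 / B"
    using Dirichlet_approx[OF assms(1), of "real m / real Q"] by blast
  have "\<bar>of_int k * (real m / real Q) - of_int h\<bar> * real Q < 1 / B * real Q"
    using hk(3) Q by (intro mult_strict_right_mono) auto
  moreover have "\<bar>of_int k * (real m / real Q) - of_int h\<bar> * real Q = \<bar>of_int (k * int m - h * int Q)\<bar>"
  proof -
    have "\<bar>of_int k * (real m / real Q) - of_int h\<bar> * real Q = \<bar>(of_int k * (real m / real Q) - of_int h) * real Q\<bar>"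
      using Q by (simp add: abs_mult)
    also have "(of_int k * (real m / real Q) - of_int h) * real Q = of_int (k * int m - h * int Q)"
      using Q by (simp add: field_simps)
    finally show ?thesis .
  qed
  moreover have "1 / B * real Q = real I" using assms by (simp add: Q_def)
  ultimately have "\<bar>real_of_int (k * int m - h * int Q)\<bar> < real_of_int (int I)" by simp
  then have "\<bar>k * int m - h * int Q\<bar> \<le> int I" by linarith
  moreover have "[int (m * nat k) = k * int m - h * int Q] (mod int Q)"
    using hk(1) by (simp add: cong_iff_dvd_diff mult.commute)
  ultimately have "near Q I (m * nat k)" unfolding near_def by blast
  then show ?thesis using that[of "nat k"] hk unfolding Q_def by auto
qed

text \<open>\<open>\<rho>\<close> is the number of digits that survive all steps, and
  \<open>J\<close> bounds the tolerated common prime powers with \<open>q\<close>. The last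
  condition lets \<open>s - 2\<close> drops of at most \<open>6 * \<rho>\<close> lead from the top
  level \<open>d + 2 * \<rho> + 2\<close> to \<open>16 * \<rho>\<close>.\<close>

locale level_params =
  fixes q d \<rho> J s D :: nat
  assumes q: "q \<ge> 2" and D: "q ^ d \<le> D" "D < q ^ (d + 1)"
    and J: "1 \<le> J" "2 * J + 1 \<le> \<rho>" and d: "16 * \<rho> \<le> d"
    and s: "3 \<le> s" "d + 2 * \<rho> + 2 \<le> 16 * \<rho> + 6 * \<rho> * (s - 2)"
begin

text \<open>A Dirichlet multiplier at most \<open>q ^ (8 * \<rho>)\<close>, times a shift below
  \<open>q ^ \<rho>\<close>, moves numbers by at most \<open>q ^ (lev i - 7 * \<rho>)\<close> modulo
  the level; a drop of \<open>6 * \<rho>\<close> leaves \<open>\<rho>\<close> digits as a safety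
  margin. The moduli used for Dirichlet end at \<open>16 * \<rho>\<close>, where the square of the
  multiplier bound still fits below the modulus. The level \<open>10 * \<rho>\<close> lies under the
  length \<open>N\<close>, so full periods are available, and one Bezout relation leads from it to
  \<open>\<rho>\<close>.\<close>

definition lev :: "nat \<Rightarrow> nat" where
  "lev i = (if i = s then \<rho> else if i = s - 1 then 10 * \<rho> else max (16 * \<rho>) (d + 2 * \<rho> + 2 - 6 * \<rho> * i))"

text \<open>The tolerance is a small fraction of the level, so that only a proportion of order
  \<open>q ^ - J\<close> of the residues is within reach of a carry.\<close>

definition E :: "nat \<Rightarrow> nat" where "E i = q ^ (lev i - J - 1)"

text \<open>Long compared with the van der Corput shifts, at most \<open>q ^ (11 * \<rho>)\<close>,
  but still at most x / D in the application.\<close>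

definition N :: nat where "N = q ^ (15 * \<rho>)"

text \<open>Dirichlet's theorem gives no control over which multiplier it returns. Therefore every
  admissible \<open>k\<close> with a high common prime power is excluded beforehand.\<close>

definition exceptional :: "nat \<Rightarrow> bool" where
  "exceptional m \<longleftrightarrow> (\<exists>p. prime p \<and> p dvd q \<and> (p ^ J dvd m \<or>
     (\<exists>i<s - 1. \<exists>k. 1 \<le> k \<and> k \<le> q ^ (8 * \<rho>) \<and> p ^ J dvd k \<and> near (q ^ lev i) (q ^ (lev i - 8 * \<rho>)) (m * k))))"

definition M :: "nat \<Rightarrow> nat \<Rightarrow> nat" where
  "M i m = 1 + card {j. 1 \<le> j \<and> j < N \<and> near (q ^ lev i) (2 * E i) (m * j)}"

lemma lev_0: "lev 0 = d + 2 * \<rho> + 2" using s d by (auto simp: lev_def)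
lemma lev_last: "lev s = \<rho>" by (simp add: lev_def)
lemma lev_pred: "lev (s - 1) = 10 * \<rho>" using s by (auto simp: lev_def)
lemma lev_mid: "i \<le> s - 2 \<Longrightarrow> lev i = max (16 * \<rho>) (d + 2 * \<rho> + 2 - 6 * \<rho> * i)"
  using s by (auto simp: lev_def)
lemma lev_end: "lev (s - 2) = 16 * \<rho>"
  using s by (subst lev_mid) (auto simp: max_def)

lemma lev_ge: "i \<le> s - 2 \<Longrightarrow> 16 * \<rho> \<le> lev i" by (simp add: lev_mid)

lemma lev_ge_rho: "i \<le> s \<Longrightarrow> \<rho> \<le> lev i"
  by (auto simp: lev_def)

lemma lev_le_d: "1 \<le> i \<Longrightarrow> i \<le> s - 2 \<Longrightarrow> lev i \<le> d"
proof -
  assume i: "1 \<le> i" "i \<le> s - 2"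
  have "6 * \<rho> * 1 \<le> 6 * \<rho> * i" using i by (intro mult_le_mono2) auto
  then have "d + 2 * \<rho> + 2 - 6 * \<rho> * i \<le> d + 2 * \<rho> + 2 - 6 * \<rho>" by (intro diff_le_mono2) simp
  also have "\<dots> \<le> d" using J by simp
  finally show ?thesis using d i by (simp add: lev_mid)
qed

lemma lev_step: "i < s - 1 \<Longrightarrow> lev i \<le> lev (Suc i) + 6 * \<rho>"
proof -
  assume i: "i < s - 1"
  show ?thesis
  proof (cases "Suc i = s - 1")
    case True
    then have "i = s - 2" using s by simp
    then show ?thesis using lev_end lev_pred True by simp
  next
    case False
    then have "Suc i \<le> s - 2" using i by simp
    then show ?thesis by (auto simp: lev_mid max_def)
  qed
qed

lemma lev_dec: "i < s \<Longrightarrow> lev (Suc i) \<le> lev i"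
proof -
  assume i: "i < s"
  consider "Suc i = s" | "Suc i = s - 1" | "Suc i \<le> s - 2" using i by linarith
  then show ?thesis
  proof cases
    case 1
    then have "i = s - 1" by simp
    then show ?thesis using lev_last lev_pred 1 by simp
  next
    case 2
    then have "i = s - 2" using s by simp
    then show ?thesis using lev_end lev_pred 2 by simp
  next
    case 3
    then show ?thesis by (auto simp: lev_mid max_def)
  qed
qed

lemma power_le: "a \<le> b \<Longrightarrow> q ^ a \<le> q ^ b"
  using q by (intro power_increasing) auto

lemma rho3: "3 \<le> \<rho>" using J by simp

lemma gcd_le:
  assumes "k > 0" "\<And>p. prime p \<Longrightarrow> p dvd q \<Longrightarrow> \<not> p ^ J dvd k"
  shows "gcd k (q ^ L) dvd q ^ J" "gcd k (q ^ L) \<le> q ^ J"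
proof -
  show "gcd k (q ^ L) dvd q ^ J" using q assms by (intro gcd_power_dvd) auto
  then show "gcd k (q ^ L) \<le> q ^ J" using q by (intro dvd_imp_le) auto
qed

lemma card_not_central_le_M:
  "card {k. k < N \<and> \<not> central (E i) (q ^ lev i) (r + m * k)} \<le> M i m"
  unfolding M_def using q by (intro card_not_central_le) auto

lemma unexceptional_sum_bound:
  fixes z :: complex
  assumes m: "D < m" "m \<le> q * D" and ne: "\<not> exceptional m"
    and z: "norm z = 1" and \<delta>: "norm (1 + z ^ (q - 1)) \<le> 2 - \<delta>"
    and L0: "L0 = a + c + 2" and a: "s + 1 < q ^ a" and c: "s + 1 \<le> q ^ c"
    and K: "K \<le> N"
  shows "(norm (\<Sum>k<K. z ^ digit_sum q (r + m * k)) / N) ^ (2 ^ (s + 1)) \<le>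
     vdc_const (s + 1) * (real q ^ ((2 * s + 2) * J + 1) * (1 - \<delta> / real (q ^ L0) ^ (s + 2)) ^ ((\<rho> - J) div L0)
       + (real q ^ (11 * \<rho>) + real q ^ \<rho> + 2 ^ (s + 2) * (\<Sum>i\<le>s. real (M i m))) / N)"
proof -
  have mp: "m > 0" using m by simp
  have mJ: "\<not> p ^ J dvd m" if "prime p" "p dvd q" for p using ne that by (auto simp: exceptional_def)
  have "\<exists>k. 1 \<le> k \<and> k \<le> q ^ (8 * \<rho>) \<and> near (q ^ lev i) (q ^ (lev i - 8 * \<rho>)) (m * k)" if "i < s - 1" for i
  proof -
    have "16 * \<rho> \<le> lev i" using that by (intro lev_ge) auto
    then have eq: "q ^ (8 * \<rho>) * q ^ (lev i - 8 * \<rho>) = q ^ lev i" by (simp add: power_add[symmetric])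
    show ?thesis using near_approx_exists[of "q ^ (8 * \<rho>)" "q ^ (lev i - 8 * \<rho>)" m] q unfolding eq by auto
  qed
  then obtain k where k: "\<And>i. i < s - 1 \<Longrightarrow> 1 \<le> k i" "\<And>i. i < s - 1 \<Longrightarrow> k i \<le> q ^ (8 * \<rho>)"
    "\<And>i. i < s - 1 \<Longrightarrow> near (q ^ lev i) (q ^ (lev i - 8 * \<rho>)) (m * k i)" by metis
  have kJ: "\<not> p ^ J dvd k i" if "prime p" "p dvd q" "i < s - 1" for p i
  proof
    assume "p ^ J dvd k i"
    then have "exceptional m" unfolding exceptional_def using that k by blast
    then show False using ne by contradiction
  qed
  define P where "P = q ^ (10 * \<rho>)"
  have Ppos: "P > 0" using q by (simp add: P_def)
  \<comment> \<open>Here \<open>m\<close> times the multiplier is congruent to a number at most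
    \<open>q ^ J\<close>, so that the level can fall to \<open>\<rho>\<close> at once. Reducing the
    multiplier modulo \<open>P\<close> keeps it below \<open>q ^ (10 * \<rho>)\<close>, short
    against \<open>N\<close>.\<close>
  obtain b0 where b0: "[m * b0 = gcd m P] (mod P)" using cong_solve_nat[of m P] mp by auto
  define b where "b = b0 mod P"
  have bP: "b < P" using Ppos by (simp add: b_def)
  have bm: "[m * b = gcd m P] (mod P)" using b0 by (simp add: b_def cong_def mod_mult_right_eq)
  define \<kappa> where "\<kappa> i = (if i = 0 then 1 else if i = s then b else k (i - 1))" for i
  \<comment> \<open>\<open>q ^ J * q ^ (\<rho> - 2 * J - 1)\<close> is exactly \<open>E s\<close>,
    which fixes the last range. In it the residues \<open>g * h\<close> do not wrap around and are
    distinct, whence \<open>F s = 1\<close>. In the other directions a fibre has at most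
    \<open>q ^ J * q ^ J\<close> elements, one factor from \<open>m\<close> and one from the
    multiplier.\<close>
  define T where "T i = (if i = s then q ^ (\<rho> - 2 * J - 1) else q ^ \<rho>)" for i
  define F where "F i = (if i = s then 1 else q ^ (2 * J))" for i
  have gP: "gcd m P \<le> q ^ J" unfolding P_def using mJ by (intro gcd_le mp) auto
  have gQ: "gcd m (q ^ lev s) dvd q ^ J" using mJ by (intro gcd_le mp) auto
  have \<kappa>0: "\<kappa> 0 = 1" "\<kappa> s = b" "\<And>i. i < s - 1 \<Longrightarrow> \<kappa> (Suc i) = k i" using s by (auto simp: \<kappa>_def)
  have T0: "T s = q ^ (\<rho> - 2 * J - 1)" "\<And>i. i < s \<Longrightarrow> T i = q ^ \<rho>" by (auto simp: T_def)
  have nearX: "near (q ^ lev i) (E (Suc i)) (m * (\<kappa> (Suc i) * h))" if "i < s" "h < T (Suc i)" for i h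
  proof (cases "Suc i = s")
    case False
    then have i: "i < s - 1" using that by simp
    have l: "16 * \<rho> \<le> lev i" using i by (intro lev_ge) auto
    have "near (q ^ lev i) (E (Suc i)) (m * k i * h)"
    proof (rule near_mult[OF k(3)[OF i]])
      show "h \<le> q ^ \<rho>" using that False by (simp add: T_def)
      show "q ^ (lev i - 8 * \<rho>) * q ^ \<rho> \<le> E (Suc i)"
        unfolding E_def power_add[symmetric] using lev_step[OF i] l J by (intro power_le) simp
    qed
    then show ?thesis using \<kappa>0(3)[OF i] by (simp add: mult.assoc)
  next
    case True
    then have i: "i = s - 1" by simp
    have "near P (E s) (m * b * h)"
    proof (rule near_mult)
      have "near P (gcd m P) (m * b)"
        using near_mod_cong[OF bm] near_small[of "gcd m P" "gcd m P" P] by simp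
      then show "near P (q ^ J) (m * b)" using gP by (rule near_mono)
      show "h \<le> q ^ (\<rho> - 2 * J - 1)" using that True by (simp add: T_def)
      show "q ^ J * q ^ (\<rho> - 2 * J - 1) \<le> E s"
        unfolding E_def power_add[symmetric] lev_last using J by (intro power_le) simp
    qed
    then show ?thesis using i lev_pred True \<kappa>0 by (simp add: mult.assoc P_def)
  qed
  have near0: "near 0 (E 0) (m * (\<kappa> 0 * h))" if "h < T 0" for h
  proof (rule near_small)
    have "h \<le> q ^ \<rho>" using that T0(2)[of 0] s by simp
    moreover have "m \<le> q ^ (d + 2)"
    proof -
      have "m \<le> q * D" by fact
      also have "\<dots> \<le> q * q ^ (d + 1)" using D by (intro mult_le_mono2) simp
      finally show ?thesis by simp
    qed
    ultimately have "m * h \<le> q ^ (d + 2) * q ^ \<rho>" by (intro mult_le_mono)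
    also have "\<dots> \<le> E 0" unfolding E_def power_add[symmetric] lev_0 using J by (intro power_le) simp
    finally show "m * (\<kappa> 0 * h) \<le> E 0" using \<kappa>0 by simp
  qed
  have Hb: "real (\<kappa> i * T i) \<le> real q ^ (11 * \<rho>)" if i: "i < s + 1" for i
  proof -
    have "\<kappa> i * T i \<le> q ^ (11 * \<rho>)"
    proof -
      consider "i = 0" | "i = s" | j where "i = Suc j" "j < s - 1" using i
        by (metis Suc_pred' less_Suc_eq less_Suc_eq_0_disj Suc_eq_plus1 diff_Suc_1 not_less_eq Suc_less_eq2)
      then show ?thesis
      proof cases
        case 1
        then show ?thesis using T0(2)[of 0] s power_le[of \<rho> "11 * \<rho>"] \<kappa>0 by simp
      next
        case 2
        have "b * q ^ (\<rho> - 2 * J - 1) \<le> q ^ (10 * \<rho>) * q ^ \<rho>"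
          using bP by (intro mult_le_mono power_le) (auto simp: P_def)
        then show ?thesis using 2 T0 \<kappa>0 by (simp add: power_add[symmetric])
      next
        case 3
        have "k j * q ^ \<rho> \<le> q ^ (8 * \<rho>) * q ^ \<rho>" using k(2)[OF 3(2)] by (intro mult_le_mono) auto
        also have "\<dots> \<le> q ^ (11 * \<rho>)" unfolding power_add[symmetric] by (intro power_le) simp
        finally show ?thesis using 3 T0(2)[of i] \<kappa>0(3)[of j] by simp
      qed
    qed
    then show ?thesis by (metis of_nat_le_iff of_nat_power)
  qed
  have fib: "card {h. h < T i \<and> m * \<kappa> i * h mod q ^ lev s = x} \<le> F i" if i: "i < s + 1" for i x
  proof (cases "i = s")
    case True
    define g where "g = gcd m P"
    have gpos: "g > 0" using Ppos by (simp add: g_def)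
    have res: "m * b * h mod q ^ \<rho> = g * h" if "h < T s" for h
    proof -
      have "q ^ \<rho> dvd P" unfolding P_def by (intro le_imp_power_dvd) simp
      then have "[m * b = g] (mod q ^ \<rho>)" using bm unfolding g_def by (rule cong_dvd_modulus_nat[rotated])
      then have "[m * b * h = g * h] (mod q ^ \<rho>)" by (rule cong_mult) simp
      moreover have "g * h < q ^ \<rho>"
      proof -
        have "g * h < q ^ J * q ^ (\<rho> - 2 * J - 1)"
          using that gP gpos q unfolding g_def[symmetric] T0(1) by (intro mult_le_less_imp_less) auto
        also have "\<dots> \<le> q ^ \<rho>" unfolding power_add[symmetric] using J by (intro power_le) simp
        finally show ?thesis .
      qed
      ultimately show ?thesis by (simp add: cong_def)
    qed
    have "card {h. h < T s \<and> m * b * h mod q ^ \<rho> = x} \<le> 0 + 1"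
    proof (rule card_le_diameter)
      fix h h' assume "h \<in> {h. h < T s \<and> m * b * h mod q ^ \<rho> = x}" "h' \<in> {h. h < T s \<and> m * b * h mod q ^ \<rho> = x}"
      then have "g * h = g * h'" using res[of h] res[of h'] by auto
      then show "h' - h \<le> 0" using gpos by simp
    qed
    then show ?thesis using True \<kappa>0 lev_last by (simp add: F_def)
  next
    case False
    define Q where "Q = q ^ \<rho>"
    have Q: "Q > 0" using q by (simp add: Q_def)
    have "card {h. h < Q \<and> m * \<kappa> i * h mod Q = x} \<le> gcd (m * \<kappa> i) Q" by (rule card_residue_fibre_le[OF Q])
    also have "\<dots> \<le> gcd m Q * gcd (\<kappa> i) Q" by (rule gcd_mult_le[OF Q])
    also have "\<dots> \<le> q ^ J * q ^ J"
    proof (intro mult_le_mono)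
      show "gcd m Q \<le> q ^ J" unfolding Q_def using mJ by (intro gcd_le mp) auto
      show "gcd (\<kappa> i) Q \<le> q ^ J"
      proof (cases i)
        case 0
        then show ?thesis using \<kappa>0 q by simp
      next
        case (Suc j)
        then have j: "j < s - 1" using i False by simp
        then show ?thesis unfolding Q_def Suc \<kappa>0(3)[OF j] using kJ k(1)[OF j] by (intro gcd_le) auto
      qed
    qed
    also have "\<dots> = q ^ (2 * J)" by (simp add: power_add[symmetric] mult_2)
    finally show ?thesis using False T0(2)[of i] i by (simp add: F_def Q_def lev_last)
  qed
  have "(norm (\<Sum>k<K. z ^ digit_sum q (r + m * k)) / N) ^ (2 ^ Suc s) \<le>
     vdc_const (Suc s) * ((\<Prod>i<Suc s. real (F i) * real (q ^ lev s) / real (T i)) * (1 - \<delta> / real (q ^ L0) ^ (Suc s + 1)) ^ ((lev s - J) div L0)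
       + (real q ^ (11 * \<rho>) + real (q ^ lev s) + 2 ^ (Suc s + 1) * (\<Sum>i\<le>s. real (M i m))) / N)"
  proof (rule progression_sum_bound[OF q z \<delta> L0, where \<kappa> = \<kappa> and T = T and F = F and E = E and l = lev and s = s])
    show "K \<le> N" by fact
    show "N > 0" using q by (simp add: N_def)
    show "T i > 0" for i using q by (simp add: T_def)
    show "J \<le> lev s" using J lev_last by simp
    show "card {k. k < N \<and> \<not> central (E i) (q ^ lev i) (r + m * k)} \<le> M i m" for i r
      by (rule card_not_central_le_M)
  qed (use a c near0 nearX Hb fib gQ lev_dec in auto)
  \<comment> \<open>Each of the first \<open>s\<close> directions costs its fibre size
    \<open>q ^ (2 * J)\<close>; the last one costs \<open>q ^ (2 * J + 1)\<close> through its
    shorter range.\<close>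
  also have "(\<Prod>i<Suc s. real (F i) * real (q ^ lev s) / real (T i)) = real q ^ ((2 * s + 2) * J + 1)"
  proof -
    have qp: "real q > 0" using q by simp
    have "(\<Prod>i<s. real (F i) * real (q ^ lev s) / real (T i)) = (\<Prod>i<s. real q ^ (2 * J))"
      using qp by (intro prod.cong) (auto simp: F_def T_def lev_last)
    also have "\<dots> = real q ^ (2 * J * s)" by (simp add: power_mult)
    finally have 1: "(\<Prod>i<s. real (F i) * real (q ^ lev s) / real (T i)) = real q ^ (2 * J * s)" .
    have "real q ^ \<rho> = real q ^ (\<rho> - 2 * J - 1) * real q ^ (2 * J + 1)"
      using J by (simp only: power_add[symmetric]) simp
    then have 2: "real (F s) * real (q ^ lev s) / real (T s) = real q ^ (2 * J + 1)"
      using qp by (simp add: F_def T_def lev_last)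
    show ?thesis unfolding prod.lessThan_Suc 1 2 by (simp add: power_add[symmetric] algebra_simps)
  qed
  finally show ?thesis by (simp add: lev_last)
qed

end

section \<open>Averaging over the moduli\<close>

lemma sum_card_swap:
  assumes "finite A" "finite B"
  shows "(\<Sum>m\<in>B. card {j \<in> A. P m j}) = (\<Sum>j\<in>A. card {m \<in> B. P m j})"
proof -
  have "(\<Sum>m\<in>B. card {j \<in> A. P m j}) = (\<Sum>m\<in>B. \<Sum>j\<in>A. if P m j then 1 else 0)"
    by (simp only: card_eq_sum sum.inter_filter[OF assms(1)])
  also have "\<dots> = (\<Sum>j\<in>A. \<Sum>m\<in>B. if P m j then 1 else 0)" by (rule sum.swap)
  also have "\<dots> = (\<Sum>j\<in>A. card {m \<in> B. P m j})"
    by (simp only: card_eq_sum sum.inter_filter[OF assms(2)])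
  finally show ?thesis .
qed

text \<open>Because m > D > I, a product \<open>m * k\<close> in the set is close to a non-zero
  multiple of \<open>Q\<close>; hence y = k q D / Q is at least 1/2 as soon as the set is non-empty,
  and y + 2 is at most 5 y in the count of multiples. The condition on \<open>B * B\<close> then
  makes the term 5 y harmless.\<close>

lemma card_near_interval_le:
  fixes q D B I Q k :: nat
  assumes Q: "Q = B * I" and I: "0 < I" "I < D" and B: "2 \<le> B" "B * B \<le> Q" and k: "1 \<le> k" "k \<le> B"
  shows "real (card {m. D < m \<and> m \<le> q * D \<and> near Q I (m * k)}) \<le> 15 * real q * real D / real B"
proof (cases "{m. D < m \<and> m \<le> q * D \<and> near Q I (m * k)} = {}")
  case True
  show ?thesis unfolding True by simp
next
  case False
  then obtain m where m: "D < m" "m \<le> q * D" "near Q I (m * k)" by auto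
  have Qpos: "real Q > 0" using Q B I by simp
  have IQ: "2 * I \<le> Q" unfolding Q using B by simp
  have ILQ: "I < Q" using IQ I by simp
  have half: "Q \<le> 2 * (k * (q * D))"
  proof -
    obtain e i where ei: "\<bar>e\<bar> \<le> int I" "int (m * k) = e + int Q * int i" using near_witness[OF m(3) ILQ] .
    have "i \<noteq> 0"
    proof
      assume "i = 0"
      then have "int (m * k) \<le> int I" using ei by simp
      then have "m * k \<le> I" by linarith
      moreover have "m \<le> m * k" using k by simp
      ultimately show False using m I by linarith
    qed
    then have "Q \<le> Q * i" by simp
    then have "int Q \<le> int Q * int i" by (simp only: of_nat_mult[symmetric] of_nat_le_iff)
    then have "int Q \<le> int (m * k) + int I" using ei by linarith
    then have "Q \<le> m * k + I" by linarith
    then have "Q \<le> 2 * (m * k)" using IQ by linarith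
    also have "m * k \<le> k * (q * D)" using m(2) by (simp add: mult.commute mult_le_mono2)
    finally show ?thesis by simp
  qed
  define y where "y = real k * (real q * real D) / real Q"
  have y: "1 \<le> 2 * y" using half Qpos unfolding y_def
    by (simp add: field_simps) (metis of_nat_le_iff of_nat_mult of_nat_numeral mult.assoc mult.commute)
  have "card {m. D < m \<and> m \<le> q * D \<and> near Q I (m * k)} \<le> card {m. m \<le> q * D \<and> near Q I (k * m)}"
    by (intro card_mono) (auto simp: mult.commute)
  also have "\<dots> \<le> (k * (q * D) div Q + 2) * (2 * I div k + 1)"
    by (rule card_near_multiples_le) (use k ILQ in auto)
  finally have "real (card {m. D < m \<and> m \<le> q * D \<and> near Q I (m * k)}) \<le> real ((k * (q * D) div Q + 2) * (2 * I div k + 1))"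
    by (simp only: of_nat_le_iff)
  also have "\<dots> = (real (k * (q * D) div Q) + 2) * (real (2 * I div k) + 1)" by (simp add: algebra_simps)
  also have "\<dots> \<le> (y + 2) * (2 * real I / real k + 1)"
    using of_nat_div_le_of_nat[of "k * (q * D)" Q, where ?'a = real] of_nat_div_le_of_nat[of "2 * I" k, where ?'a = real]
    by (intro mult_mono add_mono) (auto simp: y_def)
  also have "\<dots> \<le> (5 * y) * (2 * real I / real k + 1)" using y by (intro mult_right_mono) auto
  also have "\<dots> = 10 * (real q * real D) / real B + 5 * y"
    using k B I Q Qpos by (simp add: y_def field_simps)
  also have "y \<le> real q * real D / real B"
  proof -
    have "real B * real B \<le> real Q" using B(2) by (metis of_nat_le_iff of_nat_mult)
    moreover have "real k * real B \<le> real B * real B" using k by (intro mult_right_mono) auto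
    ultimately have "real k * real B \<le> real Q" by linarith
    then have "(real k * real B) * (real q * real D) \<le> real Q * (real q * real D)" by (intro mult_right_mono) auto
    then show ?thesis using Qpos B by (simp add: y_def field_simps)
  qed
  finally show ?thesis by (simp add: field_simps)
qed

context level_params
begin

lemma rpow_le: "a \<le> b \<Longrightarrow> real q ^ a \<le> real q ^ b"
  using q by (intro power_increasing) auto

lemma rq: "real q \<ge> 2" "real q > 0" using q by simp_all

lemma rN: "real N = real q ^ (15 * \<rho>)" by (simp add: N_def)

lemma small_le_N: "real q ^ a * real q ^ J \<le> real N" if "a + J \<le> 15 * \<rho>"
  unfolding rN power_add[symmetric] by (rule rpow_le[OF that])

lemma two_E_le: "i \<le> s \<Longrightarrow> 2 * E i \<le> q ^ (lev i - J)"
proof -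
  assume "i \<le> s"
  then have "lev i - J = Suc (lev i - J - 1)" using lev_ge_rho[of i] J by simp
  then have "q ^ (lev i - J) = q * E i" unfolding E_def by simp
  then show ?thesis using q by simp
qed

lemma two_E_less: "i \<le> s \<Longrightarrow> 2 * E i < q ^ lev i"
proof -
  assume i: "i \<le> s"
  have "2 * E i \<le> q ^ (lev i - J)" by (rule two_E_le[OF i])
  also have "\<dots> < q ^ lev i" using q J lev_ge_rho[OF i] by (intro power_strict_increasing) auto
  finally show ?thesis .
qed

lemma two_E_real: "i \<le> s \<Longrightarrow> 2 * real (E i) * real q ^ J \<le> real q ^ lev i"
proof -
  assume i: "i \<le> s"
  have "2 * E i * q ^ J \<le> q ^ (lev i - J) * q ^ J" by (intro mult_le_mono1 two_E_le i)
  also have "\<dots> = q ^ lev i" unfolding power_add[symmetric] using J lev_ge_rho[OF i] by simp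
  finally have "real (2 * E i * q ^ J) \<le> real (q ^ lev i)" by (simp only: of_nat_le_iff)
  then show ?thesis by simp
qed

lemma D_real: "real q ^ d \<le> real D" "real D \<le> real q ^ (d + 1)"
  using D by (metis of_nat_le_iff of_nat_power less_imp_le)+

text \<open>The top level exceeds \<open>m\<close> by a factor of about
  \<open>q ^ (2 * \<rho>)\<close>. So \<open>m * j\<close> goes round about
  \<open>N / q ^ (2 * \<rho>)\<close> times, spending about \<open>q ^ (2 * \<rho> - J)\<close>
  indices near the boundary each time; this works for every single \<open>m\<close>.\<close>

lemma M_0_le:
  assumes m: "D < m" "m \<le> q * D"
  shows "real (M 0 m) \<le> 14 * real q * (real N / real q ^ J)"
proof -
  define X where "X = real q ^ J"
  define A where "A = real q ^ (2 * \<rho>)"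
  define Q where "Q = q ^ lev 0"
  have pos: "X > 0" "A > 0" using rq by (simp_all add: X_def A_def)
  have "card {j. 1 \<le> j \<and> j < N \<and> near Q (2 * E 0) (m * j)} \<le> card {j. j \<le> N \<and> near Q (2 * E 0) (m * j)}"
    by (intro card_mono) auto
  also have "\<dots> \<le> (m * N div Q + 2) * (2 * (2 * E 0) div m + 1)"
    unfolding Q_def by (rule card_near_multiples_le) (use m two_E_less in auto)
  finally have "M 0 m \<le> 1 + (m * N div Q + 2) * (2 * (2 * E 0) div m + 1)" by (simp add: M_def Q_def)
  then have "real (M 0 m) \<le> real (1 + (m * N div Q + 2) * (2 * (2 * E 0) div m + 1))" by (simp only: of_nat_le_iff)
  also have "\<dots> = 1 + (real (m * N div Q) + 2) * (real (2 * (2 * E 0) div m) + 1)" by (simp add: algebra_simps)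
  also have "\<dots> \<le> 1 + (real N / A + 2) * (4 * real q * A / X + 1)"
  proof (intro add_mono mult_mono order.refl)
    have mm: "real m \<le> real q ^ (d + 2)"
    proof -
      have "real m \<le> real q * real D" using m(2) by (metis of_nat_le_iff of_nat_mult)
      also have "\<dots> \<le> real q * real q ^ (d + 1)" using D_real rq by (intro mult_left_mono) auto
      finally show ?thesis by simp
    qed
    have "real (m * N div Q) \<le> real (m * N) / real Q" by (rule of_nat_div_le_of_nat)
    also have "\<dots> \<le> real q ^ (d + 2) * real N / real Q" using mm by (intro divide_right_mono) (auto intro: mult_right_mono)
    also have "\<dots> = real N / A"
      using rq by (simp add: Q_def lev_0 A_def power_add field_simps)
    finally show "real (m * N div Q) \<le> real N / A" .
    have "real (2 * (2 * E 0) div m) \<le> real (2 * (2 * E 0)) / real m" by (rule of_nat_div_le_of_nat)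
    also have "\<dots> \<le> real (2 * (2 * E 0)) / real q ^ d" using m D_real rq by (intro divide_left_mono) auto
    also have "\<dots> = 4 * real q * A / X"
    proof -
      have "real (E 0) * (X * real q) = real q ^ (d + 2 * \<rho> + 2)"
        unfolding E_def lev_0 X_def using J by (simp only: of_nat_power power_add[symmetric] power_Suc2[symmetric]) simp
      also have "\<dots> = real q ^ d * A * real q * real q" by (simp add: A_def power_add power2_eq_square)
      finally have "real (E 0) * X = real q ^ d * A * real q" using rq by simp
      then show ?thesis using pos rq by (simp add: field_simps)
    qed
    finally show "real (2 * (2 * E 0) div m) \<le> 4 * real q * A / X" .
  qed (use pos rq in auto)
  also have "\<dots> = 3 + 4 * real q * (real N / X) + real N / A + 8 * real q * (A / X)"
    using pos by (simp add: field_simps)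
  also have "\<dots> \<le> 3 * (real N / X) + 4 * real q * (real N / X) + real N / X + 8 * real q * (real N / X)"
  proof (intro add_mono mult_left_mono divide_left_mono divide_right_mono order.refl)
    show "3 \<le> 3 * (real N / X)" using small_le_N[of 0] J pos by (simp add: X_def field_simps)
    show "X \<le> A" unfolding X_def A_def using J by (intro rpow_le) simp
    show "A \<le> real N" unfolding A_def rN by (intro rpow_le) simp
  qed (use pos rq in auto)
  also have "\<dots> \<le> 14 * real q * (real N / X)"
  proof -
    define t where "t = real N / X"
    have "4 * t \<le> (2 * real q) * t" using rq pos unfolding t_def by (intro mult_right_mono) auto
    then show ?thesis unfolding t_def[symmetric] by (simp add: algebra_simps)
  qed
  finally show ?thesis by (simp add: X_def)
qed

text \<open>At these two levels \<open>N\<close> consists of full periods. The gcd of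
  \<open>m\<close> with the period adds only \<open>q ^ J\<close>, which is small because
  \<open>2 * J < \<rho>\<close>.\<close>

lemma M_low_le:
  assumes i: "i = s - 1 \<or> i = s" and m: "m > 0" and ne: "\<And>p. prime p \<Longrightarrow> p dvd q \<Longrightarrow> \<not> p ^ J dvd m"
  shows "real (M i m) \<le> 7 * (real N / real q ^ J)"
proof -
  define X where "X = real q ^ J"
  define Q where "Q = q ^ lev i"
  have lev: "\<rho> \<le> lev i" "lev i \<le> 15 * \<rho>" using i lev_last lev_pred by auto
  have Q: "Q > 0" using q by (simp add: Q_def)
  have pos: "X > 0" using rq by (simp add: X_def)
  have QN: "N div Q = q ^ (15 * \<rho> - lev i)" "real (N div Q) = real N / real Q" "real N / real Q \<ge> 1"
  proof -
    have NQ: "N = q ^ (15 * \<rho> - lev i) * Q" unfolding N_def Q_def power_add[symmetric] using lev by simp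
    show 1: "N div Q = q ^ (15 * \<rho> - lev i)" unfolding NQ using Q by simp
    show "real (N div Q) = real N / real Q" using NQ Q 1 by simp
    show "real N / real Q \<ge> 1" using Q q by (simp add: NQ)
  qed
  have "card {j. 1 \<le> j \<and> j < N \<and> near Q (2 * E i) (m * j)} \<le> card {j. j < N \<and> near Q (2 * E i) (m * j)}"
    by (intro card_mono) auto
  also have "\<dots> \<le> (N div Q + 1) * (2 * (2 * E i) + gcd m Q)" by (rule card_near_le[OF Q])
  also have "\<dots> \<le> (N div Q + 1) * (2 * (2 * E i) + q ^ J)"
    unfolding Q_def using gcd_le[OF m] ne by (intro mult_le_mono2 add_mono) auto
  finally have "M i m \<le> 1 + (N div Q + 1) * (2 * (2 * E i) + q ^ J)" by (simp add: M_def Q_def)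
  then have "real (M i m) \<le> real (1 + (N div Q + 1) * (2 * (2 * E i) + q ^ J))" by (simp only: of_nat_le_iff)
  also have "\<dots> = 1 + (real N / real Q + 1) * (2 * (2 * real (E i)) + X)"
    by (simp only: of_nat_add of_nat_mult of_nat_1 of_nat_numeral of_nat_power QN(2) X_def)
  also have "\<dots> \<le> 1 + (2 * (real N / real Q)) * (2 * (real Q / X) + real Q / X)"
  proof (intro add_mono mult_mono order.refl)
    show "real N / real Q + 1 \<le> 2 * (real N / real Q)" using QN by simp
    show "2 * real (E i) \<le> real Q / X"
      using two_E_real[of i] i pos by (auto simp: X_def Q_def field_simps)
    have "X * X \<le> real Q" unfolding X_def Q_def of_nat_power power_add[symmetric]
      using J lev by (intro rpow_le) simp
    then show "X \<le> real Q / X" using pos by (simp add: field_simps)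
  qed (use pos in auto)
  also have "\<dots> = 1 + 6 * (real N / X)" using Q pos by (simp add: field_simps)
  also have "\<dots> \<le> 7 * (real N / X)"
    using small_le_N[of 0] J pos by (simp add: X_def field_simps)
  finally show ?thesis by (simp add: X_def)
qed

text \<open>At these levels \<open>q ^ lev i\<close> exceeds \<open>N\<close>, and a bound for a single \<open>m\<close> is not available: exchanging
  the roles of \<open>j\<close> and \<open>m\<close> exploits the average over \<open>m\<close>.\<close>

lemma sum_M_mid_le:
  assumes i: "1 \<le> i" "i \<le> s - 2"
  shows "(\<Sum>m\<in>{D<..q * D}. real (M i m)) \<le> 7 * real q * (real D * real N / real q ^ J)"
proof -
  define X where "X = real q ^ J"
  define Q where "Q = q ^ lev i"
  define I where "I = 2 * E i"
  have is': "i \<le> s" using i by simp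
  have Q: "Q > 0" "real Q > 0" using q by (simp_all add: Q_def)
  have pos: "X > 0" using rq by (simp add: X_def)
  have IX: "real I * X \<le> real Q" using two_E_real[OF is'] by (simp add: I_def X_def Q_def)
  have QD: "real Q \<le> real D"
    unfolding Q_def of_nat_power using rpow_le[OF lev_le_d[OF i]] D_real by linarith
  have XD: "X \<le> real D" unfolding X_def using rpow_le[of J d] J d D_real by linarith
  have one: "real (card {m \<in> {D<..q * D}. near Q I (m * j)}) \<le> (2 * real q + real q + 6) * (real D / X)"
    if j: "j \<in> {1..<N}" for j
  proof -
    have "card {m \<in> {D<..q * D}. near Q I (m * j)} \<le> card {m. m \<le> q * D \<and> near Q I (j * m)}"
      by (intro card_mono) (auto simp: mult.commute)
    also have "\<dots> \<le> (j * (q * D) div Q + 2) * (2 * I div j + 1)"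
      by (rule card_near_multiples_le) (use j two_E_less[OF is'] in \<open>auto simp: I_def Q_def\<close>)
    finally have "real (card {m \<in> {D<..q * D}. near Q I (m * j)}) \<le> real ((j * (q * D) div Q + 2) * (2 * I div j + 1))"
      by (simp only: of_nat_le_iff)
    also have "\<dots> = (real (j * (q * D) div Q) + 2) * (real (2 * I div j) + 1)" by (simp add: algebra_simps)
    also have "\<dots> \<le> (real (j * (q * D)) / real Q + 2) * (real (2 * I) / real j + 1)"
      by (intro mult_mono add_mono of_nat_div_le_of_nat) auto
    also have "\<dots> = 2 * real q * (real D * (real I / real Q)) + real q * (real D * (real j / real Q)) + 4 * (real I / real j) + 2"
      using j Q by (simp add: field_simps)
    also have "\<dots> \<le> 2 * real q * (real D * (1 / X)) + real q * (real D * (1 / X)) + 4 * (real D / X) + 2 * (real D / X)"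
    proof (intro add_mono mult_left_mono)
      show "real I / real Q \<le> 1 / X" using IX Q pos by (simp add: field_simps)
      have "real N * X \<le> real Q"
        unfolding rN X_def Q_def of_nat_power power_add[symmetric] using lev_ge[OF i(2)] J by (intro rpow_le) simp
      moreover have "real j * X \<le> real N * X" using j pos by (intro mult_right_mono) auto
      ultimately have "real j * X \<le> real Q" by linarith
      then show "real j / real Q \<le> 1 / X" using Q pos by (simp add: field_simps)
      have "real I / real j \<le> real I / 1" using j by (intro divide_left_mono) auto
      also have "\<dots> \<le> real D / X" using IX QD pos by (simp add: field_simps)
      finally show "real I / real j \<le> real D / X" .
      show "2 \<le> 2 * (real D / X)" using XD pos by (simp add: field_simps)
    qed (use rq in auto)
    also have "\<dots> = (2 * real q + real q + 6) * (real D / X)" by (simp add: algebra_simps)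
    finally show ?thesis .
  qed
  have set_eq: "{j. 1 \<le> j \<and> j < N \<and> near Q I (m * j)} = {j \<in> {1..<N}. near Q I (m * j)}" for m by auto
  have "(\<Sum>m\<in>{D<..q * D}. real (M i m)) = real (card {D<..q * D}) + real (\<Sum>m\<in>{D<..q * D}. card {j \<in> {1..<N}. near Q I (m * j)})"
    unfolding M_def I_def[symmetric] Q_def[symmetric] set_eq by (simp add: sum.distrib)
  also have "(\<Sum>m\<in>{D<..q * D}. card {j \<in> {1..<N}. near Q I (m * j)}) = (\<Sum>j\<in>{1..<N}. card {m \<in> {D<..q * D}. near Q I (m * j)})"
    by (rule sum_card_swap) auto
  also have "real \<dots> \<le> (\<Sum>j\<in>{1..<N}. (2 * real q + real q + 6) * (real D / X))"
    unfolding of_nat_sum by (intro sum_mono one)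
  also have "\<dots> \<le> real N * ((2 * real q + real q + 6) * (real D / X))"
  proof -
    have "(\<Sum>j\<in>{1..<N}. (2 * real q + real q + 6) * (real D / X)) = real (N - 1) * ((2 * real q + real q + 6) * (real D / X))"
      by (simp only: sum_constant card_atLeastLessThan)
    also have "\<dots> \<le> real N * ((2 * real q + real q + 6) * (real D / X))"
      using pos rq by (intro mult_right_mono) auto
    finally show ?thesis .
  qed
  also have "real (card {D<..q * D}) \<le> real q * (real D * real N / X)"
  proof -
    have "X \<le> real N" using small_le_N[of 0] J by (simp add: X_def)
    then have "1 \<le> real N / X" using pos by (simp add: field_simps)
    then have "real (q * D) * 1 \<le> real (q * D) * (real N / X)" by (intro mult_left_mono) auto
    moreover have "card {D<..q * D} \<le> q * D" by simp
    then have "real (card {D<..q * D}) \<le> real (q * D)" by (simp only: of_nat_le_iff)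
    ultimately show ?thesis by simp
  qed
  also have "real q * (real D * real N / X) + real N * ((2 * real q + real q + 6) * (real D / X)) =
      (4 * real q + 6) * (real D * real N / X)"
  proof -
    define t where "t = real D * real N / X"
    have "real N * ((2 * real q + real q + 6) * (real D / X)) = (2 * real q + real q + 6) * t"
      by (simp add: t_def mult_ac)
    then show ?thesis unfolding t_def[symmetric] by (simp add: algebra_simps)
  qed
  also have "\<dots> \<le> 7 * real q * (real D * real N / X)" using rq pos by (intro mult_right_mono) auto
  finally show ?thesis by (simp add: X_def)
qed

lemma sum_M_le:
  "(\<Sum>m | m \<in> {D<..q * D} \<and> \<not> exceptional m. \<Sum>i\<le>s. real (M i m)) \<le>
     14 * real q ^ 2 * (real s + 1) * (real D * real N / real q ^ J)"
proof -
  define Y where "Y = real D * real N / real q ^ J"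
  define U where "U = {m \<in> {D<..q * D}. \<not> exceptional m}"
  have Y0: "Y \<ge> 0" by (simp add: Y_def)
  have cU: "real (card U) \<le> real q * real D"
  proof -
    have "card U \<le> card {D<..q * D}" unfolding U_def by (intro card_mono) auto
    also have "\<dots> \<le> q * D" by simp
    finally show ?thesis by (metis of_nat_le_iff of_nat_mult)
  qed
  have one: "(\<Sum>m\<in>U. real (M i m)) \<le> 14 * real q ^ 2 * Y" if i: "i \<le> s" for i
  proof -
    have qq: "real q * 1 \<le> real q * real q" using rq by (intro mult_left_mono) auto
    consider "i = 0" | "1 \<le> i" "i \<le> s - 2" | "i = s - 1 \<or> i = s" using i by linarith
    then show ?thesis
    proof cases
      case 1
      have "(\<Sum>m\<in>U. real (M i m)) \<le> (\<Sum>m\<in>U. 14 * real q * (real N / real q ^ J))"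
        unfolding 1 by (intro sum_mono M_0_le) (auto simp: U_def)
      also have "\<dots> = real (card U) * (14 * real q * (real N / real q ^ J))" by simp
      also have "\<dots> \<le> (real q * real D) * (14 * real q * (real N / real q ^ J))"
        using cU rq by (intro mult_right_mono) auto
      finally show ?thesis by (simp add: Y_def power2_eq_square algebra_simps)
    next
      case 2
      have "(\<Sum>m\<in>U. real (M i m)) \<le> (\<Sum>m\<in>{D<..q * D}. real (M i m))"
        by (intro sum_mono2) (auto simp: U_def)
      also have "\<dots> \<le> 7 * real q * Y" unfolding Y_def by (rule sum_M_mid_le[OF 2])
      also have "\<dots> \<le> 14 * real q ^ 2 * Y" using qq rq Y0 by (intro mult_right_mono) (auto simp: power2_eq_square)
      finally show ?thesis .
    next
      case 3
      have "(\<Sum>m\<in>U. real (M i m)) \<le> (\<Sum>m\<in>U. 7 * (real N / real q ^ J))"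
      proof (intro sum_mono M_low_le[OF 3])
        fix m assume "m \<in> U"
        then show "0 < m" "\<And>p. prime p \<Longrightarrow> p dvd q \<Longrightarrow> \<not> p ^ J dvd m" by (auto simp: U_def exceptional_def)
      qed
      also have "\<dots> = real (card U) * (7 * (real N / real q ^ J))" by simp
      also have "\<dots> \<le> (real q * real D) * (7 * (real N / real q ^ J))"
        using cU rq by (intro mult_right_mono) auto
      also have "\<dots> = 7 * real q * Y" by (simp add: Y_def)
      also have "\<dots> \<le> 14 * real q ^ 2 * Y" using qq rq Y0 by (intro mult_right_mono) (auto simp: power2_eq_square)
      finally show ?thesis .
    qed
  qed
  have "(\<Sum>m\<in>U. \<Sum>i\<le>s. real (M i m)) = (\<Sum>i\<le>s. \<Sum>m\<in>U. real (M i m))" by (rule sum.swap)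
  also have "\<dots> \<le> (\<Sum>i\<le>s. 14 * real q ^ 2 * Y)" by (intro sum_mono one) auto
  also have "\<dots> = 14 * real q ^ 2 * (real s + 1) * Y" by (simp add: algebra_simps)
  finally show ?thesis by (simp add: U_def Y_def)
qed

text \<open>At most \<open>B / 2 ^ J\<close> multipliers are divisible by \<open>p ^ J\<close>, and
  each is near for a number of moduli of order q D / B; the multiplier bound \<open>B\<close>
  cancels. There are at most \<open>q\<close> primes and \<open>s - 1\<close> levels.\<close>

lemma card_exceptional_le:
  "real (card {m \<in> {D<..q * D}. exceptional m}) \<le> 15 * real q ^ 2 * real s * (real D / 2 ^ J)"
proof -
  define B where "B = q ^ (8 * \<rho>)"
  define Ps where "Ps = {p. prime p \<and> p dvd q}"
  define A where "A p = {m. 1 \<le> m \<and> m \<le> q * D \<and> p ^ J dvd m}" for p :: nat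
  define Ks where "Ks p = {k. 1 \<le> k \<and> k \<le> B \<and> p ^ J dvd k}" for p :: nat
  define C where "C i k = {m. D < m \<and> m \<le> q * D \<and> near (q ^ lev i) (q ^ (lev i - 8 * \<rho>)) (m * k)}" for i k
  have Bpos: "real B > 0" using q by (simp add: B_def)
  have Psub: "Ps \<subseteq> {1..q}" using q by (auto simp: Ps_def dvd_imp_le Suc_le_eq prime_gt_0_nat)
  then have finPs: "finite Ps" by (rule finite_subset) simp
  have cPs: "card Ps \<le> q" using card_mono[OF _ Psub] by simp
  have finA: "finite (A p)" and finK: "finite (Ks p)" and finC: "finite (C i k)" for p i k
    by (simp_all add: A_def Ks_def C_def)
  have mult: "real (n div p ^ J) \<le> real n / 2 ^ J" if "p \<in> Ps" for n p
  proof -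
    have "(2::real) ^ J \<le> real p ^ J" using that by (intro power_mono) (auto simp: Ps_def prime_ge_2_nat)
    moreover have "real p > 0" using that by (simp add: Ps_def prime_gt_0_nat)
    ultimately have "real n / real (p ^ J) \<le> real n / 2 ^ J" by (intro divide_left_mono) auto
    then show ?thesis using of_nat_div_le_of_nat[of n "p ^ J", where ?'a = real] by linarith
  qed
  have cA: "real (card (A p)) \<le> real q * real D / 2 ^ J" if p: "p \<in> Ps" for p
  proof -
    have "p ^ J > 0" using p by (simp add: Ps_def prime_gt_0_nat)
    then have "card (A p) \<le> q * D div p ^ J" unfolding A_def by (rule card_multiples_le)
    then have "real (card (A p)) \<le> real (q * D div p ^ J)" by simp
    also have "\<dots> \<le> real (q * D) / 2 ^ J" by (rule mult[OF p])
    finally show ?thesis by simp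
  qed
  have cK: "real (card (Ks p)) \<le> real B / 2 ^ J" if p: "p \<in> Ps" for p
  proof -
    have "p ^ J > 0" using p by (simp add: Ps_def prime_gt_0_nat)
    then have "card (Ks p) \<le> B div p ^ J" unfolding Ks_def by (rule card_multiples_le)
    then have "real (card (Ks p)) \<le> real (B div p ^ J)" by simp
    also have "\<dots> \<le> real B / 2 ^ J" by (rule mult[OF p])
    finally show ?thesis .
  qed
  have cC: "real (card (C i k)) \<le> 15 * real q * real D / real B" if i: "i < s - 1" and k: "1 \<le> k" "k \<le> B" for i k
    unfolding C_def
  proof (rule card_near_interval_le[OF _ _ _ _ _ k])
    have l: "16 * \<rho> \<le> lev i" using i by (intro lev_ge) auto
    then show eq: "q ^ lev i = B * q ^ (lev i - 8 * \<rho>)" by (simp add: B_def power_add[symmetric])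
    show "0 < q ^ (lev i - 8 * \<rho>)" using q by simp
    show "2 \<le> B"
    proof -
      have "q ^ 1 \<le> B" unfolding B_def using rho3 by (intro power_le) simp
      then show ?thesis using q by simp
    qed
    show "B * B \<le> q ^ lev i" unfolding B_def power_add[symmetric] using l by (intro power_le) simp
    have "lev i - 8 * \<rho> < d"
    proof (cases "i = 0")
      case True
      then show ?thesis using lev_0 rho3 d by simp
    next
      case False
      then have "lev i \<le> d" using i by (intro lev_le_d) auto
      then show ?thesis using rho3 d by simp
    qed
    then have "q ^ (lev i - 8 * \<rho>) < q ^ d" using q by (intro power_strict_increasing) auto
    then show "q ^ (lev i - 8 * \<rho>) < D" using D by simp
  qed
  have "{m \<in> {D<..q * D}. exceptional m} \<subseteq> (\<Union>p\<in>Ps. A p \<union> (\<Union>i\<in>{..<s - 1}. \<Union>k\<in>Ks p. C i k))"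
    unfolding exceptional_def Ps_def A_def Ks_def C_def B_def by auto
  then have "card {m \<in> {D<..q * D}. exceptional m} \<le> card (\<Union>p\<in>Ps. A p \<union> (\<Union>i\<in>{..<s - 1}. \<Union>k\<in>Ks p. C i k))"
    by (intro card_mono) (use finPs finA finK finC in auto)
  also have "\<dots> \<le> (\<Sum>p\<in>Ps. card (A p) + (\<Sum>i\<in>{..<s - 1}. \<Sum>k\<in>Ks p. card (C i k)))"
  proof (rule order.trans[OF card_UN_le[OF finPs] sum_mono])
    fix p
    have "card (\<Union>i\<in>{..<s - 1}. \<Union>k\<in>Ks p. C i k) \<le> (\<Sum>i\<in>{..<s - 1}. \<Sum>k\<in>Ks p. card (C i k))"
      by (rule order.trans[OF card_UN_le sum_mono]) (auto intro: card_UN_le finK)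
    then show "card (A p \<union> (\<Union>i\<in>{..<s - 1}. \<Union>k\<in>Ks p. C i k)) \<le> card (A p) + (\<Sum>i\<in>{..<s - 1}. \<Sum>k\<in>Ks p. card (C i k))"
      by (intro order.trans[OF card_Un_le]) simp
  qed
  finally have "real (card {m \<in> {D<..q * D}. exceptional m}) \<le>
     (\<Sum>p\<in>Ps. real (card (A p)) + (\<Sum>i\<in>{..<s - 1}. \<Sum>k\<in>Ks p. real (card (C i k))))"
    unfolding of_nat_sum[symmetric] of_nat_add[symmetric] of_nat_le_iff .
  also have "\<dots> \<le> (\<Sum>p\<in>Ps. 15 * real q * real s * (real D / 2 ^ J))"
  proof (rule sum_mono)
    fix p assume p: "p \<in> Ps"
    have "(\<Sum>i\<in>{..<s - 1}. \<Sum>k\<in>Ks p. real (card (C i k))) \<le> (\<Sum>i\<in>{..<s - 1}. \<Sum>k\<in>Ks p. 15 * real q * real D / real B)"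
      by (intro sum_mono cC) (auto simp: Ks_def)
    also have "\<dots> = real (s - 1) * (real (card (Ks p)) * (15 * real q * real D / real B))" by simp
    also have "\<dots> \<le> real (s - 1) * (real B / 2 ^ J * (15 * real q * real D / real B))"
      using cK[OF p] by (intro mult_left_mono mult_right_mono) auto
    also have "\<dots> = real (s - 1) * (15 * real q * (real D / 2 ^ J))" using Bpos by simp
    finally have "real (card (A p)) + (\<Sum>i\<in>{..<s - 1}. \<Sum>k\<in>Ks p. real (card (C i k))) \<le>
       real q * real D / 2 ^ J + real (s - 1) * (15 * real q * (real D / 2 ^ J))" using cA[OF p] by linarith
    also have "\<dots> \<le> 15 * real q * (real D / 2 ^ J) + real (s - 1) * (15 * real q * (real D / 2 ^ J))"
      by (simp add: field_simps)
    also have "\<dots> = 15 * real q * real s * (real D / 2 ^ J)"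
    proof -
      have "real (s - 1) = real s - 1" using s by simp
      moreover define t where "t = real D / 2 ^ J"
      ultimately show ?thesis unfolding t_def[symmetric] by (simp add: algebra_simps)
    qed
    finally show "real (card (A p)) + (\<Sum>i\<in>{..<s - 1}. \<Sum>k\<in>Ks p. real (card (C i k))) \<le> 15 * real q * real s * (real D / 2 ^ J)" .
  qed
  also have "\<dots> = real (card Ps) * (15 * real q * real s * (real D / 2 ^ J))" by simp
  also have "\<dots> \<le> real q * (15 * real q * real s * (real D / 2 ^ J))" using cPs by (intro mult_right_mono) auto
  finally show ?thesis by (simp add: power2_eq_square algebra_simps)
qed

end

section \<open>From exponential sums to counting\<close>

text \<open>Takes the place of Hoelder's inequality: \<open>y\<close> is bounded linearly in its
  high power, so an average of that power over the moduli can be used directly.\<close>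

lemma le_add_scaled_power:
  fixes y \<theta> :: real
  assumes "y \<ge> 0" "\<theta> > 0" "n \<ge> 1"
  shows "y \<le> \<theta> + \<theta> * (y ^ n / \<theta> ^ n)"
proof (cases "y \<le> \<theta>")
  case True
  moreover have "0 \<le> \<theta> * (y ^ n / \<theta> ^ n)" using assms by simp
  ultimately show ?thesis by linarith
next
  case False
  then have "1 \<le> y / \<theta>" using assms by simp
  then have "y / \<theta> \<le> (y / \<theta>) ^ n" using assms by (intro self_le_power) auto
  then have "\<theta> * (y / \<theta>) \<le> \<theta> * (y ^ n / \<theta> ^ n)" using assms by (intro mult_left_mono) (auto simp: power_divide)
  then show ?thesis using assms by simp
qed

text \<open>The summands belong to the exceptional moduli, the threshold \<open>\<theta>\<close>,
  the contraction together with the shift errors, and the indices close to a carry.\<close>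

definition average_const :: "nat \<Rightarrow> nat \<Rightarrow> real \<Rightarrow> real" where
  "average_const q s A = 15 * real q ^ 2 * real s + real q + vdc_const (s + 1) * (A + 2) * real q +
     vdc_const (s + 1) * 2 ^ (s + 2) * 14 * real q ^ 2 * (real s + 1)"

context level_params
begin

text \<open>\<open>Y\<close> depends on the modulus alone, not on the character, the offset or the
  length. This order of choices is what lets the maxima stand inside the sum over moduli.\<close>

lemma exponential_sums_on_average:
  assumes A: "A \<ge> 0"
    and decay: "real q ^ ((2 * s + 2) * J + 1) * (1 - \<delta> / real (q ^ L0) ^ (s + 2)) ^ ((\<rho> - J) div L0) \<le> A / 2 ^ J"
    and L0: "L0 = a + c + 2" and a: "s + 1 < q ^ a" and c: "s + 1 \<le> q ^ c"
  obtains Y :: "nat \<Rightarrow> real" where "\<And>m. Y m \<ge> 0"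
    and "\<And>m z r K. D < m \<Longrightarrow> m \<le> q * D \<Longrightarrow> norm (z::complex) = 1 \<Longrightarrow> norm (1 + z ^ (q - 1)) \<le> 2 - \<delta> \<Longrightarrow> K \<le> N \<Longrightarrow>
       norm (\<Sum>k<K. z ^ digit_sum q (r + m * k)) / N \<le> Y m"
    and "(\<Sum>m\<in>{D<..q * D}. Y m) \<le> average_const q s A * (real D * 2 powr (- (real J / 2 ^ (s + 1))))"
proof -
  \<comment> \<open>The threshold with \<open>\<theta> ^ (2 ^ (s + 1)) = 1 / 2 ^ J\<close>, matching
    the average size of the bound for the high power.\<close>
  define \<theta> where "\<theta> = 2 powr (- (real J / 2 ^ (s + 1)))"
  define V where "V = vdc_const (s + 1)"
  define R where "R m = V * (A / 2 ^ J + 2 / 2 ^ J + 2 ^ (s + 2) * (\<Sum>i\<le>s. real (M i m)) / N)" for m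
  define Y where "Y m = (if exceptional m then 1 else \<theta> + \<theta> * (2 ^ J * R m))" for m
  have \<theta>pos: "\<theta> > 0" by (simp add: \<theta>_def)
  have \<theta>n: "\<theta> ^ (2 ^ (s + 1)) = 1 / 2 ^ J"
  proof -
    have "\<theta> ^ (2 ^ (s + 1)) = \<theta> powr real (2 ^ (s + 1))" by (rule powr_realpow[OF \<theta>pos, symmetric])
    also have "\<dots> = 2 powr (- real J)" by (simp add: \<theta>_def powr_powr)
    finally show ?thesis by (simp add: powr_minus powr_realpow field_simps)
  qed
  have \<theta>ge: "1 / 2 ^ J \<le> \<theta>"
  proof -
    have "(1::real) \<le> 2 ^ (s + 1)" by (rule one_le_power) simp
    then have "real J / 2 ^ (s + 1) \<le> real J / 1" by (intro divide_left_mono) auto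
    then have "2 powr (- real J) \<le> \<theta>" unfolding \<theta>_def by (intro powr_mono) auto
    then show ?thesis by (simp add: powr_minus powr_realpow field_simps)
  qed
  have V: "V \<ge> 1" unfolding V_def by (rule vdc_const_ge_1)
  have Npos: "real N > 0" using rq by (simp add: rN)
  have R0: "R m \<ge> 0" for m unfolding R_def using V A
    by (intro mult_nonneg_nonneg add_nonneg_nonneg divide_nonneg_nonneg sum_nonneg) auto
  have "Y m \<ge> 0" for m using R0 \<theta>pos by (auto simp: Y_def)
  moreover have "norm (\<Sum>k<K. z ^ digit_sum q (r + m * k)) / N \<le> Y m"
    if m: "D < m" "m \<le> q * D" and z: "norm z = 1" "norm (1 + z ^ (q - 1)) \<le> 2 - \<delta>" and K: "K \<le> N" for m r K and z :: complex
  proof (cases "exceptional m")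
    case True
    have "norm (\<Sum>k<K. z ^ digit_sum q (r + m * k)) / N \<le> 1"
      using K Npos z by (intro norm_average_le_1) (auto simp: norm_power)
    then show ?thesis using True by (simp add: Y_def)
  next
    case False
    define y where "y = norm (\<Sum>k<K. z ^ digit_sum q (r + m * k)) / N"
    have y0: "y \<ge> 0" by (simp add: y_def)
    have "y ^ (2 ^ (s + 1)) \<le> V * (real q ^ ((2 * s + 2) * J + 1) * (1 - \<delta> / real (q ^ L0) ^ (s + 2)) ^ ((\<rho> - J) div L0)
       + (real q ^ (11 * \<rho>) + real q ^ \<rho> + 2 ^ (s + 2) * (\<Sum>i\<le>s. real (M i m))) / N)"
      unfolding y_def V_def by (rule unexceptional_sum_bound[OF m False z L0 a c K])
    also have "\<dots> \<le> V * (A / 2 ^ J + (2 / 2 ^ J + 2 ^ (s + 2) * (\<Sum>i\<le>s. real (M i m)) / N))"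
    proof (intro mult_left_mono add_mono decay)
      have "(real q ^ (11 * \<rho>) + real q ^ \<rho>) / N \<le> 2 / 2 ^ J"
      proof -
        have "real q ^ (11 * \<rho>) * real q ^ J \<le> real N" "real q ^ \<rho> * real q ^ J \<le> real N"
          using J by (auto intro!: small_le_N)
        then have "(real q ^ (11 * \<rho>) + real q ^ \<rho>) * real q ^ J \<le> 2 * real N" by (simp add: algebra_simps)
        moreover have "(2::real) ^ J \<le> real q ^ J" using rq by (intro power_mono) auto
        then have "(real q ^ (11 * \<rho>) + real q ^ \<rho>) * 2 ^ J \<le> (real q ^ (11 * \<rho>) + real q ^ \<rho>) * real q ^ J"
          by (intro mult_left_mono) auto
        ultimately have "(real q ^ (11 * \<rho>) + real q ^ \<rho>) * 2 ^ J \<le> 2 * real N" by linarith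
        then show ?thesis using Npos by (simp add: field_simps)
      qed
      then show "(real q ^ (11 * \<rho>) + real q ^ \<rho> + 2 ^ (s + 2) * (\<Sum>i\<le>s. real (M i m))) / N \<le>
         2 / 2 ^ J + 2 ^ (s + 2) * (\<Sum>i\<le>s. real (M i m)) / N" by (simp add: add_divide_distrib)
    qed (use V in auto)
    also have "\<dots> = R m" by (simp add: R_def add.assoc)
    finally have yR: "y ^ (2 ^ (s + 1)) \<le> R m" .
    have "y \<le> \<theta> + \<theta> * (y ^ (2 ^ (s + 1)) / \<theta> ^ (2 ^ (s + 1)))"
      by (rule le_add_scaled_power[OF y0 \<theta>pos]) simp
    also have "\<dots> = \<theta> + \<theta> * (2 ^ J * y ^ (2 ^ (s + 1)))" unfolding \<theta>n by simp
    also have "\<dots> \<le> \<theta> + \<theta> * (2 ^ J * R m)" using yR \<theta>pos by (intro add_mono mult_left_mono) auto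
    finally show ?thesis using False by (simp add: Y_def y_def)
  qed
  moreover have "(\<Sum>m\<in>{D<..q * D}. Y m) \<le> average_const q s A * (real D * \<theta>)"
  proof -
    define Ex where "Ex = {m \<in> {D<..q * D}. exceptional m}"
    define U where "U = {m \<in> {D<..q * D}. \<not> exceptional m}"
    have "(\<Sum>m\<in>{D<..q * D}. Y m) = (\<Sum>m\<in>Ex. Y m) + (\<Sum>m\<in>U. Y m)"
    proof -
      have "{D<..q * D} = Ex \<union> U" "Ex \<inter> U = {}" by (auto simp: Ex_def U_def)
      moreover have "finite Ex" "finite U" by (auto simp: Ex_def U_def)
      ultimately show ?thesis by (simp add: sum.union_disjoint)
    qed
    also have "(\<Sum>m\<in>Ex. Y m) = real (card Ex)" by (simp add: Ex_def Y_def)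
    also have "\<dots> \<le> 15 * real q ^ 2 * real s * (real D / 2 ^ J)" unfolding Ex_def by (rule card_exceptional_le)
    also have "\<dots> \<le> 15 * real q ^ 2 * real s * (real D * \<theta>)"
      using \<theta>ge by (intro mult_left_mono) (auto simp: divide_inverse intro!: mult_left_mono)
    also have "(\<Sum>m\<in>U. Y m) = (\<Sum>m\<in>U. \<theta> + \<theta> * (V * (A + 2)) + (\<theta> * V * 2 ^ (s + 2) * 2 ^ J / N) * (\<Sum>i\<le>s. real (M i m)))"
    proof (intro sum.cong refl)
      fix m assume "m \<in> U"
      then show "Y m = \<theta> + \<theta> * (V * (A + 2)) + (\<theta> * V * 2 ^ (s + 2) * 2 ^ J / N) * (\<Sum>i\<le>s. real (M i m))"
        using Npos by (simp add: U_def Y_def R_def field_simps)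
    qed
    also have "\<dots> = real (card U) * (\<theta> + \<theta> * (V * (A + 2))) + (\<theta> * V * 2 ^ (s + 2) * 2 ^ J / N) * (\<Sum>m\<in>U. \<Sum>i\<le>s. real (M i m))"
      by (simp add: sum.distrib sum_distrib_left)
    also have "\<dots> \<le> (real q * real D) * (\<theta> + \<theta> * (V * (A + 2))) +
       (\<theta> * V * 2 ^ (s + 2) * 2 ^ J / N) * (14 * real q ^ 2 * (real s + 1) * (real D * real N / real q ^ J))"
    proof (intro add_mono mult_right_mono mult_left_mono)
      have "card U \<le> card {D<..q * D}" unfolding U_def by (intro card_mono) auto
      also have "\<dots> \<le> q * D" by simp
      finally show "real (card U) \<le> real q * real D" by (metis of_nat_le_iff of_nat_mult)
      show "(\<Sum>m\<in>U. \<Sum>i\<le>s. real (M i m)) \<le> 14 * real q ^ 2 * (real s + 1) * (real D * real N / real q ^ J)"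
        using sum_M_le by (simp add: U_def)
    qed (use \<theta>pos V A in auto)
    also have "(\<theta> * V * 2 ^ (s + 2) * 2 ^ J / N) * (14 * real q ^ 2 * (real s + 1) * (real D * real N / real q ^ J)) =
       (V * 2 ^ (s + 2) * 14 * real q ^ 2 * (real s + 1) * (real D * \<theta>)) * (2 ^ J / real q ^ J)"
      using Npos rq by (simp add: field_simps)
    also have "\<dots> \<le> (V * 2 ^ (s + 2) * 14 * real q ^ 2 * (real s + 1) * (real D * \<theta>)) * 1"
    proof (intro mult_left_mono)
      have "(2::real) ^ J \<le> real q ^ J" using rq by (intro power_mono) auto
      then show "2 ^ J / real q ^ J \<le> 1" using rq by simp
    qed (use \<theta>pos V in auto)
    finally have "(\<Sum>m\<in>{D<..q * D}. Y m) \<le> 15 * real q ^ 2 * real s * (real D * \<theta>) +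
      ((real q * real D) * (\<theta> + \<theta> * (V * (A + 2))) + (V * 2 ^ (s + 2) * 14 * real q ^ 2 * (real s + 1) * (real D * \<theta>)) * 1)"
      by (simp add: add_left_mono)
    also have "\<dots> = average_const q s A * (real D * \<theta>)"
      unfolding average_const_def V_def[symmetric] by (simp add: algebra_simps)
    finally show ?thesis .
  qed
  ultimately show ?thesis unfolding \<theta>_def by (rule that) auto
qed

end

section \<open>Residue classes in intervals and detection of digit sums by roots of unity\<close>

lemma progression_in_interval:
  fixes y z :: real and r m :: int
  assumes m: "m > 0" and y: "0 \<le> y" "y < z"
  obtains r0 K :: nat where "{n :: nat. y \<le> real n \<and> real n < z \<and> [int n = r] (mod m)} = (\<lambda>k. r0 + nat m * k) ` {..<K}"
    and "\<bar>real K - (z - y) / m\<bar> \<le> 1"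
proof -
  define A where "A = {n :: nat. y \<le> real n \<and> [int n = r] (mod m)}"
  define n0 where "n0 = nat (r mod m) + nat m * nat \<lceil>y\<rceil>"
  have mm: "int (nat m) = m" "nat m \<ge> 1" using m by auto
  have "n0 \<in> A"
  proof -
    have "int n0 = r mod m + m * int (nat \<lceil>y\<rceil>)" using m by (simp add: n0_def)
    then have "[int n0 = r] (mod m)" by (simp add: cong_def)
    moreover have "y \<le> real n0"
    proof -
      have "1 * nat \<lceil>y\<rceil> \<le> nat m * nat \<lceil>y\<rceil>" using mm by (intro mult_le_mono1) simp
      then have "nat \<lceil>y\<rceil> \<le> n0" unfolding n0_def by linarith
      then have "real (nat \<lceil>y\<rceil>) \<le> real n0" by (simp only: of_nat_le_iff)
      moreover have "y \<le> real (nat \<lceil>y\<rceil>)" using y by linarith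
      ultimately show ?thesis by linarith
    qed
    ultimately show ?thesis by (simp add: A_def)
  qed
  define r0 where "r0 = (LEAST n. n \<in> A)"
  have r0A: "r0 \<in> A" unfolding r0_def using \<open>n0 \<in> A\<close> by (rule LeastI)
  have r0le: "r0 \<le> n" if "n \<in> A" for n unfolding r0_def using that by (rule Least_le)
  have r0lt: "real r0 < y + m"
  proof (rule ccontr)
    assume "\<not> real r0 < y + m"
    then have "y \<le> real r0 - m" by simp
    then have ge: "nat m \<le> r0" using y mm by linarith
    have "r0 - nat m \<in> A"
    proof -
      have "[int (r0 - nat m) = r] (mod m)"
        using r0A ge mm by (simp add: A_def of_nat_diff cong_def)
      moreover have "y \<le> real (r0 - nat m)" using \<open>y \<le> real r0 - m\<close> ge mm by (simp add: of_nat_diff)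
      ultimately show ?thesis by (simp add: A_def)
    qed
    then show False using r0le[of "r0 - nat m"] ge mm by linarith
  qed
  have Aeq: "A = range (\<lambda>k. r0 + nat m * k)"
  proof (intro equalityI subsetI)
    fix n assume n: "n \<in> A"
    then have le: "r0 \<le> n" by (rule r0le)
    have "[int n = int r0] (mod m)" using n r0A by (auto simp: A_def intro: cong_trans cong_sym)
    then have "m dvd int n - int r0" by (simp add: cong_iff_dvd_diff)
    then have "int (nat m) dvd int (n - r0)" using le mm by (simp add: of_nat_diff)
    then have "nat m dvd n - r0" by (simp only: int_dvd_int_iff)
    then obtain k where "n - r0 = nat m * k" by blast
    then have "n = r0 + nat m * k" using le by simp
    then show "n \<in> range (\<lambda>k. r0 + nat m * k)" by blast
  next
    fix n assume "n \<in> range (\<lambda>k. r0 + nat m * k)"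
    then obtain k where n: "n = r0 + nat m * k" by blast
    have "int n = int r0 + m * int k" using mm by (simp add: n)
    then have "[int n = r] (mod m)" using r0A by (simp add: A_def cong_def)
    moreover have "y \<le> real n"
    proof -
      have "real r0 \<le> real n" unfolding n of_nat_le_iff by simp
      then show ?thesis using r0A by (simp add: A_def)
    qed
    ultimately show "n \<in> A" by (simp add: A_def)
  qed
  define K where "K = nat \<lceil>(z - r0) / m\<rceil>"
  have "{n :: nat. y \<le> real n \<and> real n < z \<and> [int n = r] (mod m)} = A \<inter> {n. real n < z}"
    by (auto simp: A_def)
  also have "\<dots> = (\<lambda>k. r0 + nat m * k) ` {..<K}"
  proof -
    have "real (r0 + nat m * k) < z \<longleftrightarrow> k < K" for k
    proof -
      have "real (r0 + nat m * k) < z \<longleftrightarrow> real k < (z - r0) / m"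
        using m by (simp add: field_simps)
      also have "\<dots> \<longleftrightarrow> int k < \<lceil>(z - r0) / m\<rceil>" by (simp add: less_ceiling_iff)
      also have "\<dots> \<longleftrightarrow> k < K" by (simp add: K_def zless_nat_eq_int_zless)
      finally show ?thesis .
    qed
    then have "{k. real (r0 + nat m * k) < z} = {..<K}" by blast
    moreover have "A \<inter> {n. real n < z} = (\<lambda>k. r0 + nat m * k) ` {k. real (r0 + nat m * k) < z}"
      unfolding Aeq by blast
    ultimately show ?thesis by simp
  qed
  finally have 1: "{n :: nat. y \<le> real n \<and> real n < z \<and> [int n = r] (mod m)} = (\<lambda>k. r0 + nat m * k) ` {..<K}" .
  have yr0: "y \<le> real r0" using r0A by (simp add: A_def)
  have mpos: "real_of_int m > 0" using m by simp
  have lo: "(z - y) / m < (z - r0) / m + 1" 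
  proof -
    have "(z - y) / m < (z - r0 + m) / m" using r0lt mpos by (intro divide_strict_right_mono) auto
    also have "\<dots> = (z - r0) / m + 1" using mpos by (simp add: add_divide_distrib)
    finally show ?thesis .
  qed
  have hi: "(z - r0) / m \<le> (z - y) / m" using yr0 mpos by (simp add: divide_right_mono)
  have zy: "0 \<le> (z - y) / m" using y mpos by simp
  have "\<bar>real K - (z - y) / m\<bar> \<le> 1"
  proof (cases "(z - r0) / m \<le> 0")
    case True
    then have "K = 0" unfolding K_def by (simp add: ceiling_le_iff)
    then show ?thesis using lo zy True by simp
  next
    case False
    then have "real K = of_int \<lceil>(z - r0) / m\<rceil>" unfolding K_def by simp
    then have "(z - r0) / m \<le> real K" "real K < (z - r0) / m + 1" by linarith+
    then show ?thesis using lo hi by linarith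
  qed
  with 1 show ?thesis by (rule that)
qed

lemma sum_roots_of_unity:
  assumes b: "b \<ge> 1" and w: "w = exp (2 * of_real pi * \<i> / of_nat b)"
  shows "(\<Sum>l<b. (w ^ l) ^ t) = (if b dvd t then of_nat b else 0)"
proof -
  have wt: "w ^ t = exp (2 * of_real pi * \<i> * of_nat t / of_nat b)"
    by (simp add: w exp_of_nat_mult[symmetric] mult_ac)
  have 1: "w ^ t = 1 \<longleftrightarrow> b dvd t" unfolding wt using complex_root_unity_eq_1[of b t] b by simp
  have eq: "(w ^ l) ^ t = (w ^ t) ^ l" for l by (simp add: power_mult[symmetric] mult.commute)
  show ?thesis
  proof (cases "b dvd t")
    case True
    then show ?thesis unfolding eq using 1 by simp
  next
    case False
    have "w ^ b = 1" unfolding w using complex_root_unity[of b 1] b by simp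
    then have "(w ^ t) ^ b = 1" by (metis power_mult mult.commute power_one)
    then show ?thesis unfolding eq using False 1 geometric_sum[of "w ^ t" b] by simp
  qed
qed

text \<open>The powers of \<open>\<zeta>\<close> sum to zero, so b is the sum of the 1 - \<zeta>^j
  and thus at most (b^2 / 2) |1 - \<zeta>|. The parallelogram law turns this distance from 1 into a
  deficit of |1 + \<zeta>|.\<close>

lemma root_of_unity_gap:
  fixes \<zeta> :: complex
  assumes "\<zeta> ^ b = 1" "\<zeta> \<noteq> 1" "b \<ge> 2"
  shows "norm (1 + \<zeta>) \<le> 2 - 1 / real b ^ 2"
proof -
  have n1: "norm \<zeta> = 1" using assms by (metis norm_one norm_power power_eq_1_iff norm_ge_zero not_numeral_le_zero)
  have "real b = norm (\<Sum>j<b. 1 - \<zeta> ^ j)"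
    using geometric_sum[OF assms(2), of b] assms(1) by (simp add: sum_subtractf)
  also have "\<dots> \<le> (\<Sum>j<b. real j * norm (1 - \<zeta>))"
  proof (rule sum_norm_le)
    fix j
    show "norm (1 - \<zeta> ^ j) \<le> real j * norm (1 - \<zeta>)"
    proof (induction j)
      case (Suc j)
      have "1 - \<zeta> ^ Suc j = (1 - \<zeta>) + \<zeta> * (1 - \<zeta> ^ j)" by (simp add: algebra_simps)
      also have "norm \<dots> \<le> norm (1 - \<zeta>) + norm \<zeta> * norm (1 - \<zeta> ^ j)"
        by (metis norm_mult norm_triangle_ineq)
      also have "\<dots> \<le> norm (1 - \<zeta>) + real j * norm (1 - \<zeta>)" using Suc n1 by simp
      finally show ?case by (simp add: algebra_simps)
    qed simp
  qed
  also have "\<dots> \<le> (\<Sum>j<b. (real b / 2) * norm (1 - \<zeta>))"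
  proof -
    have "(\<Sum>j<b. real j) = real b * (real b - 1) / 2" by (induction b) (auto simp: field_simps)
    then have "(\<Sum>j<b. real j) \<le> real b * (real b / 2)" by (simp add: field_simps)
    then have "(\<Sum>j<b. real j) * norm (1 - \<zeta>) \<le> real b * (real b / 2) * norm (1 - \<zeta>)" by (intro mult_right_mono) auto
    then show ?thesis unfolding sum_distrib_right by simp
  qed
  also have "\<dots> = real b * ((real b / 2) * norm (1 - \<zeta>))" by simp
  finally have "1 \<le> (real b / 2) * norm (1 - \<zeta>)" using assms(3) by simp
  then have g: "2 / real b \<le> norm (1 - \<zeta>)" using assms(3) by (simp add: field_simps)
  have "(norm (1 + \<zeta>))\<^sup>2 + (norm (1 - \<zeta>))\<^sup>2 = 4"
  proof -
    have "(Re \<zeta>)\<^sup>2 + (Im \<zeta>)\<^sup>2 = 1" using n1 cmod_power2[of \<zeta>] by simp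
    then show ?thesis unfolding cmod_power2 by (simp add: power2_eq_square algebra_simps)
  qed
  moreover have "(2 / real b)\<^sup>2 \<le> (norm (1 - \<zeta>))\<^sup>2" using g by (intro power_mono) auto
  ultimately have "(norm (1 + \<zeta>))\<^sup>2 \<le> 4 - 4 / real b ^ 2" by (simp add: power_divide)
  also have "\<dots> \<le> (2 - 1 / real b ^ 2)\<^sup>2" by (simp add: power2_eq_square algebra_simps)
  finally show ?thesis
  proof (rule power2_le_imp_le)
    have "1 / real b ^ 2 \<le> 1" using assms(3) by (simp add: field_simps)
    then show "0 \<le> 2 - 1 / real b ^ 2" by linarith
  qed
qed

lemma count_residue_error_le:
  fixes g :: "'a \<Rightarrow> nat"
  assumes b: "b \<ge> 1" and w: "w = exp (2 * of_real pi * \<i> / of_nat b)" and fin: "finite S"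
    and B: "\<And>l. 1 \<le> l \<Longrightarrow> l < b \<Longrightarrow> norm (\<Sum>k\<in>S. (w ^ l) ^ g k) \<le> B" and B0: "B \<ge> 0"
  shows "\<bar>real (card {k \<in> S. [int (g k) = a] (mod int b)}) - real (card S) / real b\<bar> \<le> B"
proof -
  define a' where "a' = nat (a mod int b)"
  have a': "a' < b" "int a' = a mod int b" using b by (auto simp: a'_def nat_less_iff)
  \<comment> \<open>Stands for \<open>g k - a'\<close>; adding a full \<open>b\<close> keeps the
    exponent a natural number.\<close>
  define t where "t k = g k + (b - a')" for k
  have dvd: "[int (g k) = a] (mod int b) \<longleftrightarrow> b dvd t k" for k
  proof -
    have "int (t k) = (int (g k) - int a') + int b" using a' by (simp add: t_def of_nat_diff)
    then have "b dvd t k \<longleftrightarrow> int b dvd int (g k) - int a'" 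
      by (metis dvd_add_triv_right_iff int_dvd_int_iff)
    also have "\<dots> \<longleftrightarrow> [int (g k) = int a'] (mod int b)" by (simp add: cong_iff_dvd_diff)
    also have "\<dots> \<longleftrightarrow> [int (g k) = a] (mod int b)" unfolding a' by (simp add: cong_def)
    finally show ?thesis by simp
  qed
  have nw: "norm w = 1" unfolding w using norm_exp_i_times[of "2 * pi / real b"] by (simp add: mult_ac)
  define c where "c = card {k \<in> S. [int (g k) = a] (mod int b)}"
  have "of_nat b * of_nat c = (\<Sum>k\<in>S. if b dvd t k then of_nat b else (0::complex))"
  proof -
    have "(\<Sum>k\<in>S. if b dvd t k then of_nat b else (0::complex)) = (\<Sum>k\<in>{k\<in>S. b dvd t k}. of_nat b)"
      by (rule sum.inter_filter[OF fin, symmetric])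
    then show ?thesis by (simp add: c_def dvd)
  qed
  also have "\<dots> = (\<Sum>k\<in>S. \<Sum>l<b. (w ^ l) ^ t k)" by (simp only: sum_roots_of_unity[OF b w])
  also have "\<dots> = (\<Sum>l<b. \<Sum>k\<in>S. (w ^ l) ^ t k)" by (rule sum.swap)
  also have "{..<b} = insert 0 {1..<b}" using b by auto
  also have "(\<Sum>l\<in>insert 0 {1..<b}. \<Sum>k\<in>S. (w ^ l) ^ t k) = of_nat (card S) + (\<Sum>l\<in>{1..<b}. \<Sum>k\<in>S. (w ^ l) ^ t k)"
    by simp
  finally have "of_nat b * of_nat c - of_nat (card S) = (\<Sum>l\<in>{1..<b}. \<Sum>k\<in>S. (w ^ l) ^ t k)" by simp
  then have "norm (of_nat b * of_nat c - of_nat (card S) :: complex) \<le> (\<Sum>l\<in>{1..<b}. B)"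
  proof (simp only:, intro sum_norm_le)
    fix l assume l: "l \<in> {1..<b}"
    have "(\<Sum>k\<in>S. (w ^ l) ^ t k) = (w ^ l) ^ (b - a') * (\<Sum>k\<in>S. (w ^ l) ^ g k)"
      by (simp add: t_def power_add sum_distrib_left mult.commute)
    then show "norm (\<Sum>k\<in>S. (w ^ l) ^ t k) \<le> B" using B[of l] l nw by (simp add: norm_mult norm_power)
  qed
  also have "\<dots> \<le> real b * B" using B0 by (simp add: mult_right_mono)
  finally have "norm (of_nat b * of_nat c - of_nat (card S) :: complex) \<le> real b * B" .
  moreover have "(of_nat b * of_nat c - of_nat (card S) :: complex) = of_real (real b * real c - real (card S))" by simp
  ultimately have "\<bar>real b * real c - real (card S)\<bar> \<le> real b * B" by (simp only: norm_of_real)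
  moreover have "real b * real c - real (card S) = real b * (real c - real (card S) / real b)" using b by (simp add: algebra_simps)
  ultimately have "real b * \<bar>real c - real (card S) / real b\<bar> \<le> real b * B" using b by (simp add: abs_mult)
  then show ?thesis using b by (simp add: c_def)
qed

lemma norm_sum_blocks_le:
  fixes f :: "nat \<Rightarrow> complex"
  assumes "\<And>r K'. K' \<le> N \<Longrightarrow> norm (\<Sum>k<K'. f (r + m * k)) \<le> real N * Y" and N: "N > 0" and Y: "Y \<ge> 0"
  shows "norm (\<Sum>k<K. f (r + m * k)) \<le> (real K + real N) * Y"
proof -
  have "(\<Sum>k<K. f (r + m * k)) = (\<Sum>k<N * (K div N) + K mod N. f (r + m * k))" by simp
  also have "\<dots> = (\<Sum>c<N. \<Sum>j<K div N. f (r + m * (c + N * j))) + (\<Sum>k<K mod N. f (r + m * (N * (K div N) + k)))"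
    unfolding sum_lessThan_add sum_lessThan_mult ..
  also have "(\<Sum>c<N. \<Sum>j<K div N. f (r + m * (c + N * j))) = (\<Sum>j<K div N. \<Sum>c<N. f ((r + m * (N * j)) + m * c))"
    by (subst sum.swap) (simp add: algebra_simps)
  also have "(\<Sum>k<K mod N. f (r + m * (N * (K div N) + k))) = (\<Sum>k<K mod N. f ((r + m * (N * (K div N))) + m * k))"
    by (simp add: algebra_simps)
  also have "norm ((\<Sum>j<K div N. \<Sum>c<N. f ((r + m * (N * j)) + m * c)) + \<dots>) \<le> (\<Sum>j<K div N. real N * Y) + real N * Y"
    by (intro norm_triangle_le add_mono sum_norm_le assms(1)) (use N in \<open>auto simp: less_imp_le\<close>)
  also have "\<dots> = (real (N * (K div N)) + real N) * Y" by (simp add: algebra_simps)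
  also have "\<dots> \<le> (real K + real N) * Y"
  proof (intro mult_right_mono add_mono order.refl Y)
    show "real (N * (K div N)) \<le> real K" unfolding of_nat_le_iff by simp
  qed
  finally show ?thesis .
qed

text \<open>The progression has at most \<open>(z - y) / m + 1\<close> terms, an incomplete block
  counts as a full one and adds \<open>N\<close>, and the final 1 pays for rounding the main
  term.\<close>

lemma AP_error_le_exponential_sums:
  fixes m :: int
  assumes q: "q \<ge> 2" and b: "b \<ge> 2" and w: "w = exp (2 * of_real pi * \<i> / of_nat b)" and m: "m > 0"
    and y: "0 \<le> y" "y < z"
    and bound: "\<And>l r K. 1 \<le> l \<Longrightarrow> l < b \<Longrightarrow> K \<le> N \<Longrightarrow> norm (\<Sum>k<K. (w ^ l) ^ digit_sum q (r + nat m * k)) \<le> real N * Y"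
    and N: "N > 0" and Y: "Y \<ge> 0"
  shows "AP_error q b a m y z r \<le> ((z - y) / m + 1 + real N) * Y + 1"
proof -
  obtain r0 K where K: "{n :: nat. y \<le> real n \<and> real n < z \<and> [int n = r] (mod m)} = (\<lambda>k. r0 + nat m * k) ` {..<K}"
    "\<bar>real K - (z - y) / m\<bar> \<le> 1" by (rule progression_in_interval[OF m y])
  have inj: "inj_on (\<lambda>k. r0 + nat m * k) X" for X using m by (auto simp: inj_on_def)
  have "count_AP q y z a b r m = card {k \<in> {..<K}. [int (digit_sum q (r0 + nat m * k)) = a] (mod int b)}"
  proof -
    have "{n :: nat. y \<le> real n \<and> real n < z \<and> [int (digit_sum q n) = a] (mod int b) \<and> [int n = r] (mod m)} =
      {n. y \<le> real n \<and> real n < z \<and> [int n = r] (mod m)} \<inter> {n. [int (digit_sum q n) = a] (mod int b)}" by auto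
    also have "\<dots> = (\<lambda>k. r0 + nat m * k) ` {k \<in> {..<K}. [int (digit_sum q (r0 + nat m * k)) = a] (mod int b)}"
      unfolding K(1) by auto
    finally show ?thesis unfolding count_AP_def using card_image[OF inj] by simp
  qed
  moreover have "\<bar>real (card {k \<in> {..<K}. [int (digit_sum q (r0 + nat m * k)) = a] (mod int b)}) - real (card {..<K}) / real b\<bar>
     \<le> (real K + real N) * Y"
    by (rule count_residue_error_le[OF _ w]) (use b N Y bound in \<open>auto intro!: norm_sum_blocks_le\<close>)
  ultimately have 1: "\<bar>real (count_AP q y z a b r m) - real K / real b\<bar> \<le> (real K + real N) * Y" by simp
  have "\<bar>real K / real b - (z - y) / (real b * m)\<bar> = \<bar>real K - (z - y) / m\<bar> / real b"
  proof -
    have "real K / real b - (z - y) / (real b * m) = (real K - (z - y) / m) / real b"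
      using b m by (simp add: field_simps)
    then show ?thesis by (simp add: abs_divide)
  qed
  also have "\<dots> \<le> 1 / real b" using K(2) by (intro divide_right_mono) auto
  also have "\<dots> \<le> 1" using b by simp
  finally have "AP_error q b a m y z r \<le> (real K + real N) * Y + 1"
    unfolding AP_error_def using 1 by linarith
  also have "(real K + real N) * Y \<le> ((z - y) / m + 1 + real N) * Y"
    using K(2) Y by (intro mult_right_mono) linarith+
  finally show ?thesis by simp
qed

section \<open>The admissible exponent\<close>

lemma power_between:
  assumes "(q::nat) \<ge> 2" "n \<ge> 1"
  obtains a where "n < q ^ a" "q ^ a \<le> q * n"
proof -
  define a where "a = (LEAST a. n < q ^ a)"
  have ex: "\<exists>a. n < q ^ a" using power_gt_expt[of q n] assms by auto
  have a: "n < q ^ a" unfolding a_def using ex by (rule LeastI_ex)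
  then obtain a' where a': "a = Suc a'" using assms by (cases a) auto
  have "\<not> n < q ^ a'" using not_less_Least[of a' "\<lambda>a. n < q ^ a"] a' unfolding a_def[symmetric] by simp
  then have "q ^ a \<le> q * n" by (simp add: a')
  with a show ?thesis by (rule that)
qed

text \<open>With \<open>P = q ^ L0\<close>, the left-hand side contains the reciprocal of the
  relative gain per digit: b^2 from the gap of the roots of unity, \<open>P ^ (s + 2)\<close> terms
  in a block, and ln P for its \<open>L0\<close> digits. The right-hand side is the reciprocal of
  the exponential factor of the admissible exponent.\<close>

lemma saving_dominates:
  fixes u P :: real and b q s :: nat
  assumes u: "u \<ge> 1" and b: "b \<ge> 2" and q: "q \<ge> 2" and s: "real s \<le> 3 * u + 1"
    and P: "P \<ge> 1" "P \<le> real q ^ 4 * (real s + 1) ^ 2"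
  shows "real b ^ 2 * ln P * P ^ (s + 2) \<le> exp (5 * u * (ln (4 * real q * u) + 5 * real b * u * ln (real q)))"
proof -
  define lq where "lq = ln (real q)"
  have lq: "lq \<ge> ln 2" unfolding lq_def using q by simp
  have l2: "ln 2 \<ge> (2/3 :: real)" by (rule ln2_ge_two_thirds)
  have "real s + 1 \<le> 5 * u" using s u by linarith
  then have "(real s + 1) ^ 2 \<le> (5 * u) ^ 2" by (intro power_mono) auto
  then have P5: "P \<le> real q ^ 4 * (5 * u) ^ 2" using P(2) by (smt (verit) mult_left_mono zero_le_power of_nat_0_le_iff)
  have lnP: "ln P \<le> 4 * lq + 2 * (ln 5 + ln u)"
  proof -
    have "ln P \<le> ln (real q ^ 4 * (5 * u) ^ 2)" using P5 P by (intro ln_mono) linarith+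
    also have "\<dots> = 4 * lq + 2 * (ln 5 + ln u)"
    proof -
      have "ln ((5 * u) ^ 2) = 2 * ln (5 * u)" using ln_realpow[of "5 * u" 2] u by (simp only: of_nat_numeral)
      moreover have "ln (5 * u) = ln 5 + ln u" using u by (simp add: ln_mult)
      moreover have "ln (real q ^ 4) = 4 * lq" using q by (simp add: lq_def ln_realpow)
      moreover have "ln (real q ^ 4 * (5 * u) ^ 2) = ln (real q ^ 4) + ln ((5 * u) ^ 2)"
        using q u by (intro ln_mult_pos) auto
      ultimately show ?thesis by (simp only:)
    qed
    finally show ?thesis .
  qed
  have lnP0: "ln P \<ge> 0" using P by simp
  have lnu: "0 \<le> ln u" "ln u \<le> u - 1" using u ln_le_minus_one[of u] by auto
  have ln5: "3 * ln 5 \<le> 7 * ln (2::real)"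
  proof -
    have "ln ((5::real) ^ 3) \<le> ln (2 ^ 7)" by simp
    then show ?thesis by (simp only: ln_realpow)
  qed
  have b2: "real b ^ 2 \<le> exp (2 * real b * lq)"
  proof -
    have "real b \<le> 2 ^ b" using of_nat_less_two_power[of b, where ?'a = real] by simp
    also have "\<dots> = exp (real b * ln 2)" by (simp add: exp_of_nat_mult)
    also have "\<dots> \<le> exp (real b * lq)" using lq by (simp add: mult_left_mono)
    finally have "real b ^ 2 \<le> exp (real b * lq) ^ 2" by (intro power_mono) auto
    then show ?thesis by (simp add: exp_of_nat_mult[symmetric] mult.assoc)
  qed
  have Pp: "ln P * P ^ (s + 2) \<le> exp (7 * u * (4 * lq + 2 * (ln 5 + ln u)))"
  proof -
    have "ln P \<le> P" using P ln_le_minus_one[of P] by simp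
    then have "ln P * P ^ (s + 2) \<le> P * P ^ (s + 2)" using P by (intro mult_right_mono) auto
    also have "\<dots> = P ^ (s + 3)" by (simp add: numeral_eq_Suc)
    also have "\<dots> = exp (ln P) ^ (s + 3)" using P by simp
    also have "\<dots> = exp (real (s + 3) * ln P)" by (simp only: exp_of_nat_mult)
    also have "\<dots> \<le> exp (7 * u * (4 * lq + 2 * (ln 5 + ln u)))"
      unfolding exp_le_cancel_iff by (intro mult_mono lnP lnP0) (use s u in auto)
    finally show ?thesis .
  qed
  have "real b ^ 2 * ln P * P ^ (s + 2) = real b ^ 2 * (ln P * P ^ (s + 2))" by simp
  also have "\<dots> \<le> exp (2 * real b * lq) * exp (7 * u * (4 * lq + 2 * (ln 5 + ln u)))"
    using P lnP0 by (intro mult_mono b2 Pp) auto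
  also have "\<dots> = exp (2 * real b * lq + 7 * u * (4 * lq + 2 * (ln 5 + ln u)))" by (simp add: exp_add)
  also have "\<dots> \<le> exp (5 * u * (ln (4 * real q * u) + 5 * real b * u * lq))"
  proof -
    have "ln (4 * real q * u) = 2 * ln 2 + lq + ln u"
    proof -
      have "ln (4::real) = 2 * ln 2" using ln_realpow[of "2::real" 2] by simp
      then show ?thesis using q u by (simp add: ln_mult lq_def)
    qed
    moreover have "2 * real b * lq + 7 * u * (4 * lq + 2 * (ln 5 + ln u)) \<le> 5 * u * (2 * ln 2 + lq + ln u + 5 * real b * u * lq)"
    proof -
      have lq0: "lq > 0" using lq l2 by linarith
      \<comment> \<open>The right-hand side offers 25 copies of b u^2 ln q. Two of them pay for b^2;
        the other 23 give 46 u^2 ln q, because b is at least 2, and pay for the excess of the powers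
        of \<open>P\<close>.\<close>
      have 1: "2 * real b * lq \<le> 2 * real b * (u * u) * lq"
      proof -
        have "1 * 1 \<le> u * u" using u by (intro mult_mono) auto
        then have "real b * lq * 1 \<le> real b * lq * (u * u)" using lq0 by (intro mult_left_mono) auto
        then show ?thesis by (simp add: mult_ac)
      qed
      have 2: "46 * (u * u) * lq \<le> 23 * real b * (u * u) * lq"
      proof -
        have "46 * (u * u * lq) \<le> (23 * real b) * (u * u * lq)" using b lq0 u by (intro mult_right_mono) auto
        then show ?thesis by (simp add: mult_ac)
      qed
      have 3: "14 * ln 5 + 9 * ln u + 23 * lq \<le> 10 * ln 2 + 46 * u * lq"
      proof -
        have A: "9 * (u - 1) \<le> 46 * (u - 1) * lq"
        proof -
          have "(u - 1) * 9 \<le> (u - 1) * (46 * lq)" using u lq l2 by (intro mult_left_mono) linarith+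
          then show ?thesis by (simp add: mult_ac)
        qed
        have B: "46 * u * lq = 46 * (u - 1) * lq + 46 * lq" by (simp add: algebra_simps)
        have "14 * a + 9 * l + 23 * k \<le> 10 * t + M"
          if "9 * v \<le> N" "M = N + 46 * k" "l \<le> v" "3 * a \<le> 7 * t" "t \<le> k" "0 \<le> t" for a l k t M N v :: real
          using that by linarith
        from this[OF A B lnu(2) ln5 lq] show ?thesis using l2 by simp
      qed
      have 4: "u * (14 * ln 5 + 9 * ln u + 23 * lq) \<le> u * (10 * ln 2 + 46 * u * lq)"
        using 3 u by (intro mult_left_mono) auto
      have "2 * real b * lq + 7 * u * (4 * lq + 2 * (ln 5 + ln u)) =
         2 * real b * lq + u * (14 * ln 5 + 9 * ln u + 23 * lq) + 5 * u * (lq + ln u)" by (simp add: algebra_simps)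
      also have "\<dots> \<le> 2 * real b * (u * u) * lq + u * (10 * ln 2 + 46 * u * lq) + 5 * u * (lq + ln u)"
        using 1 4 by linarith
      also have "\<dots> = 2 * real b * (u * u) * lq + 46 * (u * u) * lq + 5 * u * (2 * ln 2 + lq + ln u)" by (simp add: algebra_simps)
      also have "\<dots> \<le> 2 * real b * (u * u) * lq + 23 * real b * (u * u) * lq + 5 * u * (2 * ln 2 + lq + ln u)"
        using 2 by linarith
      also have "\<dots> = 5 * u * (2 * ln 2 + lq + ln u + 5 * real b * u * lq)" by (simp add: algebra_simps)
      finally show ?thesis .
    qed
    ultimately show ?thesis by simp
  qed
  finally show ?thesis by (simp add: lq_def)
qed

lemma eta_admissible_eq:
  fixes \<delta>\<^sub>1 \<delta>\<^sub>2 u :: real and b q :: nat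
  assumes "\<delta>\<^sub>2 < 1" and u: "u = 1 / (1 - \<delta>\<^sub>2)"
  defines "Lg \<equiv> ln (4 * real q * u) + 5 * real b * u * ln (real q)"
  shows "eta_admissible \<delta>\<^sub>1 \<delta>\<^sub>2 b q =
    \<delta>\<^sub>1 * min (1/4) (3 * log (real q) (real (least_prime_divisor q))) / (1800 * u\<^sup>2 * 8 powr u * Lg * exp (5 * u * Lg))"
proof -
  have e: "1 - \<delta>\<^sub>2 = 1 / u" using assms by simp
  have upos: "u > 0" using assms by simp
  have e1: "1 / (1 / u) = u" "4 * real q / (1 / u) = 4 * real q * u"
    "5 * real b * ln (real q) / (1 / u) = 5 * real b * u * ln (real q)" "- (5 / (1 / u)) = - (5 * u)" by simp_all
  have "eta_admissible \<delta>\<^sub>1 \<delta>\<^sub>2 b q = \<delta>\<^sub>1 * (1 / u)\<^sup>2 * min (1/4) (3 * log (real q) (real (least_prime_divisor q)))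
     / (1800 * 8 powr u * Lg) * exp (- (5 * u) * Lg)"
    unfolding eta_admissible_def e e1 Lg_def[symmetric] ..
  also have "exp (- (5 * u) * Lg) = 1 / exp (5 * u * Lg)" by (simp add: exp_minus field_simps)
  finally show ?thesis using upos by (simp add: power_divide field_simps)
qed

lemma least_prime_divisor_gt_1:
  assumes "q \<ge> 2"
  shows "least_prime_divisor q > 1"
proof -
  have "\<exists>p. prime p \<and> p dvd q" using assms by (intro prime_factor_nat) auto
  then have "prime (least_prime_divisor q) \<and> least_prime_divisor q dvd q"
    unfolding least_prime_divisor_def by (rule LeastI_ex)
  then show ?thesis using prime_gt_1_nat by blast
qed

text \<open>The second bound serves the errors that add up to a multiple of D; the third compares
  with the exponent that the choice of parameters yields. There
  \<open>2 ^ (s + 1) \<le> 4 * 8 powr u\<close> because s is at most 3 u + 1.\<close>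

lemma eta_bounds:
  fixes \<delta>\<^sub>1 \<delta>\<^sub>2 :: real and b q s L0 :: nat
  assumes \<delta>: "0 < \<delta>\<^sub>1" "\<delta>\<^sub>1 \<le> \<delta>\<^sub>2" "\<delta>\<^sub>2 < 1" and b: "b \<ge> 2" and q: "q \<ge> 2" and u: "u = 1 / (1 - \<delta>\<^sub>2)"
    and s: "real s \<le> 3 * u + 1" and L0: "L0 \<ge> 1" "q ^ L0 \<le> q ^ 4 * (s + 1) ^ 2"
  shows "eta_admissible \<delta>\<^sub>1 \<delta>\<^sub>2 b q > 0" "eta_admissible \<delta>\<^sub>1 \<delta>\<^sub>2 b q \<le> 1 - \<delta>\<^sub>2"
    "eta_admissible \<delta>\<^sub>1 \<delta>\<^sub>2 b q \<le> \<delta>\<^sub>1 * ln 2 / (16 * u * (ln (real q))\<^sup>2 * 2 ^ (s + 1) * real L0 * (2 * real s + 5) * real b ^ 2 * real (q ^ L0) ^ (s + 2))"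
proof -
  define lq where "lq = ln (real q)"
  define Lg where "Lg = ln (4 * real q * u) + 5 * real b * u * lq"
  define X where "X = exp (5 * u * Lg)"
  define P where "P = real (q ^ L0)"
  define mn where "mn = min (1/4) (3 * log (real q) (real (least_prime_divisor q)))"
  have u1: "u \<ge> 1" using \<delta> unfolding u by (simp add: le_divide_eq)
  have l2: "ln 2 \<ge> (2/3 :: real)" by (rule ln2_ge_two_thirds)
  have lq: "lq \<ge> ln 2" unfolding lq_def using q by simp
  have lq0: "lq > 0" using lq l2 by linarith
  have Lg: "10 * lq \<le> Lg"
  proof -
    have "1 * 1 \<le> (4 * real q) * u" using u1 q by (intro mult_mono) auto
    then have "0 \<le> ln (4 * real q * u)" by (intro ln_ge_zero) simp
    moreover have "2 * 1 \<le> real b * u" using b u1 by (intro mult_mono) auto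
    then have "5 * lq * 2 \<le> 5 * lq * (real b * u)" using lq0 by (intro mult_left_mono) auto
    ultimately show ?thesis unfolding Lg_def by (simp add: mult_ac)
  qed
  then have Lg1: "Lg \<ge> 1" using lq l2 by linarith
  have mn: "0 < mn" "mn \<le> 1 / 4"
    unfolding mn_def using least_prime_divisor_gt_1[OF q] q by auto
  have X: "X \<ge> 1" unfolding X_def using u1 Lg1 by simp
  have e8: "8 powr u \<ge> 1" using u1 by (intro ge_one_powr_ge_zero) auto
  have eta: "eta_admissible \<delta>\<^sub>1 \<delta>\<^sub>2 b q = \<delta>\<^sub>1 * mn / (1800 * u\<^sup>2 * 8 powr u * Lg * X)"
    using eta_admissible_eq[OF \<delta>(3) u] by (simp add: mn_def X_def Lg_def lq_def)
  have den: "1800 * u\<^sup>2 * 8 powr u * Lg * X > 0" using u1 Lg1 X e8 by (intro mult_pos_pos) auto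
  show "eta_admissible \<delta>\<^sub>1 \<delta>\<^sub>2 b q > 0" unfolding eta using \<delta> mn by (intro divide_pos_pos[OF _ den]) auto
  have "eta_admissible \<delta>\<^sub>1 \<delta>\<^sub>2 b q \<le> \<delta>\<^sub>1 * (1/4) / (1800 * u\<^sup>2 * 8 powr u * Lg * X)"
    unfolding eta using \<delta> mn by (intro divide_right_mono mult_left_mono less_imp_le[OF den]) auto
  also have "\<dots> = \<delta>\<^sub>1 / (7200 * u\<^sup>2 * 8 powr u * Lg * X)" by simp
  finally have eta_le: "eta_admissible \<delta>\<^sub>1 \<delta>\<^sub>2 b q \<le> \<delta>\<^sub>1 / (7200 * u\<^sup>2 * 8 powr u * Lg * X)" .
  show "eta_admissible \<delta>\<^sub>1 \<delta>\<^sub>2 b q \<le> 1 - \<delta>\<^sub>2"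
  proof -
    have "u * 1 \<le> 7200 * u\<^sup>2 * 8 powr u * Lg * X"
    proof -
      have "u \<le> 7200 * u\<^sup>2" using u1 by (simp add: power2_eq_square)
      moreover have "1 * 1 \<le> 8 powr u * (Lg * X)" using e8 mult_mono[OF Lg1 X] Lg1 by (intro mult_mono) auto
      ultimately have "u * 1 \<le> (7200 * u\<^sup>2) * (8 powr u * (Lg * X))" using u1 by (intro mult_mono) auto
      then show ?thesis by (simp add: mult_ac)
    qed
    then have "\<delta>\<^sub>1 / (7200 * u\<^sup>2 * 8 powr u * Lg * X) \<le> 1 / u" using \<delta> u1 by (intro frac_le) auto
    moreover have "1 / u = 1 - \<delta>\<^sub>2" using u \<delta> by simp
    ultimately show ?thesis using eta_le by simp
  qed
  have P1: "P \<ge> 1" unfolding P_def using q by simp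
  have PP: "P \<le> real q ^ 4 * (real s + 1) ^ 2"
  proof -
    have "P \<le> real (q ^ 4 * (s + 1) ^ 2)" unfolding P_def using L0(2) by (simp only: of_nat_le_iff)
    then show ?thesis by (simp add: add.commute)
  qed
  have lnP: "ln P = real L0 * lq" unfolding P_def lq_def using q by (simp add: ln_realpow)
  have key: "real b ^ 2 * (real L0 * lq) * P ^ (s + 2) \<le> X"
    using saving_dominates[OF u1 b q s P1 PP] unfolding X_def Lg_def lq_def[symmetric] lnP .
  define Dn where "Dn = 16 * u * lq\<^sup>2 * 2 ^ (s + 1) * real L0 * (2 * real s + 5) * real b ^ 2 * P ^ (s + 2)"
  have Dn0: "Dn > 0" unfolding Dn_def using u1 lq0 L0 b P1 by (intro mult_pos_pos zero_less_power) auto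
  have s8: "2 ^ (s + 1) \<le> 4 * 8 powr u"
  proof -
    have "(2::real) ^ (s + 1) = 2 powr (real s + 1)" by (subst powr_realpow[symmetric]) (auto simp: add.commute)
    also have "\<dots> \<le> 2 powr (2 + 3 * u)" using s by (intro powr_mono) auto
    also have "\<dots> = 2 powr 2 * (2 powr 3) powr u" by (simp only: powr_add powr_powr)
    finally show ?thesis by simp
  qed
  have "Dn = 16 * u * lq * 2 ^ (s + 1) * (2 * real s + 5) * (real b ^ 2 * (real L0 * lq) * P ^ (s + 2))"
    by (simp add: Dn_def power2_eq_square mult_ac)
  also have "\<dots> \<le> 16 * u * (Lg / 10) * (4 * 8 powr u) * (13 * u) * X"
  proof (intro mult_mono key s8)
    show "lq \<le> Lg / 10" using Lg by simp
    show "2 * real s + 5 \<le> 13 * u" using s u1 by linarith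
  qed (use u1 lq0 P1 Lg1 X in auto)
  also have "\<dots> \<le> 4800 * u\<^sup>2 * 8 powr u * Lg * X"
  proof -
    have "0 \<le> u\<^sup>2 * 8 powr u * Lg * X" using Lg1 X by (intro mult_nonneg_nonneg) auto
    then show ?thesis by (simp add: power2_eq_square mult_ac)
  qed
  also have "\<dots> = 7200 * u\<^sup>2 * 8 powr u * Lg * X * (2/3)" by simp
  also have "\<dots> \<le> 7200 * u\<^sup>2 * 8 powr u * Lg * X * ln 2"
    using l2 Lg1 X by (intro mult_left_mono mult_nonneg_nonneg) auto
  finally have "Dn / ln 2 \<le> 7200 * u\<^sup>2 * 8 powr u * Lg * X" by (simp add: divide_le_eq)
  then have "\<delta>\<^sub>1 / (7200 * u\<^sup>2 * 8 powr u * Lg * X) \<le> \<delta>\<^sub>1 / (Dn / ln 2)"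
  proof (rule divide_left_mono)
    have "7200 * u\<^sup>2 * 8 powr u * Lg * X > 0" using u1 Lg1 X e8 by (intro mult_pos_pos) auto
    moreover have "Dn / ln 2 > 0" using Dn0 by simp
    ultimately show "0 < 7200 * u\<^sup>2 * 8 powr u * Lg * X * (Dn / ln 2)" by (rule mult_pos_pos)
  qed (use \<delta> in auto)
  then show "eta_admissible \<delta>\<^sub>1 \<delta>\<^sub>2 b q \<le> \<delta>\<^sub>1 * ln 2 / (16 * u * (ln (real q))\<^sup>2 * 2 ^ (s + 1) * real L0 * (2 * real s + 5) * real b ^ 2 * real (q ^ L0) ^ (s + 2))"
    using eta_le unfolding Dn_def P_def lq_def by simp
qed

section \<open>Choice of parameters and conclusion\<close>

text \<open>The contraction is about exp (- \<gamma> \<rho> / L0), hence by the condition on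
  \<open>J\<close> at most about \<open>q ^ - ((2 * s + 5) * J)\<close>. Of the surplus of three
  factors \<open>q ^ J\<close>, one is spent on the \<open>J\<close> digits lost at the bottom; what
  remains is more than the claimed \<open>2 ^ J\<close>.\<close>

lemma decay_estimate:
  fixes q s J \<rho> L0 :: nat and \<gamma> :: real
  assumes q: "q \<ge> 2" and \<gamma>: "0 < \<gamma>" "\<gamma> \<le> 1/4" and L0: "L0 \<ge> 1" and J: "J \<le> \<rho>"
    and le: "real J * (real L0 * (2 * real s + 5) * ln (real q)) \<le> \<gamma> * real \<rho>"
  shows "real q ^ ((2 * s + 2) * J + 1) * (1 - \<gamma>) ^ ((\<rho> - J) div L0) \<le> (real q * exp 1) / 2 ^ J"
proof -
  define lq where "lq = ln (real q)"
  define k where "k = (\<rho> - J) div L0"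
  have l2: "ln 2 \<ge> (2/3 :: real)" by (rule ln2_ge_two_thirds)
  have lq: "lq \<ge> ln 2" unfolding lq_def using q by simp
  have L0p: "real L0 > 0" using L0 by simp
  have k: "real k \<ge> (real \<rho> - real J) / real L0 - 1"
  proof -
    have "\<rho> - J < L0 * (k + 1)" unfolding k_def using L0
      by (metis Suc_eq_plus1 dividend_less_times_div less_le_trans mult_Suc_right zero_less_one add.commute)
    then have "real (\<rho> - J) < real (L0 * (k + 1))" by (simp only: of_nat_less_iff)
    then have "real \<rho> - real J < real L0 * (real k + 1)" using J by (simp add: of_nat_diff algebra_simps)
    then show ?thesis using L0p by (simp add: field_simps)
  qed
  have "(1 - \<gamma>) ^ k \<le> exp (- \<gamma>) ^ k" using \<gamma> exp_ge_add_one_self[of "- \<gamma>"] by (intro power_mono) auto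
  also have "\<dots> = exp (- \<gamma> * real k)" by (simp add: exp_of_nat_mult[symmetric] mult.commute)
  finally have 1: "(1 - \<gamma>) ^ k \<le> exp (- \<gamma> * real k)" .
  have qe: "real q ^ n = exp (real n * lq)" for n using q by (simp add: lq_def exp_of_nat_mult)
  have "real q ^ ((2 * s + 2) * J + 1) * (1 - \<gamma>) ^ k \<le> exp (real ((2 * s + 2) * J + 1) * lq) * exp (- \<gamma> * real k)"
    unfolding qe by (intro mult_left_mono 1) auto
  also have "\<dots> = exp (real ((2 * s + 2) * J + 1) * lq - \<gamma> * real k)" by (simp add: exp_diff exp_minus field_simps)
  also have "\<dots> \<le> exp (lq + 1 - real J * ln 2)"
  proof -
    define t where "t = real J * lq"
    have t2: "real J * ln 2 \<le> t" unfolding t_def using lq by (intro mult_left_mono) auto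
    have t0: "t \<ge> 0" unfolding t_def using lq l2 by simp
    have "\<gamma> * real k \<ge> \<gamma> * ((real \<rho> - real J) / real L0 - 1)" using k \<gamma> by (intro mult_left_mono) auto
    moreover have "\<gamma> * ((real \<rho> - real J) / real L0 - 1) = \<gamma> * real \<rho> / real L0 - \<gamma> * real J / real L0 - \<gamma>"
      by (simp add: algebra_simps diff_divide_distrib)
    moreover have "\<gamma> * real \<rho> / real L0 \<ge> (2 * real s + 5) * t"
      using le L0p by (simp add: t_def lq_def field_simps)
    moreover have "\<gamma> * real J / real L0 \<le> t"
    proof -
      have "\<gamma> * real J / real L0 \<le> \<gamma> * real J / 1" using L0 \<gamma> by (intro divide_left_mono) auto
      also have "\<dots> \<le> lq * real J" using \<gamma> lq l2 by (simp add: mult_right_mono)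
      finally show ?thesis by (simp add: t_def mult.commute)
    qed
    moreover have "real ((2 * s + 2) * J + 1) * lq = (2 * real s + 2) * t + lq" by (simp add: t_def algebra_simps)
    moreover have "(2 * real s + 5) * t = (2 * real s + 2) * t + 3 * t" by (simp add: algebra_simps)
    ultimately have "real ((2 * s + 2) * J + 1) * lq - \<gamma> * real k \<le> lq + \<gamma> - 2 * t" by linarith
    also have "\<dots> \<le> lq + 1 - real J * ln 2" using t2 t0 \<gamma> by linarith
    finally show ?thesis by simp
  qed
  also have "\<dots> = (real q * exp 1) / 2 ^ J"
    using q by (simp add: exp_add exp_diff lq_def exp_of_nat_mult)
  finally show ?thesis by (simp add: k_def)
qed

text \<open>The bounds on \<open>J\<close> force \<rho> to be at least 9, so that rounding \<rho>
  down is affordable: 16 u (\<rho> + 1) is at most 18 u \<rho>, the amount covered by drops of 6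
  \<rho> in 3 u steps.\<close>

lemma level_params_choice:
  fixes u :: real and q d n s J \<rho> :: nat
  assumes q: "q \<ge> 2" and d: "q ^ d \<le> n" "n < q ^ (d + 1)" and u: "u > 1" and s: "3 * u \<le> real s"
    and \<rho>: "\<rho> = nat \<lfloor>real d / (16 * u)\<rfloor>" and J: "1 \<le> J" "real J \<le> real \<rho> / 9"
  shows "level_params q d \<rho> J s n" "16 * real \<rho> * u \<le> real d"
proof -
  have \<rho>r: "real \<rho> \<le> real d / (16 * u)" "real d / (16 * u) < real \<rho> + 1"
    unfolding \<rho> using u by (simp_all add: of_nat_floor)
  have \<rho>9: "real \<rho> \<ge> 9 * real J" "real \<rho> \<ge> 9" using J by auto
  show du: "16 * real \<rho> * u \<le> real d" using \<rho>r u by (simp add: field_simps)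
  have du2: "real d < 16 * u * (real \<rho> + 1)" using \<rho>r(2) u by (simp add: field_simps)
  have s3: "3 \<le> s" using s u by linarith
  show "level_params q d \<rho> J s n"
  proof
    show "2 * J + 1 \<le> \<rho>" using \<rho>9 J by linarith
    have "16 * real \<rho> * 1 \<le> 16 * real \<rho> * u" using u by (intro mult_left_mono) auto
    then have "real (16 * \<rho>) \<le> real d" using du by simp
    then show "16 * \<rho> \<le> d" by (simp only: of_nat_le_iff)
    have "real d + 2 * real \<rho> + 2 \<le> 16 * real \<rho> + 6 * real \<rho> * (real s - 2)"
    proof -
      have "6 * real \<rho> * (3 * u - 2) \<le> 6 * real \<rho> * (real s - 2)" using s by (intro mult_left_mono) auto
      moreover have "9 * u \<le> real \<rho> * u" using \<rho>9 u by (intro mult_right_mono) auto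
      moreover have "6 * real \<rho> * (3 * u - 2) = 18 * (real \<rho> * u) - 12 * real \<rho>"
        "16 * u * (real \<rho> + 1) = 16 * (real \<rho> * u) + 16 * u" by (simp_all add: algebra_simps)
      ultimately show ?thesis using du2 \<rho>9 u by linarith
    qed
    then have "real (d + 2 * \<rho> + 2) \<le> real (16 * \<rho> + 6 * \<rho> * (s - 2))" using s3 by (simp add: of_nat_diff)
    then show "d + 2 * \<rho> + 2 \<le> 16 * \<rho> + 6 * \<rho> * (s - 2)" by (simp only: of_nat_le_iff)
  qed (use q d J s3 in auto)
qed

text \<open>Rounding in \<open>d\<close>, \<open>\<rho>\<close> and \<open>J\<close> loses at most 1
  each from the exponent of 2, hence the factor 8.\<close>

lemma saving_estimate:
  fixes x u \<delta>\<^sub>1 c :: real and q d \<rho> J s n :: nat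
  assumes q: "q \<ge> 2" and x: "x \<ge> 1" and n: "x powr \<delta>\<^sub>1 \<le> real n" "n < q ^ (d + 1)" and u: "u > 1" and \<delta>\<^sub>1: "\<delta>\<^sub>1 > 0"
    and c: "0 < c" "c \<le> 1" and \<rho>: "\<rho> = nat \<lfloor>real d / (16 * u)\<rfloor>" and J: "J = nat \<lfloor>c * real \<rho>\<rfloor>"
  shows "2 powr (- (real J / 2 ^ (s + 1))) \<le> 8 * x powr (- (\<delta>\<^sub>1 * c * ln 2 / (16 * u * ln (real q) * 2 ^ (s + 1))))"
proof -
  define lq where "lq = ln (real q)"
  define W where "W = \<delta>\<^sub>1 * c * ln x / (16 * u * lq)"
  have lq: "lq > 0" unfolding lq_def using q by simp
  have lx: "\<delta>\<^sub>1 * ln x < (real d + 1) * lq"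
  proof -
    have "x powr \<delta>\<^sub>1 < real (q ^ (d + 1))" using n by (metis le_less_trans of_nat_less_iff)
    then have "ln (x powr \<delta>\<^sub>1) < ln (real (q ^ (d + 1)))" using x q by (subst ln_less_cancel_iff) auto
    also have "ln (real (q ^ (d + 1))) = (real d + 1) * lq"
      using q ln_realpow[of "real q" "d + 1"] by (simp add: lq_def add.commute)
    finally show ?thesis using x by (simp add: ln_powr)
  qed
  have d: "real d > \<delta>\<^sub>1 * ln x / lq - 1" using lx lq by (simp add: field_simps)
  have \<rho>r: "real \<rho> > real d / (16 * u) - 1" unfolding \<rho> using u by linarith
  have Jr: "real J > c * real \<rho> - 1" unfolding J by linarith
  have "W \<le> real J + 3"
  proof -
    have 1: "c * real \<rho> \<ge> c * (real d / (16 * u) - 1)" using \<rho>r c by (intro mult_left_mono) auto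
    have 2: "c * (real d / (16 * u)) \<ge> c * ((\<delta>\<^sub>1 * ln x / lq - 1) / (16 * u))"
      using d c u by (intro mult_left_mono divide_right_mono) auto
    have 3: "c * ((\<delta>\<^sub>1 * ln x / lq - 1) / (16 * u)) = W - c / (16 * u)"
      using lq u by (simp add: W_def field_simps)
    have 4: "c / (16 * u) \<le> 1" using c u by (simp add: divide_le_eq)
    have 5: "c * (real d / (16 * u) - 1) = c * (real d / (16 * u)) - c" by (simp add: algebra_simps)
    show ?thesis using 1 2 3 4 5 Jr c by linarith
  qed
  then have "W / 2 ^ (s + 1) \<le> (real J + 3) / 2 ^ (s + 1)" by (intro divide_right_mono) auto
  also have "\<dots> \<le> real J / 2 ^ (s + 1) + 3"
  proof -
    have "(1::real) \<le> 2 ^ (s + 1)" by (rule one_le_power) simp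
    then have "3 / (2::real) ^ (s + 1) \<le> 3 / 1" by (intro divide_left_mono) auto
    then show ?thesis by (simp add: add_divide_distrib)
  qed
  finally have "- (real J / 2 ^ (s + 1)) \<le> 3 - W / 2 ^ (s + 1)" by simp
  then have "2 powr (- (real J / 2 ^ (s + 1))) \<le> 2 powr (3 - W / 2 ^ (s + 1))" by (intro powr_mono) auto
  also have "\<dots> = 8 * 2 powr (- (W / 2 ^ (s + 1)))" by (simp add: powr_diff powr_minus_divide)
  also have "2 powr (- (W / 2 ^ (s + 1))) = x powr (- (\<delta>\<^sub>1 * c * ln 2 / (16 * u * ln (real q) * 2 ^ (s + 1))))"
    using x by (simp add: powr_def W_def lq_def)
  finally show ?thesis .
qed

lemma max_AP_error_le:
  assumes "x > 0" "\<And>y z r. 0 \<le> y \<Longrightarrow> y < z \<Longrightarrow> z - y \<le> x \<Longrightarrow> AP_error q b a m y z r \<le> B"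
  shows "max_AP_error q b a x m \<le> B"
  unfolding max_AP_error_def
proof (rule cSUP_least[OF interval_pairs_nonempty[OF assms(1)]])
  fix p :: "real \<times> real" assume "p \<in> {(y, z). 0 \<le> y \<and> y < z \<and> z - y \<le> x}"
  then obtain y z where p: "p = (y, z)" "0 \<le> y" "y < z" "z - y \<le> x" by auto
  have "(SUP r\<in>{r. 0 \<le> r}. AP_error q b a m y z r) \<le> B"
    using assms(2)[OF p(2-4)] by (intro cSUP_least) auto
  then show "(case p of (y, z) \<Rightarrow> SUP r\<in>{r. 0 \<le> r}. AP_error q b a m y z r) \<le> B" by (simp add: p)
qed

lemma distribution_bound_eta_admissible:
  fixes \<delta>\<^sub>1 \<delta>\<^sub>2 :: real and b q :: nat
  assumes \<delta>: "0 < \<delta>\<^sub>1" "\<delta>\<^sub>1 \<le> \<delta>\<^sub>2" "\<delta>\<^sub>2 < 1" and b: "b \<ge> 2" and q: "q \<ge> 2" and cop: "gcd b (q - 1) = 1"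
  shows "eta_admissible \<delta>\<^sub>1 \<delta>\<^sub>2 b q > 0" "\<exists>C>0. distribution_bound \<delta>\<^sub>1 \<delta>\<^sub>2 b q C (eta_admissible \<delta>\<^sub>1 \<delta>\<^sub>2 b q)"
proof -
  define \<eta> where "\<eta> = eta_admissible \<delta>\<^sub>1 \<delta>\<^sub>2 b q"
  define u where "u = 1 / (1 - \<delta>\<^sub>2)"
  define s where "s = nat \<lceil>3 * u\<rceil>"
  have u1: "u > 1" using \<delta> by (simp add: u_def less_divide_eq)
  have s: "3 * u \<le> real s" "real s \<le> 3 * u + 1" unfolding s_def using u1 by linarith+
  obtain a where a: "s + 1 < q ^ a" "q ^ a \<le> q * (s + 1)" using power_between[OF q, of "s + 1"] by auto
  \<comment> \<open>The same \<open>a\<close> serves for both parts of the block; choosing it with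
    \<open>q ^ a \<le> q * (s + 1)\<close> keeps \<open>q ^ L0\<close> polynomial in
    \<open>s\<close>.\<close>
  define L0 where "L0 = a + a + 2"
  have L0P: "q ^ L0 \<le> q ^ 4 * (s + 1) ^ 2"
  proof -
    have "q ^ L0 = q\<^sup>2 * (q ^ a)\<^sup>2" by (simp add: L0_def power_add power2_eq_square mult_ac)
    also have "\<dots> \<le> q\<^sup>2 * (q * (s + 1))\<^sup>2" using a by (intro mult_le_mono2 power_mono) auto
    also have "\<dots> = q ^ 4 * (s + 1) ^ 2" by (simp only: power_mult_distrib mult.assoc[symmetric] power_add[symmetric]) simp
    finally show ?thesis .
  qed
  have L01: "L0 \<ge> 2" by (simp add: L0_def)
  note eta = eta_bounds[OF \<delta> b q u_def s(2) _ L0P]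
  show pos: "eta_admissible \<delta>\<^sub>1 \<delta>\<^sub>2 b q > 0" using eta(1) L01 by simp
  define G where "G = real (q ^ L0) ^ (s + 2)"
  define dl where "dl = 1 / real b ^ 2"
  define \<gamma> where "\<gamma> = dl / G"
  define lq where "lq = ln (real q)"
  \<comment> \<open>The ratio of \<open>J\<close> to \<open>\<rho>\<close> at which the hypothesis
    of \<open>decay_estimate\<close> becomes an equality.\<close>
  define c0 where "c0 = \<gamma> / (real L0 * (2 * real s + 5) * lq)"
  have l2: "ln 2 \<ge> (2/3 :: real)" by (rule ln2_ge_two_thirds)
  have lq: "lq \<ge> ln 2" unfolding lq_def using q by simp
  have G1: "G \<ge> 1" unfolding G_def using q by (intro one_le_power) simp
  have dl: "0 < dl" "dl \<le> 1/4"
  proof -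
    have "(2::real) ^ 2 \<le> real b ^ 2" using b by (intro power_mono) auto
    then show "dl \<le> 1/4" unfolding dl_def using b by (simp add: divide_le_eq)
    show "0 < dl" unfolding dl_def using b by simp
  qed
  have \<gamma>: "0 < \<gamma>" "\<gamma> \<le> 1/4"
  proof -
    show "0 < \<gamma>" unfolding \<gamma>_def using dl G1 by simp
    have "\<gamma> \<le> dl / 1" unfolding \<gamma>_def using dl G1 by (intro divide_left_mono) auto
    then show "\<gamma> \<le> 1/4" using dl by simp
  qed
  have den: "real L0 * (2 * real s + 5) * lq \<ge> 2 * 5 * (2/3)"
    using L01 lq l2 by (intro mult_mono) auto
  have c0: "0 < c0" "c0 \<le> 1/9"
  proof -
    show "0 < c0" unfolding c0_def using \<gamma> den by (intro divide_pos_pos) auto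
    have "c0 \<le> (1/4) / (2 * 5 * (2/3))" unfolding c0_def using \<gamma> den by (intro frac_le) auto
    then show "c0 \<le> 1/9" by simp
  qed
  define \<eta>1 where "\<eta>1 = \<delta>\<^sub>1 * c0 * ln 2 / (16 * u * ln (real q) * 2 ^ (s + 1))"
  have \<eta>1: "\<eta> \<le> \<eta>1"
  proof -
    have "\<eta>1 = \<delta>\<^sub>1 * ln 2 / (16 * u * (ln (real q))\<^sup>2 * 2 ^ (s + 1) * real L0 * (2 * real s + 5) * real b ^ 2 * real (q ^ L0) ^ (s + 2))"
      unfolding \<eta>1_def c0_def \<gamma>_def dl_def G_def lq_def by (simp add: power2_eq_square mult_ac)
    then show ?thesis using eta(3) L01 by (simp add: \<eta>_def)
  qed
  have \<eta>2: "\<eta> \<le> 1 - \<delta>\<^sub>2" using eta(2) L01 by (simp add: \<eta>_def)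
  define A where "A = real q * exp 1"
  have A: "A \<ge> 0" by (simp add: A_def)
  define C1 where "C1 = average_const q s A"
  have C1: "C1 \<ge> 0" unfolding C1_def average_const_def using A vdc_const_ge_1[of "s + 1"]
    by (intro add_nonneg_nonneg mult_nonneg_nonneg) auto
  define w where "w = exp (2 * of_real pi * \<i> / of_nat b)"
  have nw: "norm w = 1" unfolding w_def using norm_exp_i_times[of "2 * pi / real b"] by (simp add: mult_ac)
  \<comment> \<open>The place of the coprimality assumption: for 0 < l < b, the modulus
    \<open>b\<close> does not divide \<open>l * (q - 1)\<close>, so the ratio of the two special
    phases is a root of unity other than 1.\<close>
  have gap: "norm (1 + (w ^ l) ^ (q - 1)) \<le> 2 - dl" if l: "1 \<le> l" "l < b" for l
    unfolding dl_def
  proof (rule root_of_unity_gap[OF _ _ b])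
    have wt: "w ^ t = exp (2 * of_real pi * \<i> * of_nat t / of_nat b)" for t
      by (simp add: w_def exp_of_nat_mult[symmetric] mult_ac)
    have w1: "w ^ t = 1 \<longleftrightarrow> b dvd t" for t unfolding wt using complex_root_unity_eq_1[of b t] b by simp
    show "((w ^ l) ^ (q - 1)) ^ b = 1" unfolding power_mult[symmetric] w1 by simp
    show "(w ^ l) ^ (q - 1) \<noteq> 1"
    proof
      assume "(w ^ l) ^ (q - 1) = 1"
      then have "b dvd l * (q - 1)" unfolding power_mult[symmetric] w1 .
      moreover have "coprime b (q - 1)" using cop by (rule iffD2[OF coprime_iff_gcd_eq_1])
      ultimately have "b dvd l" using coprime_dvd_mult_left_iff by blast
      then show False using l by (auto dest: dvd_imp_le)
    qed
  qed
  define C where "C = 8 * (3 * C1 + real q) + 3 * real q"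
  have "C > 0" unfolding C_def using C1 q by (intro add_nonneg_pos) auto
  moreover have "distribution_bound \<delta>\<^sub>1 \<delta>\<^sub>2 b q C \<eta>"
    unfolding distribution_bound_def
  proof (intro allI impI)
    fix x :: real and D a' :: int
    assume x0: "0 < x" and D1: "x powr \<delta>\<^sub>1 \<le> real_of_int D" and D2: "real_of_int D \<le> x powr \<delta>\<^sub>2"
    have "0 < x powr \<delta>\<^sub>1" using x0 by simp
    then have Dpos: "D \<ge> 1" using D1 by linarith
    have x1: "x \<ge> 1"
    proof (rule ccontr)
      assume "\<not> x \<ge> 1"
      then have "x powr \<delta>\<^sub>2 < 1 powr \<delta>\<^sub>2" using x0 \<delta> by (intro powr_less_mono2) auto
      then show False using D2 Dpos by simp
    qed
    define n where "n = nat D"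
    have n: "real n = real_of_int D" "int n = D" "n \<ge> 1" using Dpos by (auto simp: n_def)
    obtain d where d: "q ^ d \<le> n" "n < q ^ (d + 1)" using ex_power_ivl1[OF q n(3)] by blast
    define \<rho> where "\<rho> = nat \<lfloor>real d / (16 * u)\<rfloor>"
    define J where "J = nat \<lfloor>c0 * real \<rho>\<rfloor>"
    define \<theta> where "\<theta> = 2 powr (- (real J / 2 ^ (s + 1)))"
    have Dr: "real_of_int D \<ge> 1" using Dpos by simp
    have card: "real (card {D<..int q * D}) \<le> real q * real_of_int D"
    proof -
      have "card {D<..int q * D} = nat (int q * D - D)" by simp
      also have "real \<dots> \<le> real_of_int (int q * D)" using Dpos q by simp
      finally show ?thesis by simp
    qed
    have main: "(\<Sum>m\<in>{D<..int q * D}. max_AP_error q b a' x m) \<le> (3 * C1 + real q) * (x * \<theta>) + 3 * real q * real_of_int D"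
    proof (cases "J = 0")
      \<comment> \<open>Here \<open>D\<close> is bounded and \<open>\<theta> = 1\<close>, so nothing
        has to be saved: blocks of length 1 and \<open>Y = 1\<close> give the trivial
        estimate.\<close>
      case True
      have "(\<Sum>m\<in>{D<..int q * D}. max_AP_error q b a' x m) \<le> (\<Sum>m\<in>{D<..int q * D}. x / D + 3)"
      proof (intro sum_mono max_AP_error_le x0)
        fix m r :: int and y z :: real
        assume m: "m \<in> {D<..int q * D}" and y: "0 \<le> y" "y < z" "z - y \<le> x"
        have "AP_error q b a' m y z r \<le> ((z - y) / m + 1 + real 1) * 1 + 1"
        proof (rule AP_error_le_exponential_sums[OF q b w_def _ y(1,2)])
          fix l r K :: nat assume "K \<le> 1"
          have "norm (\<Sum>k<K. (w ^ l) ^ digit_sum q (r + nat m * k)) \<le> (\<Sum>k<K. 1)"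
            by (intro sum_norm_le) (simp add: norm_power nw)
          then show "norm (\<Sum>k<K. (w ^ l) ^ digit_sum q (r + nat m * k)) \<le> real 1 * 1" using \<open>K \<le> 1\<close> by simp
        qed (use m Dpos in auto)
        also have "(z - y) / m \<le> x / D" using m y Dpos by (intro frac_le) auto
        finally show "AP_error q b a' m y z r \<le> x / D + 3" by simp
      qed
      also have "\<dots> = real (card {D<..int q * D}) * (x / D + 3)" by simp
      also have "\<dots> \<le> (real q * real_of_int D) * (x / D + 3)" using card x0 Dr by (intro mult_right_mono) auto
      also have "\<dots> = real q * x + 3 * real q * real_of_int D" using Dr by (simp add: field_simps)
      also have "\<dots> \<le> (3 * C1 + real q) * (x * \<theta>) + 3 * real q * real_of_int D"
        using True C1 x0 by (simp add: \<theta>_def mult_right_mono)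
      finally show ?thesis .
    next
      case False
      have J1: "1 \<le> J" using False by simp
      have Jc: "real J \<le> c0 * real \<rho>" unfolding J_def using c0 by (simp add: of_nat_floor)
      have "c0 * real \<rho> \<le> (1/9) * real \<rho>" using c0 by (intro mult_right_mono) auto
      then have J9: "real J \<le> real \<rho> / 9" using Jc by simp
      note lp = level_params_choice[OF q d u1 s(1) \<rho>_def J1 J9]
      interpret level_params q d \<rho> J s n by (rule lp(1))
      have decay: "real q ^ ((2 * s + 2) * J + 1) * (1 - dl / real (q ^ L0) ^ (s + 2)) ^ ((\<rho> - J) div L0) \<le> A / 2 ^ J"
        unfolding G_def[symmetric] \<gamma>_def[symmetric] A_def
      proof (rule decay_estimate[OF q \<gamma>])
        show "L0 \<ge> 1" using L01 by simp
        show "J \<le> \<rho>" using J9 by linarith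
        have "real J * (real L0 * (2 * real s + 5) * lq) \<le> c0 * real \<rho> * (real L0 * (2 * real s + 5) * lq)"
          using Jc den by (intro mult_right_mono) auto
        also have "\<dots> = \<gamma> * real \<rho>"
        proof -
          have "\<gamma> / t * real \<rho> * t = \<gamma> * real \<rho>" if "t \<noteq> 0" for t using that by simp
          then show ?thesis unfolding c0_def using den by force
        qed
        finally show "real J * (real L0 * (2 * real s + 5) * ln (real q)) \<le> \<gamma> * real \<rho>" by (simp add: lq_def)
      qed
      obtain Y where Y: "\<And>m. Y m \<ge> 0"
        "\<And>m z r K. n < m \<Longrightarrow> m \<le> q * n \<Longrightarrow> norm (z::complex) = 1 \<Longrightarrow> norm (1 + z ^ (q - 1)) \<le> 2 - dl \<Longrightarrow> K \<le> N \<Longrightarrow>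
           norm (\<Sum>k<K. z ^ digit_sum q (r + m * k)) / N \<le> Y m"
        "(\<Sum>m\<in>{n<..q * n}. Y m) \<le> average_const q s A * (real n * 2 powr (- (real J / 2 ^ (s + 1))))"
        using exponential_sums_on_average[OF A decay L0_def a(1) less_imp_le[OF a(1)]] by blast
      have Npos: "N > 0" using q by (simp add: N_def)
      \<comment> \<open>The reason for taking \<rho> about d / (16 u):
        \<open>N = q ^ (15 * \<rho>)\<close> is at most D to the power 1 -
        \<open>\<delta>\<^sub>2\<close>, hence at most x / D, and the incomplete block costs no more
        than the main range.\<close>
      have ND: "real N \<le> x / D"
      proof -
        have "real N = real q powr (15 * real \<rho>)" using q by (simp add: N_def powr_realpow[symmetric])
        also have "\<dots> \<le> real q powr (real d * (1 - \<delta>\<^sub>2))"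
        proof (intro powr_mono)
          have "16 * real \<rho> \<le> real d / u" using lp(2) u1 by (simp add: field_simps)
          also have "\<dots> = real d * (1 - \<delta>\<^sub>2)" by (simp add: u_def)
          finally show "15 * real \<rho> \<le> real d * (1 - \<delta>\<^sub>2)" by linarith
        qed (use q in auto)
        also have "\<dots> = (real q ^ d) powr (1 - \<delta>\<^sub>2)" using q by (simp add: powr_powr powr_realpow[symmetric])
        also have "\<dots> \<le> real n powr (1 - \<delta>\<^sub>2)"
          using D_real(1) \<delta> by (intro powr_mono2) auto
        also have "\<dots> \<le> x powr (1 - \<delta>\<^sub>2)"
        proof (intro powr_mono2)
          have "x powr \<delta>\<^sub>2 \<le> x powr 1" using x1 \<delta> by (intro powr_mono) auto
          then show "real n \<le> x" using D2 n x0 by simp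
        qed (use \<delta> in auto)
        also have "\<dots> = x / x powr \<delta>\<^sub>2" using x0 by (simp add: powr_diff)
        also have "\<dots> \<le> x / D" using D2 Dr x0 by (intro divide_left_mono) auto
        finally show ?thesis .
      qed
      have "(\<Sum>m\<in>{D<..int q * D}. max_AP_error q b a' x m) \<le> (\<Sum>m\<in>{D<..int q * D}. 3 * (x / D) * Y (nat m) + 1)"
      proof (intro sum_mono max_AP_error_le x0)
        fix m r :: int and y z :: real
        assume m: "m \<in> {D<..int q * D}" and y: "0 \<le> y" "y < z" "z - y \<le> x"
        have mn: "n < nat m" "nat m \<le> q * n"
        proof -
          show "n < nat m" using m Dpos by (auto simp: n_def)
          have "m \<le> int (q * n)" using m n by simp
          then show "nat m \<le> q * n" by linarith
        qed
        have "AP_error q b a' m y z r \<le> ((z - y) / m + 1 + real N) * Y (nat m) + 1"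
        proof (rule AP_error_le_exponential_sums[OF q b w_def _ y(1,2) _ Npos Y(1)])
          fix l r K :: nat assume l: "1 \<le> l" "l < b" "K \<le> N"
          have "norm (\<Sum>k<K. (w ^ l) ^ digit_sum q (r + nat m * k)) / N \<le> Y (nat m)"
            by (rule Y(2)[OF mn _ gap[OF l(1,2)] l(3)]) (simp add: norm_power nw)
          then show "norm (\<Sum>k<K. (w ^ l) ^ digit_sum q (r + nat m * k)) \<le> real N * Y (nat m)"
            using Npos by (simp add: field_simps)
        qed (use m Dpos in auto)
        also have "((z - y) / m + 1 + real N) * Y (nat m) \<le> 3 * (x / D) * Y (nat m)"
        proof (intro mult_right_mono Y(1))
          have "(z - y) / m \<le> x / D" using m y Dpos by (intro frac_le) auto
          moreover have "1 \<le> real N" using Npos by simp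
          ultimately show "(z - y) / m + 1 + real N \<le> 3 * (x / D)" using ND by linarith
        qed
        finally show "AP_error q b a' m y z r \<le> 3 * (x / D) * Y (nat m) + 1" by simp
      qed
      also have "\<dots> = 3 * (x / D) * (\<Sum>m\<in>{D<..int q * D}. Y (nat m)) + real (card {D<..int q * D})"
        by (simp add: sum.distrib sum_distrib_left)
      also have "(\<Sum>m\<in>{D<..int q * D}. Y (nat m)) = (\<Sum>m\<in>{n<..q * n}. Y m)"
      proof (rule sum.reindex_bij_witness[of _ int nat])
        fix m assume m: "m \<in> {D<..int q * D}"
        then show "int (nat m) = m" using Dpos by simp
        have "m \<le> int (q * n)" using m n by simp
        moreover have "int n < m" using m n by simp
        ultimately have "n < nat m" "nat m \<le> q * n" by linarith+
        then show "nat m \<in> {n<..q * n}" by simp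
      next
        fix m assume "m \<in> {n<..q * n}"
        then have "int n < int m" "int m \<le> int (q * n)" by (auto simp del: of_nat_mult)
        then show "int m \<in> {D<..int q * D}" using n by simp
      qed auto
      also have "3 * (x / D) * (\<Sum>m\<in>{n<..q * n}. Y m) \<le> 3 * (x / D) * (C1 * (real n * \<theta>))"
        using Y(3) x0 Dr by (intro mult_left_mono) (auto simp: C1_def \<theta>_def)
      also have "\<dots> = 3 * C1 * (x * \<theta>)" using n Dr by (simp add: field_simps)
      finally have "(\<Sum>m\<in>{D<..int q * D}. max_AP_error q b a' x m) \<le> 3 * C1 * (x * \<theta>) + real q * real_of_int D"
        using card by linarith
      moreover have "0 \<le> real q * (x * \<theta>)" using x0 by (simp add: \<theta>_def)
      moreover have "0 \<le> real q * real_of_int D" using Dr by simp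
      ultimately show ?thesis by (simp add: algebra_simps)
    qed
    have "\<theta> \<le> 8 * x powr (- \<eta>1)"
      unfolding \<theta>_def \<eta>1_def
    proof (rule saving_estimate[OF q x1 _ d(2) u1 \<delta>(1) c0(1) _ \<rho>_def J_def])
      show "x powr \<delta>\<^sub>1 \<le> real n" using D1 n by simp
      show "c0 \<le> 1" using c0 by simp
    qed
    also have "x powr (- \<eta>1) \<le> x powr (- \<eta>)" using x1 \<eta>1 by (intro powr_mono) auto
    finally have "x * \<theta> \<le> x * (8 * x powr (- \<eta>))" using x0 by (intro mult_left_mono) auto
    also have "\<dots> = 8 * x powr (1 - \<eta>)" using x0 by (simp add: powr_diff powr_minus divide_inverse)
    finally have 1: "(3 * C1 + real q) * (x * \<theta>) \<le> (3 * C1 + real q) * (8 * x powr (1 - \<eta>))"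
      using C1 by (intro mult_left_mono) auto
    \<comment> \<open>The errors of size O(1) for each of the O(D) moduli are absorbed by
      \<open>\<eta> \<le> 1 - \<delta>\<^sub>2\<close>.\<close>
    have "x powr \<delta>\<^sub>2 \<le> x powr (1 - \<eta>)" using x1 \<eta>2 by (intro powr_mono) auto
    then have "real_of_int D \<le> x powr (1 - \<eta>)" using D2 by linarith
    then have 2: "3 * real q * real_of_int D \<le> 3 * real q * x powr (1 - \<eta>)" by (intro mult_left_mono) auto
    show "(\<Sum>m\<in>{D<..int q * D}. max_AP_error q b a' x m) \<le> C * x powr (1 - \<eta>)"
      using main 1 2 by (simp add: C_def algebra_simps)
  qed
  ultimately show "\<exists>C>0. distribution_bound \<delta>\<^sub>1 \<delta>\<^sub>2 b q C (eta_admissible \<delta>\<^sub>1 \<delta>\<^sub>2 b q)"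
    unfolding \<eta>_def by blast
qed

theorem theorem4:
  fixes \<delta>\<^sub>1 \<delta>\<^sub>2 :: real and b q :: nat
  assumes "0 < \<delta>\<^sub>1" and "\<delta>\<^sub>1 \<le> \<delta>\<^sub>2" and "\<delta>\<^sub>2 < 1"
    and "b \<ge> 2" and "q \<ge> 2" and "gcd b (q - 1) = 1"
  shows "(\<exists>C > 0. \<exists>\<eta> > 0. distribution_bound \<delta>\<^sub>1 \<delta>\<^sub>2 b q C \<eta>) \<and>
         eta_admissible \<delta>\<^sub>1 \<delta>\<^sub>2 b q > 0 \<and>
         (\<exists>C > 0. distribution_bound \<delta>\<^sub>1 \<delta>\<^sub>2 b q C (eta_admissible \<delta>\<^sub>1 \<delta>\<^sub>2 b q))"
  using distribution_bound_eta_admissible[OF assms] by blast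

end
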